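(* Let $G\leq\mathrm{Sym}(n)$ be a Frobenius group with Frobenius complement $H$ and Frobenius kernel $K$, so $G=KH$. Then the derangement graph $\Gamma_G$ is the disjoint union of $|H|$ copies of the complete graph on $n$ vertices.
   Context: A transitive permutation group $G\leq\mathrm{Sym}(n)$ is a Frobenius group if no non-identity element fixes more than one point and some non-identity element fixes a point. A Frobenius complement is a non-trivial proper subgroup $H$ with $H\cap g^{-1}Hg=\{\mathrm{id}\}$ for all $g\in G\setminus H$. The Frobenius kernel is $K=\left(G\setminus\bigcup_{g\in G}g^{-1}Hg\right)\cup\{\mathrm{id}\}$. The derangement graph $\Gamma_G$ has vertex set $G$, with $\sigma,\pi$ adjacent iff $\sigma\pi^{-1}$ is a derangement (has no fixed point in $\{1,\dots,n\}$). *)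

theory Defs
  imports "HOL-Combinatorics.Permutations"
begin

definition perm_group :: "nat \<Rightarrow> (nat \<Rightarrow> nat) set \<Rightarrow> bool" where
  "perm_group n G \<longleftrightarrow> (\<forall>g\<in>G. g permutes {1..n}) \<and> id \<in> G \<and>
     (\<forall>g\<in>G. \<forall>h\<in>G. g \<circ> h \<in> G) \<and> (\<forall>g\<in>G. inv g \<in> G)"

definition transitive_on :: "nat \<Rightarrow> (nat \<Rightarrow> nat) set \<Rightarrow> bool" where
  "transitive_on n G \<longleftrightarrow> (\<forall>x\<in>{1..n}. \<forall>y\<in>{1..n}. \<exists>g\<in>G. g x = y)"

definition fixed_points :: "nat \<Rightarrow> (nat \<Rightarrow> nat) \<Rightarrow> nat set" where
  "fixed_points n g = {x\<in>{1..n}. g x = x}"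

definition derangement :: "nat \<Rightarrow> (nat \<Rightarrow> nat) \<Rightarrow> bool" where
  "derangement n g \<longleftrightarrow> fixed_points n g = {}"

definition frobenius_group :: "nat \<Rightarrow> (nat \<Rightarrow> nat) set \<Rightarrow> bool" where
  "frobenius_group n G \<longleftrightarrow> perm_group n G \<and> transitive_on n G \<and>
     (\<forall>g\<in>G. g \<noteq> id \<longrightarrow> card (fixed_points n g) \<le> 1) \<and>
     (\<exists>g\<in>G. g \<noteq> id \<and> fixed_points n g \<noteq> {})"

definition subgroup_of :: "nat \<Rightarrow> (nat \<Rightarrow> nat) set \<Rightarrow> (nat \<Rightarrow> nat) set \<Rightarrow> bool" where
  "subgroup_of n H G \<longleftrightarrow> H \<subseteq> G \<and> perm_group n H"

definition frobenius_complement ::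
  "nat \<Rightarrow> (nat \<Rightarrow> nat) set \<Rightarrow> (nat \<Rightarrow> nat) set \<Rightarrow> bool" where
  "frobenius_complement n G H \<longleftrightarrow> subgroup_of n H G \<and> H \<noteq> {id} \<and> H \<noteq> G \<and>
     (\<forall>g\<in>G - H. H \<inter> {inv g \<circ> h \<circ> g | h. h \<in> H} = {id})"

definition frobenius_kernel ::
  "(nat \<Rightarrow> nat) set \<Rightarrow> (nat \<Rightarrow> nat) set \<Rightarrow> (nat \<Rightarrow> nat) set" where
  "frobenius_kernel G H =
     (G - (\<Union>g\<in>G. {inv g \<circ> h \<circ> g | h. h \<in> H})) \<union> {id}"

definition derangement_adj :: "nat \<Rightarrow> (nat \<Rightarrow> nat) \<Rightarrow> (nat \<Rightarrow> nat) \<Rightarrow> bool" where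
  "derangement_adj n \<sigma> \<pi> \<longleftrightarrow> derangement n (\<sigma> \<circ> inv \<pi>)"

definition disjoint_union_of_complete ::
  "'a set \<Rightarrow> ('a \<Rightarrow> 'a \<Rightarrow> bool) \<Rightarrow> nat \<Rightarrow> nat \<Rightarrow> bool" where
  "disjoint_union_of_complete V E m k \<longleftrightarrow>
     (\<exists>P. P \<subseteq> Pow V \<and> \<Union>P = V \<and> (\<forall>A\<in>P. \<forall>B\<in>P. A \<noteq> B \<longrightarrow> A \<inter> B = {}) \<and>
          finite P \<and> card P = m \<and> (\<forall>A\<in>P. finite A \<and> card A = k) \<and>
          (\<forall>x\<in>V. \<forall>y\<in>V. E x y \<longleftrightarrow> x \<noteq> y \<and> (\<exists>A\<in>P. x \<in> A \<and> y \<in> A)))"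

end

theory Submission
  imports Defs "HOL-Algebra.Group_Action" "HOL-Algebra.Sylow" "Jordan_Normal_Form.Schur_Decomposition"
begin

text \<open>
  A point stabilizer \<open>S\<close> of a Frobenius group is malnormal, i.e. it meets its other conjugates trivially.
  By the theorem of Frobenius its kernel \<open>N\<close>, consisting of the identity and the derangements, is a
  subgroup. Hence \<open>\<sigma>\<close> and \<open>\<pi>\<close> are equal or adjacent iff they lie in the same coset of \<open>N\<close>, and counting
  gives \<open>|N| = n\<close> and \<open>|S|\<close> cosets.

  For the theorem of Frobenius, every irreducible character of \<open>S\<close> is extended to a virtual character of
  norm one that is constant on \<open>N\<close>; it is irreducible up to sign, so its kernel is a subgroup, and \<open>N\<close> is
  the intersection of these kernels. Representations are modelled by self-adjoint idempotents of the
  group algebra, and the integrality of inner products of characters is that of traces of idempotents.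

  The given complement \<open>H\<close> need not be a point stabilizer a priori. A conjugate of \<open>H\<close> meets \<open>S\<close>
  nontrivially, and their intersection is malnormal in both, so \<open>|H| = |S|\<close> follows once a proper
  nontrivial malnormal subgroup \<open>S\<close> is known to have no proper nontrivial malnormal subgroup of its own.
\<close>

hide_const (open) Polynomial.order

section \<open>The group algebra and its projections\<close>

text \<open>Adjacency of \<open>\<sigma>\<close> and \<open>\<pi>\<close> depends on
  \<open>\<sigma> \<circ> inv \<pi>\<close> alone, so the graph splits into complete graphs exactly
  when \<open>N\<close> is closed under composition. This is the obstacle: counting yields the size
  of \<open>N\<close> but not its closure. The value at \<open>\<one>\<close> is a positive definite
  trace on the group algebra. Its positivity produces minimal projections and, through them, Schur's
  lemma. No list of all irreducible characters is needed to recognize a virtual character of norm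
  one: a single minimal projection whose pairing \<open>c\<close> with it is nonzero suffices,
  because \<open>c\<close> is an integer and the squared distance to \<open>c\<close> times that
  character is \<open>|G| (1 - c\<^sup>2)\<close>, which cannot be negative. For the order of the
  complement, the theorem of Frobenius is applied once more inside \<open>H\<close>, to a supposed
  malnormal subgroup \<open>L\<close>. The products over orbits need an abelian group normalized by
  \<open>H\<close>; it is the centre of an \<open>H\<close>-invariant Sylow subgroup of the kernel,
  found by a Frattini argument and counting rather than by a conjugacy theorem for
  complements.\<close>

definition conv :: "('a, 'b) monoid_scheme \<Rightarrow> ('a \<Rightarrow> complex) \<Rightarrow> ('a \<Rightarrow> complex) \<Rightarrow> 'a \<Rightarrow> complex"
  where "conv G f g z = (if z \<in> carrier G then \<Sum>x\<in>carrier G. f x * g (inv\<^bsub>G\<^esub> x \<otimes>\<^bsub>G\<^esub> z) else 0)"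

definition star :: "('a, 'b) monoid_scheme \<Rightarrow> ('a \<Rightarrow> complex) \<Rightarrow> 'a \<Rightarrow> complex"
  where "star G f z = (if z \<in> carrier G then cnj (f (inv\<^bsub>G\<^esub> z)) else 0)"

definition supported :: "('a, 'b) monoid_scheme \<Rightarrow> ('a \<Rightarrow> complex) \<Rightarrow> bool"
  where "supported G f \<longleftrightarrow> (\<forall>z. z \<notin> carrier G \<longrightarrow> f z = 0)"

definition projection :: "('a, 'b) monoid_scheme \<Rightarrow> ('a \<Rightarrow> complex) \<Rightarrow> bool"
  where "projection G e \<longleftrightarrow> supported G e \<and> star G e = e \<and> conv G e e = e"

text \<open>For an idempotent \<open>e\<close>, \<open>chr G e\<close> is the character of \<open>G\<close> on the left ideal generated by \<open>e\<close> in the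
  group algebra. If \<open>e\<close> is supported on a subgroup \<open>H\<close>, it is the character induced by \<open>chr H e\<close>, so that
  induction of characters amounts to extending functions by zero.\<close>
definition chr :: "('a, 'b) monoid_scheme \<Rightarrow> ('a \<Rightarrow> complex) \<Rightarrow> 'a \<Rightarrow> complex"
  where "chr G e g = (\<Sum>x\<in>carrier G. e (inv\<^bsub>G\<^esub> x \<otimes>\<^bsub>G\<^esub> inv\<^bsub>G\<^esub> g \<otimes>\<^bsub>G\<^esub> x))"

text \<open>For idempotents \<open>e\<close> and \<open>f\<close> this is the dimension of \<open>f \<complex>[G] e\<close>.\<close>
definition pairing :: "('a, 'b) monoid_scheme \<Rightarrow> ('a \<Rightarrow> complex) \<Rightarrow> ('a \<Rightarrow> complex) \<Rightarrow> complex"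
  where "pairing G f e = (\<Sum>u\<in>carrier G. f u * chr G e u)"

section \<open>Convolution, involution and characters\<close>

locale finite_group = group G for G :: "('a, 'b) monoid_scheme" (structure) +
  assumes fin [simp]: "finite (carrier G)"
begin

lemma order_pos: "order G > 0"
  by (simp add: order_gt_0_iff_finite)

lemma conv_supported: "supported G (conv G f g)"
  by (simp add: supported_def conv_def)

lemma sum_left_mult:
  assumes "a \<in> carrier G"
  shows "(\<Sum>x\<in>carrier G. F (a \<otimes> x)) = (\<Sum>x\<in>carrier G. F x)"
  by (rule sum.reindex_bij_witness[where i = "\<lambda>x. inv a \<otimes> x" and j = "\<lambda>x. a \<otimes> x"])
    (use assms in \<open>auto simp: m_assoc[symmetric]\<close>)

lemma sum_right_mult:
  assumes "a \<in> carrier G"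
  shows "(\<Sum>x\<in>carrier G. F (x \<otimes> a)) = (\<Sum>x\<in>carrier G. F x)"
  by (rule sum.reindex_bij_witness[where i = "\<lambda>x. x \<otimes> inv a" and j = "\<lambda>x. x \<otimes> a"])
    (use assms in \<open>auto simp: m_assoc\<close>)

lemma sum_inverse: "(\<Sum>x\<in>carrier G. F (inv x)) = (\<Sum>x\<in>carrier G. F x)"
  by (rule sum.reindex_bij_witness[where i = "\<lambda>x. inv x" and j = "\<lambda>x. inv x"]) auto

lemma sum_conj:
  assumes "a \<in> carrier G"
  shows "(\<Sum>x\<in>carrier G. F (a \<otimes> x \<otimes> inv a)) = (\<Sum>x\<in>carrier G. F x)"
  using sum_left_mult[of a "\<lambda>x. F (x \<otimes> inv a)"] sum_right_mult[of "inv a" F] assms by simp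

lemma conv_assoc: "conv G (conv G f g) h = conv G f (conv G g h)"
proof
  fix z
  show "conv G (conv G f g) h z = conv G f (conv G g h) z"
  proof (cases "z \<in> carrier G")
    case z: True
    have "conv G (conv G f g) h z =
      (\<Sum>x\<in>carrier G. \<Sum>w\<in>carrier G. f x * g (inv x \<otimes> w) * h (inv w \<otimes> z))"
      using z by (subst sum.swap) (simp add: conv_def sum_distrib_right)
    also have "\<dots> = (\<Sum>x\<in>carrier G. \<Sum>y\<in>carrier G. f x * g y * h (inv y \<otimes> (inv x \<otimes> z)))"
    proof (rule sum.cong[OF refl])
      fix x assume x: "x \<in> carrier G"
      have "(\<Sum>w\<in>carrier G. f x * g (inv x \<otimes> w) * h (inv w \<otimes> z)) =
        (\<Sum>y\<in>carrier G. f x * g (inv x \<otimes> (x \<otimes> y)) * h (inv (x \<otimes> y) \<otimes> z))"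
        by (rule sum_left_mult[OF x, symmetric])
      also have "\<dots> = (\<Sum>y\<in>carrier G. f x * g y * h (inv y \<otimes> (inv x \<otimes> z)))"
        using x z by (intro sum.cong refl) (simp add: m_assoc[symmetric] inv_mult_group)
      finally show "(\<Sum>w\<in>carrier G. f x * g (inv x \<otimes> w) * h (inv w \<otimes> z)) =
        (\<Sum>y\<in>carrier G. f x * g y * h (inv y \<otimes> (inv x \<otimes> z)))" .
    qed
    also have "\<dots> = conv G f (conv G g h) z"
      using z by (simp add: conv_def sum_distrib_left mult.assoc)
    finally show ?thesis .
  qed (simp add: conv_def)
qed

lemma star_star: "supported G f \<Longrightarrow> star G (star G f) = f"
  by (auto simp: star_def supported_def)

lemma star_conv: "star G (conv G f g) = conv G (star G g) (star G f)"
proof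
  fix z
  show "star G (conv G f g) z = conv G (star G g) (star G f) z"
  proof (cases "z \<in> carrier G")
    case z: True
    have "star G (conv G f g) z = (\<Sum>x\<in>carrier G. cnj (f x) * cnj (g (inv x \<otimes> inv z)))"
      using z by (simp add: conv_def star_def)
    also have "\<dots> = (\<Sum>y\<in>carrier G. cnj (f (inv z \<otimes> y)) * cnj (g (inv (inv z \<otimes> y) \<otimes> inv z)))"
      using z by (subst sum_left_mult) auto
    also have "\<dots> = conv G (star G g) (star G f) z"
      using z by (auto simp: conv_def star_def m_assoc inv_mult_group mult.commute intro!: sum.cong)
    finally show ?thesis .
  qed (simp add: conv_def star_def)
qed

lemma conv_linear:
  "conv G (\<lambda>x. c * f x) g = (\<lambda>x. c * conv G f g x)"
  "conv G f (\<lambda>x. c * g x) = (\<lambda>x. c * conv G f g x)"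
  "conv G (\<lambda>x. f x + f' x) g = (\<lambda>x. conv G f g x + conv G f' g x)"
  "conv G f (\<lambda>x. g x + g' x) = (\<lambda>x. conv G f g x + conv G f g' x)"
  "conv G (\<lambda>x. f x - f' x) g = (\<lambda>x. conv G f g x - conv G f' g x)"
  "conv G f (\<lambda>x. g x - g' x) = (\<lambda>x. conv G f g x - conv G f g' x)"
  "conv G (\<lambda>x. 0) g = (\<lambda>x. 0)" "conv G f (\<lambda>x. 0) = (\<lambda>x. 0)"
  by (auto simp: conv_def fun_eq_iff sum_distrib_left algebra_simps sum.distrib sum_subtractf)

lemma star_linear:
  "star G (\<lambda>x. c * f x) = (\<lambda>x. cnj c * star G f x)"
  "star G (\<lambda>x. f x + f' x) = (\<lambda>x. star G f x + star G f' x)"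
  "star G (\<lambda>x. f x - f' x) = (\<lambda>x. star G f x - star G f' x)"
  "star G (\<lambda>x. 0) = (\<lambda>x. 0)"
  by (auto simp: star_def fun_eq_iff)

lemma conv_star_one: "conv G (star G f) f \<one> = of_real (\<Sum>x\<in>carrier G. (cmod (f x))\<^sup>2)"
proof -
  have "conv G (star G f) f \<one> = (\<Sum>x\<in>carrier G. cnj (f (inv x)) * f (inv x))"
    by (simp add: conv_def star_def)
  also have "\<dots> = (\<Sum>x\<in>carrier G. cnj (f x) * f x)"
    by (rule sum_inverse)
  also have "\<dots> = (\<Sum>x\<in>carrier G. of_real ((cmod (f x))\<^sup>2))"
    by (intro sum.cong refl) (metis complex_norm_square mult.commute of_real_power)
  finally show ?thesis by simp
qed

text \<open>The value of \<open>conv G (star G f) f\<close> at \<open>\<one>\<close> is the squared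
  norm of \<open>f\<close>, so the involution is proper. This is what keeps the candidate projection
  in \<open>spectral_projection\<close> from vanishing.\<close>

lemma conv_star_eq_0_iff:
  assumes "supported G f"
  shows "conv G (star G f) f = (\<lambda>x. 0) \<longleftrightarrow> f = (\<lambda>x. 0)"
proof
  assume "conv G (star G f) f = (\<lambda>x. 0)"
  then have "(\<Sum>x\<in>carrier G. (cmod (f x))\<^sup>2) = 0"
    using conv_star_one[of f] by (simp del: of_real_sum)
  then have "\<forall>x\<in>carrier G. f x = 0"
    by (simp add: sum_nonneg_eq_0_iff)
  then show "f = (\<lambda>x. 0)"
    using assms by (auto simp: supported_def)
qed (simp add: conv_linear)

lemma chr_conj:
  assumes "a \<in> carrier G" "g \<in> carrier G"
  shows "chr G e (a \<otimes> g \<otimes> inv a) = chr G e g"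
proof -
  have "chr G e (a \<otimes> g \<otimes> inv a) = (\<Sum>x\<in>carrier G. e (inv (inv a \<otimes> x) \<otimes> inv g \<otimes> (inv a \<otimes> x)))"
    unfolding chr_def using assms by (intro sum.cong refl) (simp add: inv_mult_group m_assoc)
  also have "\<dots> = chr G e g"
    unfolding chr_def using assms
    by (intro sum_left_mult[where F = "\<lambda>x. e (inv x \<otimes> inv g \<otimes> x)"]) simp
  finally show ?thesis .
qed

lemma chr_one: "chr G e \<one> = of_nat (order G) * e \<one>"
  by (simp add: chr_def Coset.order_def)

lemma chr_star:
  assumes "g \<in> carrier G"
  shows "cnj (chr G e g) = chr G (star G e) (inv g)"
  using assms by (auto simp: chr_def star_def inv_mult_group m_assoc intro!: sum.cong)

lemma chr_linear:
  "chr G (\<lambda>x. c * f x) g = c * chr G f g"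
  "chr G (\<lambda>x. f x + f' x) g = chr G f g + chr G f' g"
  "chr G (\<lambda>x. f x - f' x) g = chr G f g - chr G f' g"
  by (simp_all add: chr_def sum_distrib_left sum.distrib sum_subtractf)

text \<open>As \<open>chr G e\<close> is a class function, each of the \<open>order G\<close>
  summands of \<open>chr G f\<close> contributes the same amount after reindexing by a conjugation.
  The lemma links the Hermitian inner product of characters to \<open>pairing\<close>, which is a
  trace and hence an integer.\<close>

lemma pairing_conv_chr:
  assumes "star G f = f"
  shows "of_nat (order G) * pairing G f e = (\<Sum>g\<in>carrier G. cnj (chr G f g) * chr G e g)"
proof -
  have "cnj (chr G f g) = (\<Sum>x\<in>carrier G. f (inv x \<otimes> g \<otimes> x))" if "g \<in> carrier G" for g
    using chr_star[OF that, of f] that by (simp add: assms) (simp add: chr_def)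
  then have "(\<Sum>g\<in>carrier G. cnj (chr G f g) * chr G e g) =
    (\<Sum>x\<in>carrier G. \<Sum>g\<in>carrier G. f (inv x \<otimes> g \<otimes> x) * chr G e g)"
    by (subst sum.swap) (simp add: sum_distrib_right)
  also have "\<dots> = (\<Sum>x\<in>carrier G. pairing G f e)"
  proof (rule sum.cong[OF refl])
    fix x assume x: "x \<in> carrier G"
    have "(\<Sum>g\<in>carrier G. f (inv x \<otimes> g \<otimes> x) * chr G e g) =
      (\<Sum>g\<in>carrier G. f (inv x \<otimes> (x \<otimes> g \<otimes> inv x) \<otimes> x) * chr G e (x \<otimes> g \<otimes> inv x))"
      by (rule sum_conj[OF x, symmetric])
    also have "\<dots> = pairing G f e"
      unfolding pairing_def
    proof (rule sum.cong[OF refl])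
      fix g assume g: "g \<in> carrier G"
      have "inv x \<otimes> (x \<otimes> g \<otimes> inv x) \<otimes> x = g"
        using x g by (simp add: inv_solve_right' m_assoc) (simp add: m_assoc[symmetric])
      then show "f (inv x \<otimes> (x \<otimes> g \<otimes> inv x) \<otimes> x) * chr G e (x \<otimes> g \<otimes> inv x) = f g * chr G e g"
        using x g by (simp add: chr_conj)
    qed
    finally show "(\<Sum>g\<in>carrier G. f (inv x \<otimes> g \<otimes> x) * chr G e g) = pairing G f e" .
  qed
  finally show ?thesis by (simp add: Coset.order_def)
qed

end

section \<open>Traces of idempotent matrices and homogeneous linear systems\<close>

lemma trace_mult_commute:
  fixes A B :: "'a :: comm_ring_1 mat"
  assumes "A \<in> carrier_mat n n" "B \<in> carrier_mat n n"
  shows "(\<Sum>i<n. (A * B) $$ (i, i)) = (\<Sum>i<n. (B * A) $$ (i, i))"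
proof -
  have "(\<Sum>i<n. (A * B) $$ (i, i)) = (\<Sum>i<n. \<Sum>k<n. A $$ (i, k) * B $$ (k, i))"
    using assms by (simp add: scalar_prod_def atLeast0LessThan)
  also have "\<dots> = (\<Sum>i<n. \<Sum>k<n. B $$ (i, k) * A $$ (k, i))"
    by (subst sum.swap) (simp add: mult.commute)
  also have "\<dots> = (\<Sum>i<n. (B * A) $$ (i, i))"
    using assms by (simp add: scalar_prod_def atLeast0LessThan)
  finally show ?thesis .
qed

text \<open>Over the complex numbers \<open>A\<close> is similar to an upper triangular matrix
  \<open>B\<close>. The diagonal entries of a triangular idempotent are themselves idempotent, so
  each is 0 or 1.\<close>

lemma trace_idempotent_mat_in_Ints:
  fixes A :: "complex mat"
  assumes A: "A \<in> carrier_mat n n" and idem: "A * A = A"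
  shows "(\<Sum>i<n. A $$ (i, i)) \<in> \<int>"
proof -
  obtain as where "char_poly A = (\<Prod>a\<leftarrow>as. [:- a, 1:])"
    using char_poly_factorized[OF A] by blast
  then obtain B where B: "upper_triangular B" "similar_mat A B"
    using schur_decomposition_exists[OF A] by blast
  then obtain P Q where PQ: "P \<in> carrier_mat n n" "Q \<in> carrier_mat n n" "B \<in> carrier_mat n n"
      "P * Q = 1\<^sub>m n" "Q * P = 1\<^sub>m n" "A = P * B * Q"
    using A unfolding similar_mat_def similar_mat_wit_def Let_def by auto
  note assoc = assoc_mult_mat[where ?n\<^sub>1.0 = n and ?n\<^sub>2.0 = n and ?n\<^sub>3.0 = n and ?n\<^sub>4.0 = n]
  have B_eq: "B = Q * (A * P)"
  proof -
    have "Q * (A * P) = Q * (P * (B * (Q * P)))"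
    proof -
      have "A * P = P * (B * (Q * P))"
        unfolding PQ(6)
        by (simp only: assoc[OF mult_carrier_mat[OF PQ(1,3)] PQ(2,1)]
            assoc[OF PQ(1,3) mult_carrier_mat[OF PQ(2,1)]])
      then show ?thesis by simp
    qed
    also have "\<dots> = (Q * P) * B"
      using assoc[OF PQ(2,1,3)] PQ(3) by (simp add: PQ(5))
    finally show ?thesis using PQ(3,5) by simp
  qed
  have "B * B = Q * (A * ((P * Q) * (A * P)))"
    unfolding B_eq using PQ(1,2) A by (simp add: assoc)
  also have "\<dots> = Q * ((A * A) * P)"
    using PQ(1,2,4) A by (simp add: assoc)
  also have "\<dots> = B"
    by (simp add: idem B_eq)
  finally have BB: "B * B = B" .
  have diag: "B $$ (i, i) = 0 \<or> B $$ (i, i) = 1" if i: "i < n" for i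
  proof -
    have "B $$ (i, i) = (B * B) $$ (i, i)" by (simp add: BB)
    also have "\<dots> = (\<Sum>k<n. B $$ (i, k) * B $$ (k, i))"
      using PQ i by (simp add: scalar_prod_def atLeast0LessThan)
    also have "\<dots> = (\<Sum>k<n. if k = i then B $$ (i, i) * B $$ (i, i) else 0)"
    proof (rule sum.cong[OF refl])
      fix k assume k: "k \<in> {..<n}"
      have "B $$ (i, k) = 0" if "k < i"
        using B(1) that i PQ(3) by (auto simp: upper_triangular_def)
      moreover have "B $$ (k, i) = 0" if "i < k"
        using B(1) that k PQ(3) by (auto simp: upper_triangular_def)
      ultimately show "B $$ (i, k) * B $$ (k, i) = (if k = i then B $$ (i, i) * B $$ (i, i) else 0)"
        by (cases k i rule: linorder_cases) auto
    qed
    also have "\<dots> = B $$ (i, i) * B $$ (i, i)"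
      using i by simp
    finally show ?thesis by simp
  qed
  have "(\<Sum>i<n. A $$ (i, i)) = (\<Sum>i<n. (Q * (P * B)) $$ (i, i))"
    using trace_mult_commute[of "P * B" n Q] PQ(1-3) by (auto simp: PQ(6))
  also have "Q * (P * B) = (Q * P) * B"
    by (rule assoc[OF PQ(2,1,3), symmetric])
  also have "\<dots> = B"
    using PQ(3,5) by simp
  finally have "(\<Sum>i<n. A $$ (i, i)) = (\<Sum>i<n. B $$ (i, i))" .
  moreover have "(\<Sum>i<n. B $$ (i, i)) \<in> \<int>"
    by (rule Ints_sum) (metis Ints_0 Ints_1 diag lessThan_iff)
  ultimately show ?thesis by simp
qed

lemma trace_idempotent_kernel_in_Ints:
  fixes T :: "'a \<Rightarrow> 'a \<Rightarrow> complex"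
  assumes S: "finite S" and idem: "\<And>x y. x \<in> S \<Longrightarrow> y \<in> S \<Longrightarrow> (\<Sum>z\<in>S. T y z * T z x) = T y x"
  shows "(\<Sum>x\<in>S. T x x) \<in> \<int>"
proof -
  obtain b where b: "bij_betw b {..<card S} S"
    using ex_bij_betw_nat_finite[OF S] by (auto simp: atLeast0LessThan)
  let ?A = "mat (card S) (card S) (\<lambda>(i, j). T (b i) (b j))"
  have "?A * ?A = ?A"
  proof (rule eq_matI)
    fix i j assume "i < dim_row ?A" "j < dim_col ?A"
    then have ij: "i < card S" "j < card S" by auto
    then have "(?A * ?A) $$ (i, j) = (\<Sum>k<card S. T (b i) (b k) * T (b k) (b j))"
      by (simp add: scalar_prod_def atLeast0LessThan)
    also have "\<dots> = (\<Sum>z\<in>S. T (b i) z * T z (b j))"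
      by (rule sum.reindex_bij_betw[OF b])
    also have "\<dots> = T (b i) (b j)"
      using ij b by (intro idem) (auto simp: bij_betw_def)
    finally show "(?A * ?A) $$ (i, j) = ?A $$ (i, j)" using ij by simp
  qed auto
  then have "(\<Sum>i<card S. ?A $$ (i, i)) \<in> \<int>"
    by (intro trace_idempotent_mat_in_Ints) auto
  also have "(\<Sum>i<card S. ?A $$ (i, i)) = (\<Sum>i<card S. T (b i) (b i))"
    by simp
  also have "\<dots> = (\<Sum>x\<in>S. T x x)"
    by (rule sum.reindex_bij_betw[OF b])
  finally show ?thesis .
qed

text \<open>Gaussian elimination: an unknown \<open>j\<close> with nonzero coefficient in equation
  \<open>s\<close> is eliminated from the other equations, which costs one equation and one unknown.
  It later supplies an annihilating polynomial.\<close>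

lemma homogeneous_system_nontrivial_solution:
  fixes f :: "'i \<Rightarrow> 's \<Rightarrow> 'k :: field"
  assumes "finite S" "finite I" "card S < card I"
  shows "\<exists>c. (\<exists>i\<in>I. c i \<noteq> 0) \<and> (\<forall>s\<in>S. (\<Sum>i\<in>I. c i * f i s) = 0)"
  using assms
proof (induction S arbitrary: I f rule: finite_induct)
  case empty
  then have "I \<noteq> {}" by auto
  then show ?case by (intro exI[of _ "\<lambda>_. 1"]) auto
next
  case (insert s S)
  show ?case
  proof (cases "\<forall>i\<in>I. f i s = 0")
    case True
    have "card S < card I" using insert by simp
    from insert.IH[OF insert.prems(1) this, of f] show ?thesis
      using True by auto
  next
    case False
    then obtain j where j: "j \<in> I" "f j s \<noteq> 0" by blast
    let ?I = "I - {j}"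
    define g where "g = (\<lambda>i t. f i t - f i s / f j s * f j t)"
    have "finite ?I" "card S < card ?I"
      using insert j by auto
    from insert.IH[OF this, of g] obtain c where
      c: "\<exists>i\<in>?I. c i \<noteq> 0" "\<And>t. t \<in> S \<Longrightarrow> (\<Sum>i\<in>?I. c i * g i t) = 0" by blast
    \<comment> \<open>The value at \<open>j\<close> is forced by equation \<open>s\<close>; with it
      the old system at any \<open>t\<close> agrees with the reduced one.\<close>
    define d where "d = (\<lambda>i. if i = j then - (\<Sum>i\<in>?I. c i * f i s / f j s) else c i)"
    have sum_d: "(\<Sum>i\<in>I. d i * f i t) = (\<Sum>i\<in>?I. c i * g i t)" for t
    proof -
      have "(\<Sum>i\<in>I. d i * f i t) = d j * f j t + (\<Sum>i\<in>?I. d i * f i t)"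
        using insert.prems j by (simp add: sum.remove)
      also have "(\<Sum>i\<in>?I. d i * f i t) = (\<Sum>i\<in>?I. c i * f i t)"
        by (intro sum.cong) (auto simp: d_def)
      also have "d j * f j t = - (\<Sum>i\<in>?I. c i * (f i s / f j s * f j t))"
        by (simp add: d_def sum_distrib_right mult.assoc)
      finally show ?thesis
        by (simp add: g_def right_diff_distrib sum_subtractf)
    qed
    have "(\<Sum>i\<in>?I. c i * g i s) = 0"
      using j by (simp add: g_def)
    then have "\<forall>t\<in>insert s S. (\<Sum>i\<in>I. d i * f i t) = 0"
      using c(2) by (auto simp: sum_d)
    moreover have "\<exists>i\<in>I. d i \<noteq> 0"
      using c(1) by (auto simp: d_def)
    ultimately show ?thesis by blast
  qed
qed

text \<open>For projections \<open>conv G e p = p\<close> is the order \<open>p \<le> e\<close>,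
  since applying the involution gives \<open>conv G p e = p\<close> as well. Minimal projections
  correspond to irreducible left ideals.\<close>

definition minimal_projection :: "('a, 'b) monoid_scheme \<Rightarrow> ('a \<Rightarrow> complex) \<Rightarrow> bool"
  where "minimal_projection G e \<longleftrightarrow> projection G e \<and> e \<noteq> (\<lambda>x. 0) \<and>
    (\<forall>p. projection G p \<and> conv G e p = p \<longrightarrow> p = (\<lambda>x. 0) \<or> p = e)"

section \<open>Integrality, spectral projections and Schur's lemma\<close>

context finite_group
begin

lemma projection_conv: "projection G e \<Longrightarrow> conv G e e = e"
  by (simp add: projection_def)

lemma projection_star: "projection G e \<Longrightarrow> star G e = e"
  by (simp add: projection_def)

lemma pairing_in_Ints:
  assumes f: "conv G f f = f" and e: "conv G e e = e"
  shows "pairing G f e \<in> \<int>"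
proof -
  \<comment> \<open>\<open>T\<close> is the matrix, in the basis of group elements, of the map that
    multiplies by \<open>f\<close> on the left and by \<open>e\<close> on the right. It is
    idempotent because \<open>f\<close> and \<open>e\<close> are, and its trace is
    \<open>pairing G f e\<close>.\<close>
  define T where "T = (\<lambda>y x. \<Sum>u\<in>carrier G. f u * e (inv x \<otimes> inv u \<otimes> y))"
  have "(\<Sum>z\<in>carrier G. T y z * T z x) = T y x" if x: "x \<in> carrier G" and y: "y \<in> carrier G" for x y
  proof -
    have "(\<Sum>z\<in>carrier G. T y z * T z x) = (\<Sum>z\<in>carrier G. \<Sum>u\<in>carrier G. \<Sum>v\<in>carrier G.
        f u * f v * (e (inv x \<otimes> inv v \<otimes> z) * e (inv z \<otimes> inv u \<otimes> y)))"
      by (simp add: T_def sum_product algebra_simps)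
    also have "\<dots> = (\<Sum>u\<in>carrier G. \<Sum>v\<in>carrier G. \<Sum>z\<in>carrier G.
        f u * f v * (e (inv x \<otimes> inv v \<otimes> z) * e (inv z \<otimes> inv u \<otimes> y)))"
      by (rule trans[OF sum.swap]) (rule sum.cong[OF refl], rule sum.swap)
    also have "\<dots> = (\<Sum>u\<in>carrier G. \<Sum>v\<in>carrier G. f u * f v * e (inv x \<otimes> inv (u \<otimes> v) \<otimes> y))"
    proof (intro sum.cong refl)
      fix u v assume uv: "u \<in> carrier G" "v \<in> carrier G"
      have "(\<Sum>z\<in>carrier G. e (inv x \<otimes> inv v \<otimes> z) * e (inv z \<otimes> inv u \<otimes> y)) =
        (\<Sum>t\<in>carrier G. e (inv x \<otimes> inv v \<otimes> (v \<otimes> x \<otimes> t)) * e (inv (v \<otimes> x \<otimes> t) \<otimes> inv u \<otimes> y))"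
        using uv x by (intro sum_left_mult[symmetric]) simp
      also have "\<dots> = (\<Sum>t\<in>carrier G. e t * e (inv t \<otimes> (inv x \<otimes> inv (u \<otimes> v) \<otimes> y)))"
      proof (intro sum.cong refl)
        fix t assume t: "t \<in> carrier G"
        have "inv x \<otimes> inv v \<otimes> (v \<otimes> x \<otimes> t) = inv (v \<otimes> x) \<otimes> (v \<otimes> x) \<otimes> t"
          using uv x t by (simp add: inv_mult_group m_assoc)
        then have "inv x \<otimes> inv v \<otimes> (v \<otimes> x \<otimes> t) = t"
          using uv x t by simp
        moreover have "inv (v \<otimes> x \<otimes> t) \<otimes> inv u \<otimes> y = inv t \<otimes> (inv x \<otimes> inv (u \<otimes> v) \<otimes> y)"
          using uv x y t by (simp add: inv_mult_group m_assoc)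
        ultimately show "e (inv x \<otimes> inv v \<otimes> (v \<otimes> x \<otimes> t)) * e (inv (v \<otimes> x \<otimes> t) \<otimes> inv u \<otimes> y) =
          e t * e (inv t \<otimes> (inv x \<otimes> inv (u \<otimes> v) \<otimes> y))" by simp
      qed
      also have "\<dots> = conv G e e (inv x \<otimes> inv (u \<otimes> v) \<otimes> y)"
        using uv x y by (simp add: conv_def)
      finally show "(\<Sum>z\<in>carrier G. f u * f v * (e (inv x \<otimes> inv v \<otimes> z) * e (inv z \<otimes> inv u \<otimes> y))) =
        f u * f v * e (inv x \<otimes> inv (u \<otimes> v) \<otimes> y)"
        by (simp add: e flip: sum_distrib_left)
    qed
    also have "\<dots> = (\<Sum>u\<in>carrier G. \<Sum>w\<in>carrier G. f u * f (inv u \<otimes> w) * e (inv x \<otimes> inv w \<otimes> y))"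
    proof (rule sum.cong[OF refl])
      fix u assume u: "u \<in> carrier G"
      have "(\<Sum>v\<in>carrier G. f u * f v * e (inv x \<otimes> inv (u \<otimes> v) \<otimes> y)) =
        (\<Sum>v\<in>carrier G. f u * f (inv u \<otimes> (u \<otimes> v)) * e (inv x \<otimes> inv (u \<otimes> v) \<otimes> y))"
        using u by (intro sum.cong refl) (simp add: m_assoc[symmetric])
      also have "\<dots> = (\<Sum>w\<in>carrier G. f u * f (inv u \<otimes> w) * e (inv x \<otimes> inv w \<otimes> y))"
        by (rule sum_left_mult[OF u, of "\<lambda>w. f u * f (inv u \<otimes> w) * e (inv x \<otimes> inv w \<otimes> y)"])
      finally show "(\<Sum>v\<in>carrier G. f u * f v * e (inv x \<otimes> inv (u \<otimes> v) \<otimes> y)) =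
        (\<Sum>w\<in>carrier G. f u * f (inv u \<otimes> w) * e (inv x \<otimes> inv w \<otimes> y))" .
    qed
    also have "\<dots> = (\<Sum>w\<in>carrier G. conv G f f w * e (inv x \<otimes> inv w \<otimes> y))"
      by (subst sum.swap) (simp add: conv_def sum_distrib_right)
    finally show ?thesis by (simp add: f T_def)
  qed
  then have "(\<Sum>x\<in>carrier G. T x x) \<in> \<int>"
    by (intro trace_idempotent_kernel_in_Ints) auto
  also have "(\<Sum>x\<in>carrier G. T x x) = pairing G f e"
    unfolding T_def pairing_def chr_def by (subst sum.swap) (simp add: sum_distrib_left)
  finally show ?thesis .
qed

lemma conv_sum:
  "conv G f (\<lambda>x. \<Sum>i\<in>I. c i * g i x) = (\<lambda>x. \<Sum>i\<in>I. c i * conv G f (g i) x)"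
proof
  fix z
  show "conv G f (\<lambda>x. \<Sum>i\<in>I. c i * g i x) z = (\<Sum>i\<in>I. c i * conv G f (g i) z)"
  proof (cases "z \<in> carrier G")
    case True
    have "(\<Sum>x\<in>carrier G. f x * (\<Sum>i\<in>I. c i * g i (inv x \<otimes> z))) =
      (\<Sum>x\<in>carrier G. \<Sum>i\<in>I. c i * (f x * g i (inv x \<otimes> z)))"
      by (simp add: sum_distrib_left algebra_simps)
    also have "\<dots> = (\<Sum>i\<in>I. c i * (\<Sum>x\<in>carrier G. f x * g i (inv x \<otimes> z)))"
      by (subst sum.swap) (simp add: sum_distrib_left)
    finally show ?thesis using True by (simp add: conv_def)
  qed (simp add: conv_def)
qed

text \<open>A self-adjoint element has an annihilating polynomial. Splitting off one of its roots gives an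
  eigenvector \<open>u\<close> that is itself a polynomial in the element, hence normal, so that \<open>u\<^sup>* u\<close> is
  a nonzero multiple of a projection.\<close>
lemma spectral_projection:
  assumes e: "projection G e" and a: "star G a = a" "conv G e a = a"
    and not_scalar: "\<And>c. a \<noteq> (\<lambda>x. c * e x)"
  shows "\<exists>p. projection G p \<and> conv G e p = p \<and> p \<noteq> (\<lambda>x. 0) \<and> p \<noteq> e"
proof -
  have ae: "conv G a e = a"
    using star_conv[of e a] a projection_star[OF e] by simp
  have e_nz: "e \<noteq> (\<lambda>x. 0)"
    using not_scalar[of 0] a(2) by (auto simp: conv_linear)
  \<comment> \<open>Powers of \<open>a\<close> start from \<open>e\<close>, the unit of the corner
    containing \<open>a\<close>, so that constant polynomials evaluate to multiples of
    \<open>e\<close>.\<close>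
  define pw where "pw = rec_nat e (\<lambda>_. conv G a)"
  have pw_simps: "pw 0 = e" "pw (Suc k) = conv G a (pw k)" for k
    by (simp_all add: pw_def)
  define ev where "ev q = (\<lambda>x. \<Sum>i\<le>degree q. coeff q i * pw i x)" for q
  have ev_eq: "ev q = (\<lambda>x. \<Sum>i\<le>N. coeff q i * pw i x)" if "degree q \<le> N" for q N
    unfolding ev_def using that by (intro ext sum.mono_neutral_left) (auto simp: coeff_eq_0)
  have ev_0: "ev 0 = (\<lambda>x. 0)"
    by (simp add: ev_def)
  have ev_add: "ev (p + q) = (\<lambda>x. ev p x + ev q x)" for p q
  proof -
    let ?N = "max (degree p) (degree q)"
    have "degree (p + q) \<le> ?N" by (rule degree_add_le_max)
    then show ?thesis
      using ev_eq[of "p + q" ?N] ev_eq[of p ?N] ev_eq[of q ?N]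
      by (simp add: algebra_simps sum.distrib)
  qed
  have ev_smult: "ev (Polynomial.smult c q) = (\<lambda>x. c * ev q x)" for c q
    using ev_eq[of "Polynomial.smult c q" "degree q"]
    by (simp add: ev_def degree_smult_le sum_distrib_left mult.assoc)
  have ev_pCons: "ev (pCons c q) = (\<lambda>x. c * e x + conv G a (ev q) x)" for c q
  proof -
    have "ev (pCons c q) = (\<lambda>x. \<Sum>i\<le>Suc (degree q). coeff (pCons c q) i * pw i x)"
      by (rule ev_eq) (rule degree_pCons_le)
    also have "\<dots> = (\<lambda>x. c * e x + (\<Sum>i\<le>degree q. coeff q i * conv G a (pw i) x))"
      by (simp only: sum.atMost_Suc_shift) (simp add: pw_simps)
    finally show ?thesis by (simp add: ev_def conv_sum)
  qed
  have ee: "conv G e e = e"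
    using e by (rule projection_conv)
  have e_ev: "conv G e (ev q) = ev q" for q
    by (induction q) (simp_all add: ev_0 ev_pCons conv_linear ee conv_assoc[symmetric] a(2))
  have ev_a: "conv G (ev q) a = conv G a (ev q)" for q
    by (induction q) (simp_all add: ev_0 ev_pCons conv_linear ae a(2) conv_assoc)
  \<comment> \<open>Because \<open>a\<close> is self-adjoint, the involution only conjugates the
    coefficients; in particular \<open>star G u\<close> below is again a polynomial in
    \<open>a\<close>.\<close>
  have star_ev: "\<exists>q'. star G (ev q) = ev q'" for q
  proof (induction q)
    case 0
    show ?case by (rule exI[of _ 0]) (simp add: ev_0 star_linear)
  next
    case (pCons c q)
    then obtain q' where "star G (ev q) = ev q'" by blast
    then have "star G (ev (pCons c q)) = ev (pCons (cnj c) q')"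
      by (simp add: ev_pCons star_linear star_conv a(1) ev_a projection_star[OF e])
    then show ?case by blast
  qed
  have "\<exists>q. q \<noteq> 0 \<and> ev q = (\<lambda>x. 0)"
  proof -
    \<comment> \<open>One more power than the dimension of the group algebra, hence a linear
      dependence.\<close>
    let ?I = "{..card (carrier G)}"
    obtain c where c: "\<exists>i\<in>?I. c i \<noteq> 0" "\<And>s. s \<in> carrier G \<Longrightarrow> (\<Sum>i\<in>?I. c i * pw i s) = 0"
      using homogeneous_system_nontrivial_solution[of "carrier G" ?I pw] by auto
    define q where "q = (\<Sum>i\<in>?I. monom (c i) i)"
    have coeff_q: "coeff q i = (if i \<in> ?I then c i else 0)" for i
      by (simp add: q_def coeff_sum)
    have supp: "pw i x = 0" if "x \<notin> carrier G" for i x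
      using that e conv_supported by (cases i) (auto simp: pw_simps supported_def projection_def)
    have "degree q \<le> card (carrier G)"
      by (rule degree_le) (auto simp: coeff_q)
    then have "ev q = (\<lambda>x. \<Sum>i\<in>?I. c i * pw i x)"
      by (simp add: ev_eq coeff_q)
    also have "\<dots> = (\<lambda>x. 0)"
    proof
      fix x show "(\<Sum>i\<in>?I. c i * pw i x) = 0"
        by (cases "x \<in> carrier G") (simp_all add: c(2) supp)
    qed
    finally have "ev q = (\<lambda>x. 0)" .
    moreover have "q \<noteq> 0"
      using c(1) coeff_q by (metis coeff_0)
    ultimately show ?thesis by blast
  qed
  \<comment> \<open>Least degree matters: the cofactor \<open>r\<close> of a linear factor of
    \<open>q\<close> then does not annihilate \<open>a\<close>, so \<open>u = ev r\<close> is
    nonzero, while \<open>a u - z u = ev q = 0\<close>.\<close>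
  then obtain q where q: "q \<noteq> 0" "ev q = (\<lambda>x. 0)"
    and q_min: "\<And>r. r \<noteq> 0 \<Longrightarrow> ev r = (\<lambda>x. 0) \<Longrightarrow> degree q \<le> degree r"
    using exists_least_iff[of "\<lambda>n. \<exists>q. q \<noteq> 0 \<and> ev q = (\<lambda>x. 0) \<and> degree q = n"]
    by (metis not_less)
  have "degree q \<noteq> 0"
  proof
    assume "degree q = 0"
    then obtain c where c: "q = [:c:]" using degree_eq_zeroE by blast
    then have "c \<noteq> 0" "(\<lambda>x. c * e x) = (\<lambda>x. 0)"
      using q by (auto simp: ev_pCons ev_0 conv_linear)
    then show False using e_nz by (auto simp: fun_eq_iff)
  qed
  then have "\<not> constant (poly q)"
    by (simp add: constant_degree)
  then obtain z where "poly q z = 0"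
    using fundamental_theorem_of_algebra[of q] by blast
  then obtain r where r: "q = [:- z, 1:] * r"
    by (auto simp: poly_eq_0_iff_dvd elim: dvdE)
  have "r \<noteq> 0" using q r by auto
  then have "degree q = Suc (degree r)"
    unfolding r by (subst degree_mult_eq) auto
  then have "degree r < degree q" by simp
  define u where "u = ev r"
  have u_nz: "u \<noteq> (\<lambda>x. 0)"
    using q_min[of r] \<open>r \<noteq> 0\<close> \<open>degree r < degree q\<close> by (auto simp: u_def)
  have au: "conv G a u = (\<lambda>x. z * u x)"
  proof -
    have "q = Polynomial.smult (- z) r + pCons 0 r"
      by (simp add: r)
    then have "ev q = (\<lambda>x. - z * u x + conv G a u x)"
      by (simp only: ev_add ev_smult ev_pCons u_def) simp
    then show ?thesis
      using q(2) by (simp add: fun_eq_iff)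
  qed
  have eu: "conv G e u = u"
    by (simp add: u_def e_ev)
  \<comment> \<open>As \<open>a\<close> multiplies \<open>u\<close> by \<open>z\<close>, every
    polynomial in \<open>a\<close> multiplies \<open>u\<close> by some scalar. Applied to
    \<open>star G u\<close> and to \<open>u\<close> itself this gives \<open>w = t u\<close> and
    \<open>u u = t' u\<close>.\<close>
  have scalar: "\<exists>t. conv G (ev s) u = (\<lambda>x. t * u x)" for s
  proof (induction s)
    case 0
    show ?case by (rule exI[of _ 0]) (simp add: ev_0 conv_linear)
  next
    case (pCons c s)
    then obtain t where "conv G (ev s) u = (\<lambda>x. t * u x)" by blast
    then have "conv G (ev (pCons c s)) u = (\<lambda>x. (c + t * z) * u x)"
      by (simp add: ev_pCons conv_linear conv_assoc au eu algebra_simps)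
    then show ?case by blast
  qed
  have u_supp: "supported G u"
    using conv_supported[of e u] eu by simp
  define w where "w = conv G (star G u) u"
  obtain t where t: "w = (\<lambda>x. t * u x)"
    using star_ev[of r] scalar unfolding w_def u_def by metis
  have w_nz: "w \<noteq> (\<lambda>x. 0)"
    using conv_star_eq_0_iff[OF u_supp] u_nz by (simp add: w_def)
  have w_star: "star G w = w"
    by (simp add: w_def star_conv star_star[OF u_supp])
  have w_supp: "supported G w"
    unfolding w_def by (rule conv_supported)
  obtain t' where t': "conv G u u = (\<lambda>x. t' * u x)"
    using scalar[of r] by (auto simp: u_def)
  \<comment> \<open>Here \<open>w w = t\<^sup>2 u u = t\<^sup>2 t' u = k w\<close>, so
    \<open>w\<close> divided by \<open>k\<close> is idempotent. That \<open>k\<close> is nonzero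
    follows from positivity, as \<open>w\<close> is self-adjoint and nonzero.\<close>
  define k where "k = t * t'"
  have ww: "conv G w w = (\<lambda>x. k * w x)"
    by (simp add: t conv_linear t' k_def algebra_simps)
  have k_nz: "k \<noteq> 0"
    using conv_star_eq_0_iff[OF w_supp] w_nz ww by (auto simp: w_star)
  obtain x where x: "w x \<noteq> 0"
    using w_nz by auto
  have "(\<lambda>x. cnj k * w x) = (\<lambda>x. k * w x)"
  proof -
    have "star G (conv G w w) = conv G w w"
      by (simp only: star_conv w_star)
    then show ?thesis by (simp add: ww star_linear w_star)
  qed
  then have k_real: "cnj k = k"
    using x by (auto simp: fun_eq_iff)
  define p where "p = (\<lambda>x. inverse k * w x)"
  have "projection G p"
    unfolding projection_def
  proof (intro conjI)
    show "supported G p" using w_supp by (simp add: p_def supported_def)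
    show "star G p = p" by (simp add: p_def star_linear w_star k_real)
    show "conv G p p = p" using k_nz by (simp add: p_def conv_linear ww fun_eq_iff)
  qed
  moreover have "conv G e p = p"
    by (simp add: p_def t conv_linear eu)
  moreover have "p \<noteq> (\<lambda>x. 0)"
    using x k_nz by (auto simp: p_def fun_eq_iff)
  moreover have "p \<noteq> e"
  proof
    assume "p = e"
    then have "a = conv G a p" using ae by simp
    also have "\<dots> = (\<lambda>x. z * p x)"
      by (simp add: p_def t conv_linear au algebra_simps)
    finally show False using not_scalar[of z] \<open>p = e\<close> by simp
  qed
  ultimately show ?thesis by blast
qed

text \<open>Schur's lemma: up to the order of multiplication, the corner of \<open>e\<close> is the
  endomorphism ring of its left ideal. Both \<open>a + star G a\<close> and
  \<open>\<i> * (a - star G a)\<close> are self-adjoint elements of the corner, and a nonscalar one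
  would yield a smaller projection by \<open>spectral_projection\<close>.\<close>

lemma minimal_projection_corner:
  assumes e: "minimal_projection G e" and a: "conv G e a = a" "conv G a e = a"
  shows "\<exists>c. a = (\<lambda>x. c * e x)"
proof -
  have pe: "projection G e"
    using e by (simp add: minimal_projection_def)
  have self_adjoint: "\<exists>c. b = (\<lambda>x. c * e x)" if "star G b = b" "conv G e b = b" for b
    using spectral_projection[OF pe that] e unfolding minimal_projection_def by blast
  have supp: "supported G a"
    using conv_supported[of e a] a by simp
  have sa: "conv G e (star G a) = star G a"
    using star_conv[of a e] a projection_star[OF pe] by simp
  obtain c where c: "(\<lambda>x. a x + star G a x) = (\<lambda>x. c * e x)"
    using self_adjoint[of "\<lambda>x. a x + star G a x"]
    by (auto simp: star_linear conv_linear a sa star_star[OF supp] add.commute)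
  obtain d where d: "(\<lambda>x. \<i> * (a x - star G a x)) = (\<lambda>x. d * e x)"
    using self_adjoint[of "\<lambda>x. \<i> * (a x - star G a x)"]
    by (auto simp: star_linear conv_linear a sa star_star[OF supp] algebra_simps)
  have "a x = (c - \<i> * d) / 2 * e x" for x
  proof -
    have "a x + star G a x = c * e x" "\<i> * (a x - star G a x) = d * e x"
      using c d by meson+
    then have "(c - \<i> * d) * e x = (a x + star G a x) - \<i> * (\<i> * (a x - star G a x))"
      by (simp add: algebra_simps)
    also have "\<dots> = 2 * a x"
      by (simp add: algebra_simps)
    finally show ?thesis by simp
  qed
  then show ?thesis by blast
qed

text \<open>By Schur's lemma the corner of \<open>e\<close> is one-dimensional, and
  \<open>pairing G e e\<close> is its dimension. The proof computes the trace of two-sided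
  multiplication by \<open>e\<close> directly. In terms of characters, an irreducible one has norm
  one.\<close>

lemma pairing_minimal_projection:
  assumes e: "minimal_projection G e"
  shows "pairing G e e = 1"
proof -
  have pe: "projection G e" and nz: "e \<noteq> (\<lambda>x. 0)"
    using e by (auto simp: minimal_projection_def)
  have ee: "conv G e e = e"
    using pe by (rule projection_conv)
  \<comment> \<open>\<open>L x\<close> is the group element \<open>x\<close> times \<open>e\<close>;
    hence \<open>conv G e (L x)\<close> lies in the corner and is a multiple \<open>l x\<close> of
    \<open>e\<close>. Its value at \<open>x\<close> is a diagonal entry of the operator whose trace
    is sought.\<close>
  define L where "L = (\<lambda>x z. if z \<in> carrier G then e (inv x \<otimes> z) else 0)"
  have "\<exists>c. conv G e (L x) = (\<lambda>y. c * e y)" if x: "x \<in> carrier G" for x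
  proof (rule minimal_projection_corner[OF e])
    show "conv G e (conv G e (L x)) = conv G e (L x)"
      by (simp add: conv_assoc[symmetric] ee)
    have "conv G (L x) e = L x"
    proof
      fix z
      show "conv G (L x) e z = L x z"
      proof (cases "z \<in> carrier G")
        case z: True
        have "conv G (L x) e z = (\<Sum>y\<in>carrier G. e (inv x \<otimes> y) * e (inv (inv x \<otimes> y) \<otimes> (inv x \<otimes> z)))"
          unfolding conv_def L_def using x z
          by (simp add: inv_mult_group m_assoc) (simp add: m_assoc[symmetric])
        also have "\<dots> = (\<Sum>y\<in>carrier G. e y * e (inv y \<otimes> (inv x \<otimes> z)))"
          using x by (intro sum_left_mult) simp
        also have "\<dots> = conv G e e (inv x \<otimes> z)"
          using x z by (simp add: conv_def)
        finally show ?thesis using z by (simp add: ee L_def)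
      qed (simp add: conv_def L_def)
    qed
    then show "conv G (conv G e (L x)) e = conv G e (L x)"
      by (simp add: conv_assoc)
  qed
  then obtain l where l: "\<And>x. x \<in> carrier G \<Longrightarrow> conv G e (L x) = (\<lambda>y. l x * e y)"
    by metis
  have val: "conv G e (L x) y = (\<Sum>u\<in>carrier G. e u * e (inv x \<otimes> inv u \<otimes> y))"
    if "x \<in> carrier G" "y \<in> carrier G" for x y
    using that by (simp add: conv_def L_def m_assoc)
  have "pairing G e e = (\<Sum>x\<in>carrier G. conv G e (L x) x)"
    unfolding pairing_def chr_def
    by (simp add: val sum_distrib_left) (rule sum.swap)
  also have "\<dots> = (\<Sum>x\<in>carrier G. l x * e x)"
    by (simp add: l)
  finally have *: "pairing G e e = (\<Sum>x\<in>carrier G. l x * e x)" .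
  obtain y where y: "e y \<noteq> 0" using nz by auto
  then have yG: "y \<in> carrier G"
    using pe by (auto simp: projection_def supported_def)
  \<comment> \<open>Summed with weights \<open>e x\<close>, the elements
    \<open>conv G e (L x)\<close> give the triple product of \<open>e\<close>, which is
    \<open>e\<close> again; evaluation where \<open>e\<close> does not vanish shows that the trace
    is 1.\<close>
  have "(\<Sum>x\<in>carrier G. l x * e x) * e y = (\<Sum>x\<in>carrier G. e x * conv G e (L x) y)"
    by (simp add: l sum_distrib_left algebra_simps)
  also have "\<dots> = (\<Sum>u\<in>carrier G. e u * (\<Sum>x\<in>carrier G. e x * e (inv x \<otimes> (inv u \<otimes> y))))"
    using yG by (simp add: val sum_distrib_left) (subst sum.swap, simp add: algebra_simps m_assoc)
  also have "\<dots> = conv G e (conv G e e) y"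
    using yG by (simp add: conv_def)
  also have "\<dots> = 1 * e y"
    by (simp add: ee)
  finally show ?thesis
    using y * by (simp only: mult_cancel_right) simp
qed

lemma projection_diff:
  assumes "projection G e" "projection G p" "conv G e p = p"
  shows "projection G (\<lambda>x. e x - p x)"
proof -
  have "conv G p e = p"
    using star_conv[of e p] assms by (simp add: projection_def)
  then show ?thesis
    using assms by (auto simp: projection_def supported_def conv_linear star_linear)
qed

lemma projection_one_eq:
  assumes "projection G e"
  shows "e \<one> = of_real (\<Sum>x\<in>carrier G. (cmod (e x))\<^sup>2)"
  using conv_star_one[of e] assms by (simp add: projection_def)

lemma projection_unit: "projection G (\<lambda>x. if x = \<one> then 1 else 0)"
  by (auto simp: projection_def supported_def star_def conv_def fun_eq_iff if_distrib cong: if_cong)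

text \<open>Integrality comes from pairing with the unit of the group algebra, the sign from
  \<open>e \<one>\<close> being a squared norm. This degree is the measure for the descent to
  minimal projections.\<close>

lemma chr_one_Nats:
  assumes e: "projection G e"
  shows "\<exists>n. chr G e \<one> = of_nat n \<and> (e \<noteq> (\<lambda>x. 0) \<longrightarrow> n > 0)"
proof -
  have "pairing G (\<lambda>x. if x = \<one> then 1 else 0) e = chr G e \<one>"
    by (simp add: pairing_def if_distrib[of "\<lambda>c. c * _"] sum.delta cong: if_cong)
  then have "chr G e \<one> \<in> \<int>"
    using pairing_in_Ints[of "\<lambda>x. if x = \<one> then 1 else 0" e] projection_unit e
    by (simp add: projection_def)
  then obtain k where k: "chr G e \<one> = of_int k" by (auto elim: Ints_cases)
  let ?S = "\<Sum>x\<in>carrier G. (cmod (e x))\<^sup>2"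
  have "chr G e \<one> = of_real (real (order G) * ?S)"
    by (simp add: chr_one projection_one_eq[OF e])
  then have eq: "real_of_int k = real (order G) * ?S"
    unfolding k by (metis of_real_eq_iff of_real_of_int_eq)
  have "?S \<ge> 0" by (simp add: sum_nonneg)
  then have "k \<ge> 0"
    using eq by (metis of_int_0_le_iff of_nat_0_le_iff zero_le_mult_iff)
  moreover have "k > 0" if nz: "e \<noteq> (\<lambda>x. 0)"
  proof -
    obtain y where "e y \<noteq> 0" using nz by blast
    then have "y \<in> carrier G" "(cmod (e y))\<^sup>2 > 0"
      using e by (auto simp: projection_def supported_def)
    then have "?S > 0" by (intro sum_pos2[of _ y]) auto
    then have "real_of_int k > 0" unfolding eq using order_pos by simp
    then show ?thesis by simp
  qed
  ultimately show ?thesis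
    by (intro exI[of _ "nat k"]) (auto simp: k)
qed

text \<open>A substitute for complete reducibility: a non-minimal \<open>e\<close> splits into two
  nonzero projections of smaller degree, and an additive \<open>F\<close> that is nonzero on
  \<open>e\<close> is nonzero on one of them.\<close>

lemma exists_minimal_projection:
  fixes F :: "('a \<Rightarrow> complex) \<Rightarrow> complex"
  assumes "\<And>p q. F (\<lambda>x. p x + q x) = F p + F q"
    and "projection G e" "F e \<noteq> 0"
  shows "\<exists>r. minimal_projection G r \<and> F r \<noteq> 0"
proof -
  have F0: "F (\<lambda>x. 0) = 0"
    using assms(1)[of "\<lambda>x. 0" "\<lambda>x. 0"] by simp
  have "\<exists>r. minimal_projection G r \<and> F r \<noteq> 0"
    if "projection G e" "F e \<noteq> 0" "chr G e \<one> = of_nat n" for e n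
    using that
  proof (induction n arbitrary: e rule: less_induct)
    case (less n e)
    have nz: "e \<noteq> (\<lambda>x. 0)" using less.prems F0 by auto
    show ?case
    proof (cases "minimal_projection G e")
      case False
      then obtain p where p: "projection G p" "conv G e p = p" "p \<noteq> (\<lambda>x. 0)" "p \<noteq> e"
        using less.prems nz by (auto simp: minimal_projection_def)
      define q where "q = (\<lambda>x. e x - p x)"
      have q: "projection G q" "q \<noteq> (\<lambda>x. 0)"
        using projection_diff[OF less.prems(1) p(1,2)] p(4) by (auto simp: q_def fun_eq_iff) metis
      have epq: "e = (\<lambda>x. p x + q x)" by (simp add: q_def)
      obtain k m where k: "chr G p \<one> = of_nat k" "k > 0" and m: "chr G q \<one> = of_nat m" "m > 0"
        using chr_one_Nats[OF p(1)] chr_one_Nats[OF q(1)] p(3) q(2) by blast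
      have "of_nat n = (of_nat (k + m) :: complex)"
        using less.prems(3) k m chr_linear(2)[of p q \<one>] by (simp add: epq)
      then have "n = k + m" by (simp only: of_nat_eq_iff)
      moreover have "F p \<noteq> 0 \<or> F q \<noteq> 0"
        using less.prems(2) assms(1)[of p q] by (auto simp: epq)
      ultimately show ?thesis
        using less.IH[of k p] less.IH[of m q] p q k m by auto
    qed (use less.prems in blast)
  qed
  then show ?thesis
    using assms(2,3) chr_one_Nats by blast
qed

section \<open>Kernels of characters\<close>

lemma projection_inner:
  assumes r: "projection G r" and ab: "a \<in> carrier G" "b \<in> carrier G"
  shows "(\<Sum>y\<in>carrier G. r (a \<otimes> y) * cnj (r (b \<otimes> y))) = r (a \<otimes> inv b)"
proof -
  have star: "cnj (r x) = r (inv x)" if "x \<in> carrier G" for x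
    using fun_cong[OF projection_star[OF r], of "inv x"] that by (simp add: star_def)
  have "(\<Sum>y\<in>carrier G. r (a \<otimes> y) * cnj (r (b \<otimes> y))) =
    (\<Sum>y\<in>carrier G. r (a \<otimes> y) * r (inv (a \<otimes> y) \<otimes> (a \<otimes> inv b)))"
  proof (intro sum.cong refl)
    fix y assume y: "y \<in> carrier G"
    have "inv (a \<otimes> y) \<otimes> (a \<otimes> inv b) = inv y \<otimes> ((inv a \<otimes> a) \<otimes> inv b)"
      using ab y by (simp only: inv_mult_group m_assoc inv_closed m_closed)
    also have "\<dots> = inv (b \<otimes> y)"
      using ab y by (simp add: inv_mult_group)
    finally show "r (a \<otimes> y) * cnj (r (b \<otimes> y)) = r (a \<otimes> y) * r (inv (a \<otimes> y) \<otimes> (a \<otimes> inv b))"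
      using ab y by (simp add: star)
  qed
  also have "\<dots> = (\<Sum>y\<in>carrier G. r y * r (inv y \<otimes> (a \<otimes> inv b)))"
    using ab by (intro sum_left_mult)
  also have "\<dots> = conv G r r (a \<otimes> inv b)"
    using ab by (simp add: conv_def)
  finally show ?thesis using r by (simp add: projection_conv)
qed

text \<open>The character takes its degree as value precisely on the kernel of the representation.
  Instead of eigenvalues the proof uses a distance: by \<open>projection_inner\<close> the squared
  differences \<open>D x y\<close> add up to twice the degree minus \<open>chr G r g\<close> and its
  conjugate, which is zero under the hypothesis on \<open>g\<close>.\<close>

lemma chr_eq_chr_one_iff:
  assumes r: "projection G r" and g: "g \<in> carrier G"
  shows "chr G r g = chr G r \<one> \<longleftrightarrow>
    (\<forall>x\<in>carrier G. \<forall>y\<in>carrier G. r (x \<otimes> inv g \<otimes> y) = r (x \<otimes> y))"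
proof
  assume "\<forall>x\<in>carrier G. \<forall>y\<in>carrier G. r (x \<otimes> inv g \<otimes> y) = r (x \<otimes> y)"
  then show "chr G r g = chr G r \<one>"
    by (simp add: chr_def)
next
  assume eq: "chr G r g = chr G r \<one>"
  have star: "r (inv x) = cnj (r x)" if "x \<in> carrier G" for x
    using fun_cong[OF projection_star[OF r], of "inv x"] that by (simp add: star_def)
  define D where "D = (\<lambda>x y. r (x \<otimes> inv g \<otimes> y) - r (x \<otimes> y))"
  have one: "\<one> \<in> carrier G" by simp
  have rows: "(\<Sum>y\<in>carrier G. D x y * cnj (D x y)) =
      2 * r \<one> - r (x \<otimes> inv g \<otimes> inv x) - cnj (r (x \<otimes> inv g \<otimes> inv x))" if x: "x \<in> carrier G" for x
  proof -
    have "(\<Sum>y\<in>carrier G. D x y * cnj (D x y)) =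
      (\<Sum>y\<in>carrier G. r (x \<otimes> inv g \<otimes> y) * cnj (r (x \<otimes> inv g \<otimes> y))) +
      (\<Sum>y\<in>carrier G. r (x \<otimes> y) * cnj (r (x \<otimes> y))) -
      (\<Sum>y\<in>carrier G. r (x \<otimes> inv g \<otimes> y) * cnj (r (x \<otimes> y))) -
      cnj (\<Sum>y\<in>carrier G. r (x \<otimes> inv g \<otimes> y) * cnj (r (x \<otimes> y)))"
      by (simp add: D_def algebra_simps sum.distrib sum_subtractf)
    then show ?thesis
      using x g by (simp add: projection_inner[OF r])
  qed
  have sum_r: "(\<Sum>x\<in>carrier G. r (x \<otimes> inv g \<otimes> inv x)) = chr G r \<one>"
    using sum_inverse[of "\<lambda>x. r (inv x \<otimes> inv g \<otimes> x)"] eq by (simp add: chr_def)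
  have real: "cnj (r \<one>) = r \<one>"
    using star[OF one] by simp
  have "(\<Sum>x\<in>carrier G. \<Sum>y\<in>carrier G. D x y * cnj (D x y)) =
    2 * chr G r \<one> - (\<Sum>x\<in>carrier G. r (x \<otimes> inv g \<otimes> inv x))
      - cnj (\<Sum>x\<in>carrier G. r (x \<otimes> inv g \<otimes> inv x))"
    by (simp add: rows sum_subtractf chr_one Coset.order_def)
  also have "\<dots> = 0"
    unfolding sum_r by (simp add: chr_one real)
  finally have "(\<Sum>x\<in>carrier G. \<Sum>y\<in>carrier G. complex_of_real ((cmod (D x y))\<^sup>2)) = 0"
    by (simp only: complex_norm_square)
  then have "complex_of_real (\<Sum>x\<in>carrier G. \<Sum>y\<in>carrier G. (cmod (D x y))\<^sup>2) = 0"
    by simp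
  then have "(\<Sum>x\<in>carrier G. \<Sum>y\<in>carrier G. (cmod (D x y))\<^sup>2) = 0"
    by (simp only: of_real_eq_0_iff)
  then have "\<forall>x\<in>carrier G. \<forall>y\<in>carrier G. D x y = 0"
    by (simp add: sum_nonneg_eq_0_iff sum_nonneg)
  then show "\<forall>x\<in>carrier G. \<forall>y\<in>carrier G. r (x \<otimes> inv g \<otimes> y) = r (x \<otimes> y)"
    by (simp add: D_def)
qed

lemma chr_kernel_mult_closed:
  assumes r: "projection G r" and g: "g \<in> carrier G" "chr G r g = chr G r \<one>"
    and h: "h \<in> carrier G" "chr G r h = chr G r \<one>"
  shows "chr G r (g \<otimes> h) = chr G r \<one>"
proof -
  have "r (x \<otimes> inv (g \<otimes> h) \<otimes> y) = r (x \<otimes> y)" if xy: "x \<in> carrier G" "y \<in> carrier G" for x y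
  proof -
    have "r (x \<otimes> inv (g \<otimes> h) \<otimes> y) = r (x \<otimes> inv h \<otimes> (inv g \<otimes> y))"
      using xy g h by (simp add: inv_mult_group m_assoc)
    also have "\<dots> = r (x \<otimes> inv g \<otimes> y)"
      using chr_eq_chr_one_iff[OF r h(1)] xy g h by (simp add: m_assoc)
    also have "\<dots> = r (x \<otimes> y)"
      using chr_eq_chr_one_iff[OF r g(1)] xy g by simp
    finally show ?thesis .
  qed
  then show ?thesis
    using chr_eq_chr_one_iff[OF r, of "g \<otimes> h"] g h by simp
qed

end

section \<open>Malnormal subgroups and the theorem of Frobenius\<close>

text \<open>The trivial subgroup and the whole group also qualify; lemmas that need a nontrivial or
  proper subgroup say so separately.\<close>

definition malnormal :: "('a, 'b) monoid_scheme \<Rightarrow> 'a set \<Rightarrow> bool"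
  where "malnormal G H \<longleftrightarrow> subgroup H G \<and>
    (\<forall>g\<in>carrier G - H. \<forall>h\<in>H. g \<otimes>\<^bsub>G\<^esub> h \<otimes>\<^bsub>G\<^esub> inv\<^bsub>G\<^esub> g \<in> H \<longrightarrow> h = \<one>\<^bsub>G\<^esub>)"

text \<open>The identity satisfies the condition trivially, so for a subgroup \<open>H\<close> this
  is the complement of all conjugates of \<open>H\<close> with the identity put back, that is, the
  Frobenius kernel.\<close>

definition malnormal_kernel :: "('a, 'b) monoid_scheme \<Rightarrow> 'a set \<Rightarrow> 'a set"
  where "malnormal_kernel G H =
    {g \<in> carrier G. \<forall>x\<in>carrier G. x \<otimes>\<^bsub>G\<^esub> g \<otimes>\<^bsub>G\<^esub> inv\<^bsub>G\<^esub> x \<in> H \<longrightarrow> g = \<one>\<^bsub>G\<^esub>}"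

context finite_group
begin

lemma subgroup_finite_group: "subgroup H G \<Longrightarrow> finite_group (G\<lparr>carrier := H\<rparr>)"
  by (auto simp: finite_group_def finite_group_axioms_def subgroup_imp_group
      intro: finite_subset[OF subgroup.subset])

lemma projection_subgroup:
  assumes H: "subgroup H G" and e: "projection (G\<lparr>carrier := H\<rparr>) e"
  shows "projection G e"
  unfolding projection_def
proof (intro conjI)
  have HG: "H \<subseteq> carrier G" using H by (rule subgroup.subset)
  have supp: "e z = 0" if "z \<notin> H" for z
    using e that by (simp add: projection_def supported_def)
  show "supported G e"
    using supp HG by (auto simp: supported_def)
  have star: "e z = cnj (e (inv z))" if "z \<in> H" for z
  proof -
    have "star (G\<lparr>carrier := H\<rparr>) e z = e z"
      using e by (simp add: projection_def)
    then show ?thesis using that H by (simp add: star_def)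
  qed
  show "star G e = e"
  proof
    fix z
    show "star G e z = e z"
    proof (cases "z \<in> H")
      case True
      then show ?thesis using star[OF True] HG by (auto simp: star_def)
    next
      case False
      then have "inv z \<notin> H" if "z \<in> carrier G"
        using subgroup.m_inv_closed[OF H, of "inv z"] that by auto
      then show ?thesis using False by (simp add: star_def supp)
    qed
  qed
  show "conv G e e = e"
  proof
    fix z
    show "conv G e e z = e z"
    proof (cases "z \<in> carrier G")
      case z: True
      have "conv G e e z = (\<Sum>x\<in>H. e x * e (inv x \<otimes> z))"
        using z HG by (auto simp: conv_def supp intro!: sum.mono_neutral_right)
      also have "\<dots> = e z"
      proof (cases "z \<in> H")
        case True
        have "(\<Sum>x\<in>H. e x * e (inv x \<otimes> z)) = conv (G\<lparr>carrier := H\<rparr>) e e z"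
          using True H by (simp add: conv_def)
        then show ?thesis using e by (simp add: projection_def)
      next
        case False
        have "inv x \<otimes> z \<notin> H" if x: "x \<in> H" for x
        proof
          assume "inv x \<otimes> z \<in> H"
          then have "x \<otimes> (inv x \<otimes> z) \<in> H" using x H by (simp add: subgroup.m_closed)
          then show False using False x z HG by (simp add: m_assoc[symmetric] subset_iff)
        qed
        then show ?thesis by (simp add: supp False)
      qed
      finally show ?thesis .
    qed (use supp HG in \<open>auto simp: conv_def\<close>)
  qed
qed

text \<open>The projection onto the trivial representation of \<open>H\<close>; viewed in
  \<open>G\<close> it carries the permutation character on the cosets of \<open>H\<close>.\<close>

lemma projection_average:
  assumes H: "subgroup H G"
  shows "projection G (\<lambda>x. if x \<in> H then 1 / of_nat (card H) else 0)"
proof (rule projection_subgroup[OF H])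
  interpret H: finite_group "G\<lparr>carrier := H\<rparr>"
    using H by (rule subgroup_finite_group)
  have [simp]: "finite H" using H.fin by simp
  have [simp]: "inv x \<in> H" if "x \<in> H" for x
    using that H by (simp add: subgroup.m_inv_closed)
  have [simp]: "inv x \<otimes> y \<in> H" if "x \<in> H" "y \<in> H" for x y
    using that H by (simp add: subgroup.m_closed)
  have "card H \<noteq> 0"
    using subgroup.one_closed[OF H] by auto
  then show "projection (G\<lparr>carrier := H\<rparr>) (\<lambda>x. if x \<in> H then 1 / of_nat (card H) else 0)"
    using H by (auto simp: projection_def supported_def star_def conv_def fun_eq_iff field_simps)
qed

section \<open>Counting conjugates of a malnormal subgroup\<close>

lemma malnormal_subgroup: "malnormal G H \<Longrightarrow> subgroup H G"
  by (simp add: malnormal_def)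

lemma malnormal_conj_mem:
  assumes "malnormal G H" "h \<in> H" "h \<noteq> \<one>" "g \<in> carrier G" "g \<otimes> h \<otimes> inv g \<in> H"
  shows "g \<in> H"
  using assms unfolding malnormal_def by blast

lemma conj_conj:
  assumes "x \<in> carrier G" "y \<in> carrier G" "g \<in> carrier G"
  shows "x \<otimes> (y \<otimes> g \<otimes> inv y) \<otimes> inv x = (x \<otimes> y) \<otimes> g \<otimes> inv (x \<otimes> y)"
  using assms by (simp add: inv_mult_group m_assoc)

lemma conj_inv_cancel:
  assumes "x \<in> carrier G" "g \<in> carrier G"
  shows "inv x \<otimes> (x \<otimes> g \<otimes> inv x) \<otimes> x = g" "x \<otimes> (inv x \<otimes> g \<otimes> x) \<otimes> inv x = g"
  using conj_conj[of "inv x" x g] conj_conj[of x "inv x" g] assms by simp_all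

lemma conj_eq_one_iff:
  assumes "x \<in> carrier G" "g \<in> carrier G"
  shows "x \<otimes> g \<otimes> inv x = \<one> \<longleftrightarrow> g = \<one>"
  using conj_inv_cancel(1)[OF assms] assms by (metis l_one l_inv r_inv r_one inv_closed)

lemma malnormal_kernel_subset: "malnormal_kernel G H \<subseteq> carrier G"
  by (auto simp: malnormal_kernel_def)

lemma malnormal_kernel_Int:
  assumes "subgroup H G"
  shows "malnormal_kernel G H \<inter> H = {\<one>}"
proof -
  have "x = \<one>" if "x \<in> malnormal_kernel G H" "x \<in> H" for x
    using that subgroup.mem_carrier[OF assms] by (force simp: malnormal_kernel_def)
  then show ?thesis
    using subgroup.one_closed[OF assms] by (auto simp: malnormal_kernel_def)
qed

text \<open>If \<open>x\<close> and \<open>y\<close> both conjugate \<open>g\<close> into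
  \<open>H\<close>, then \<open>x \<otimes> inv y\<close> carries a nontrivial element of
  \<open>H\<close> into \<open>H\<close> and so lies in \<open>H\<close>. The conjugators therefore
  form a single coset \<open>H y\<close>.\<close>

lemma card_malnormal_conjugators:
  assumes H: "malnormal G H" and g: "g \<in> carrier G - malnormal_kernel G H"
  shows "card {x \<in> carrier G. x \<otimes> g \<otimes> inv x \<in> H} = card H"
proof -
  note sub = malnormal_subgroup[OF H]
  obtain y where y: "y \<in> carrier G" "y \<otimes> g \<otimes> inv y \<in> H" "g \<noteq> \<one>" and gG: "g \<in> carrier G"
    using g by (auto simp: malnormal_kernel_def)
  have "{x \<in> carrier G. x \<otimes> g \<otimes> inv x \<in> H} = (\<lambda>h. h \<otimes> y) ` H"
  proof (intro equalityI subsetI)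
    fix x assume "x \<in> {x \<in> carrier G. x \<otimes> g \<otimes> inv x \<in> H}"
    then have x: "x \<in> carrier G" "x \<otimes> g \<otimes> inv x \<in> H" by auto
    have "(x \<otimes> inv y) \<otimes> (y \<otimes> g \<otimes> inv y) \<otimes> inv (x \<otimes> inv y) = x \<otimes> g \<otimes> inv x"
      using x y gG by (subst conj_conj) (simp_all add: m_assoc)
    then have "x \<otimes> inv y \<in> H"
      using malnormal_conj_mem[OF H y(2), of "x \<otimes> inv y"] x y gG by (simp add: conj_eq_one_iff)
    moreover have "x = (x \<otimes> inv y) \<otimes> y"
      using x y by (simp add: m_assoc)
    ultimately show "x \<in> (\<lambda>h. h \<otimes> y) ` H" by (rule rev_image_eqI)
  next
    fix x assume "x \<in> (\<lambda>h. h \<otimes> y) ` H"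
    then obtain h where h: "h \<in> H" "x = h \<otimes> y" by blast
    then have hG: "h \<in> carrier G" using subgroup.mem_carrier[OF sub] by blast
    have "x \<otimes> g \<otimes> inv x = h \<otimes> (y \<otimes> g \<otimes> inv y) \<otimes> inv h"
      using conj_conj[OF hG y(1) gG] h by simp
    also have "\<dots> \<in> H"
      using h y sub by (simp add: subgroup.m_closed subgroup.m_inv_closed)
    finally show "x \<in> {x \<in> carrier G. x \<otimes> g \<otimes> inv x \<in> H}"
      using h hG y by simp
  qed
  moreover have "inj_on (\<lambda>h. h \<otimes> y) H"
    using subgroup.mem_carrier[OF sub] y(1) by (auto simp: inj_on_def)
  ultimately show ?thesis by (simp add: card_image)
qed

text \<open>Double counting of the pairs \<open>(g, x)\<close> for which \<open>x\<close> conjugates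
  \<open>g\<close> into \<open>H\<close>. With \<open>F\<close> constant it gives the size of the
  kernel, with \<open>F\<close> the squared modulus of a class function it computes norms.\<close>

lemma malnormal_sum:
  fixes F :: "'a \<Rightarrow> 'c :: comm_semiring_1"
  assumes H: "malnormal G H"
    and F: "\<And>x g. x \<in> carrier G \<Longrightarrow> g \<in> carrier G \<Longrightarrow> F (x \<otimes> g \<otimes> inv x) = F g"
  shows "of_nat (card H) * (\<Sum>g\<in>carrier G - malnormal_kernel G H. F g) =
    of_nat (order G) * (\<Sum>h\<in>H - {\<one>}. F h)"
proof -
  let ?C = "carrier G - malnormal_kernel G H"
  note sub = malnormal_subgroup[OF H]
  have "of_nat (card H) * (\<Sum>g\<in>?C. F g) =
      (\<Sum>g\<in>?C. \<Sum>x\<in>carrier G. if x \<otimes> g \<otimes> inv x \<in> H then F g else 0)"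
    unfolding sum_distrib_left
    by (intro sum.cong refl)
      (simp add: card_malnormal_conjugators[OF H] flip: sum.inter_filter)
  also have "\<dots> = (\<Sum>x\<in>carrier G. \<Sum>g\<in>?C. if x \<otimes> g \<otimes> inv x \<in> H then F g else 0)"
    by (rule sum.swap)
  also have "\<dots> = (\<Sum>x\<in>carrier G. \<Sum>h\<in>H - {\<one>}. F h)"
  proof (rule sum.cong[OF refl])
    fix x assume x: "x \<in> carrier G"
    have "(\<Sum>g\<in>?C. if x \<otimes> g \<otimes> inv x \<in> H then F g else 0) =
        (\<Sum>g\<in>{g\<in>?C. x \<otimes> g \<otimes> inv x \<in> H}. F g)"
      by (simp flip: sum.inter_filter)
    also have "\<dots> = (\<Sum>h\<in>H - {\<one>}. F h)"
    proof (rule sum.reindex_bij_witness[where j = "\<lambda>g. x \<otimes> g \<otimes> inv x" and i = "\<lambda>h. inv x \<otimes> h \<otimes> x"])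
      fix h assume h: "h \<in> H - {\<one>}"
      then have hG: "h \<in> carrier G" using subgroup.mem_carrier[OF sub] by blast
      show cancel: "x \<otimes> (inv x \<otimes> h \<otimes> x) \<otimes> inv x = h"
        using x hG by (rule conj_inv_cancel)
      have "inv x \<otimes> h \<otimes> x \<noteq> \<one>"
        using conj_eq_one_iff[of "inv x" h] x hG h by simp
      then show "inv x \<otimes> h \<otimes> x \<in> {g \<in> ?C. x \<otimes> g \<otimes> inv x \<in> H}"
        using cancel h x hG by (auto simp: malnormal_kernel_def intro!: bexI[of _ x])
    next
      fix g assume "g \<in> {g \<in> ?C. x \<otimes> g \<otimes> inv x \<in> H}"
      then have g: "g \<in> carrier G" "x \<otimes> g \<otimes> inv x \<in> H" "g \<noteq> \<one>"
        by (auto simp: malnormal_kernel_def)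
      show "inv x \<otimes> (x \<otimes> g \<otimes> inv x) \<otimes> x = g"
        using x g by (simp add: conj_inv_cancel)
      show "x \<otimes> g \<otimes> inv x \<in> H - {\<one>}"
        using x g by (simp add: conj_eq_one_iff)
      show "F (x \<otimes> g \<otimes> inv x) = F g"
        using x g by (simp add: F)
    qed
    finally show "(\<Sum>g\<in>?C. if x \<otimes> g \<otimes> inv x \<in> H then F g else 0) = (\<Sum>h\<in>H - {\<one>}. F h)" .
  qed
  finally show ?thesis by (simp add: Coset.order_def)
qed

lemma card_malnormal_complement:
  assumes H: "malnormal G H"
  shows "card H * card (carrier G - malnormal_kernel G H) = order G * (card H - 1)"
  using malnormal_sum[OF H, of "\<lambda>_. 1 :: nat"] subgroup.one_closed[OF malnormal_subgroup[OF H]]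
  by simp

lemma card_malnormal_kernel:
  assumes H: "malnormal G H"
  shows "card (malnormal_kernel G H) * card H = order G"
proof -
  note sub = malnormal_subgroup[OF H]
  have fin_H: "finite H" using finite_subset[OF subgroup.subset[OF sub]] by simp
  have "card (carrier G - malnormal_kernel G H) + card (malnormal_kernel G H) = order G"
    using malnormal_kernel_subset[of H]
    by (simp add: Coset.order_def card_Diff_subset finite_subset card_mono)
  then have "card H * (card (carrier G - malnormal_kernel G H) + card (malnormal_kernel G H)) =
      card H * order G" by simp
  moreover have "card H > 0"
    using subgroup.one_closed[OF sub] fin_H by (auto simp: card_gt_0_iff)
  then obtain k where "card H = Suc k" by (cases "card H") auto
  ultimately show ?thesis
    using card_malnormal_complement[OF H] by (simp add: algebra_simps)
qed

text \<open>In the sum for the induced character at \<open>h \<noteq> \<one>\<close>, malnormality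
  removes every term with \<open>x\<close> outside \<open>H\<close>, so restriction returns the
  original character. On the kernel no nontrivial element has a conjugate in \<open>H\<close>, and
  all terms vanish.\<close>

lemma chr_supported_malnormal:
  assumes H: "malnormal G H" and e: "supported (G\<lparr>carrier := H\<rparr>) e"
  shows "h \<in> H \<Longrightarrow> h \<noteq> \<one> \<Longrightarrow> chr G e h = chr (G\<lparr>carrier := H\<rparr>) e h"
    and "g \<in> malnormal_kernel G H \<Longrightarrow> g \<noteq> \<one> \<Longrightarrow> chr G e g = 0"
proof -
  note sub = malnormal_subgroup[OF H]
  have HG: "H \<subseteq> carrier G" using sub by (rule subgroup.subset)
  have supp: "e z = 0" if "z \<notin> H" for z
    using e that by (simp add: supported_def)
  show "chr G e h = chr (G\<lparr>carrier := H\<rparr>) e h" if h: "h \<in> H" "h \<noteq> \<one>"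
  proof -
    have "inv x \<otimes> inv h \<otimes> x \<notin> H" if x: "x \<in> carrier G - H" for x
    proof
      assume "inv x \<otimes> inv h \<otimes> x \<in> H"
      then have "inv x \<in> H"
        using malnormal_conj_mem[OF H, of "inv h" "inv x"] h x HG sub
        by (auto simp: subgroup.m_inv_closed)
      then show False
        using x subgroup.m_inv_closed[OF sub, of "inv x"] by simp
    qed
    then have "chr G e h = (\<Sum>x\<in>H. e (inv x \<otimes> inv h \<otimes> x))"
      unfolding chr_def using HG by (intro sum.mono_neutral_right) (auto simp: supp)
    also have "\<dots> = chr (G\<lparr>carrier := H\<rparr>) e h"
      using h sub by (simp add: chr_def)
    finally show ?thesis .
  qed
  show "chr G e g = 0" if g: "g \<in> malnormal_kernel G H" "g \<noteq> \<one>"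
  proof -
    have gG: "g \<in> carrier G" using g malnormal_kernel_subset by blast
    have "inv x \<otimes> inv g \<otimes> x \<notin> H" if x: "x \<in> carrier G" for x
    proof
      assume "inv x \<otimes> inv g \<otimes> x \<in> H"
      then have "inv (inv x \<otimes> inv g \<otimes> x) \<in> H"
        by (rule subgroup.m_inv_closed[OF sub])
      then have "inv x \<otimes> g \<otimes> inv (inv x) \<in> H"
        using x gG by (simp add: inv_mult_group m_assoc)
      then show False
        using g inv_closed[OF x] unfolding malnormal_kernel_def by blast
    qed
    then show ?thesis by (simp add: chr_def supp)
  qed
qed

section \<open>Extending characters from a malnormal subgroup\<close>

lemma norm_sq_sum_eq_0D:
  assumes "(\<Sum>x\<in>A. cnj (f x) * f x) = (0 :: complex)" "finite A" "x \<in> A"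
  shows "f x = 0"
proof -
  have "complex_of_real (\<Sum>x\<in>A. (cmod (f x))\<^sup>2) = (\<Sum>x\<in>A. cnj (f x) * f x)"
    unfolding of_real_sum by (intro sum.cong refl) (metis complex_norm_square mult.commute of_real_power)
  then have "(\<Sum>x\<in>A. (cmod (f x))\<^sup>2) = 0"
    using assms(1) by (simp only: of_real_eq_0_iff)
  then show ?thesis
    using assms by (simp add: sum_nonneg_eq_0_iff)
qed

text \<open>The character \<open>\<phi>\<close> of \<open>H\<close> given by \<open>e\<close> extends to the class function \<open>\<psi>\<close> on \<open>G\<close> that is
  constant on the kernel. It is a virtual character \<open>Ind \<phi> - \<phi>(1) (Ind 1 - 1)\<close> of norm one, hence up
  to sign an irreducible character.\<close>
lemma malnormal_extension:
  assumes H: "malnormal G H" and e: "minimal_projection (G\<lparr>carrier := H\<rparr>) e"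
  shows "\<exists>r. projection G r \<and> (\<forall>g\<in>malnormal_kernel G H. chr G r g = chr G r \<one>) \<and>
    (\<forall>h\<in>H. chr G r h = chr G r \<one> \<longleftrightarrow> chr (G\<lparr>carrier := H\<rparr>) e h = chr (G\<lparr>carrier := H\<rparr>) e \<one>)"
proof -
  let ?H = "G\<lparr>carrier := H\<rparr>"
  let ?K = "malnormal_kernel G H"
  note sub = malnormal_subgroup[OF H]
  interpret H: finite_group ?H using sub by (rule subgroup_finite_group)
  have finH: "finite H" using H.fin by simp
  have HG: "H \<subseteq> carrier G" using sub by (rule subgroup.subset)
  have one_H: "\<one> \<in> H" using sub by (rule subgroup.one_closed)
  have cardH: "card H \<noteq> 0" using one_H finH by auto
  have e_H: "projection ?H e" using e by (simp add: minimal_projection_def)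
  have pe: "projection G e" using projection_subgroup[OF sub e_H] .
  define f where "f = chr ?H e \<one>"
  obtain m where m: "f = of_nat m"
    using H.chr_one_Nats[OF e_H] by (auto simp: f_def)
  have f_eq: "f = of_nat (card H) * e \<one>"
    using H.chr_one[of e] by (simp add: f_def Coset.order_def)
  \<comment> \<open>As elements of the group algebra of \<open>G\<close>, \<open>eH\<close> and
    \<open>eG\<close> carry the characters \<open>Ind 1\<close> and \<open>1\<close> of the virtual
    character to be formed.\<close>
  define eH where "eH = (\<lambda>x. if x \<in> H then 1 / of_nat (card H) else (0::complex))"
  define eG where "eG = (\<lambda>x. if x \<in> carrier G then 1 / of_nat (card (carrier G)) else (0::complex))"
  have peH: "projection G eH"
    unfolding eH_def using sub by (rule projection_average)
  have peG: "projection G eG"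
    unfolding eG_def by (rule projection_average[OF subgroup_self])
  have cardG: "card (carrier G) \<noteq> 0" using order_pos by (simp only: Coset.order_def)
  have chr_eG: "chr G eG g = 1" if "g \<in> carrier G" for g
    using that cardG by (simp add: chr_def eG_def)
  have chr_eH: "chr ?H eH h = 1" if "h \<in> H" for h
    using that cardH sub
    by (simp add: chr_def eH_def subgroup.m_closed subgroup.m_inv_closed)
  define \<psi> where "\<psi> = (\<lambda>g. chr G e g - f * chr G eH g + f * chr G eG g)"
  have suppH: "supported ?H e" "supported ?H eH"
    using e_H by (auto simp: projection_def supported_def eH_def)
  have psi_H: "\<psi> h = chr ?H e h" if h: "h \<in> H" "h \<noteq> \<one>" for h
    using chr_supported_malnormal(1)[OF H _ h] suppH h HG
    by (auto simp: \<psi>_def chr_eG chr_eH)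
  \<comment> \<open>At \<open>\<one>\<close> the characters induced from \<open>e\<close> and
    \<open>eH\<close> are the index times \<open>f\<close> and \<open>1\<close>, so they cancel in
    \<open>\<psi> \<one>\<close> and leave \<open>f\<close>.\<close>
  have index: "of_nat (order G) * e \<one> = f * (of_nat (order G) / of_nat (card H))"
    using cardH by (simp add: f_eq)
  have psi_one: "\<psi> \<one> = f"
    using chr_eG[OF one_closed] by (simp add: \<psi>_def chr_one index) (simp add: eH_def one_H)
  have psi_K: "\<psi> g = f" if g: "g \<in> ?K" for g
  proof (cases "g = \<one>")
    case False
    then show ?thesis
      using chr_supported_malnormal(2)[OF H _ g] suppH chr_eG[of g] g malnormal_kernel_subset[of H]
      by (auto simp: \<psi>_def)
  qed (simp add: psi_one)
  have psi_class: "\<psi> (x \<otimes> g \<otimes> inv x) = \<psi> g" if "x \<in> carrier G" "g \<in> carrier G" for x g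
    using that by (simp add: \<psi>_def chr_conj)
  have cnj_f: "cnj f = f" by (simp add: m)
  \<comment> \<open>Off the kernel \<open>malnormal_sum\<close> moves the sum to
    \<open>H - {\<one>}\<close>. On the kernel \<open>\<psi>\<close> is constantly \<open>f\<close>,
    and \<open>|K| |H| = |G|\<close> turns this part into the missing term at the identity of
    \<open>H\<close>, so the norm is that of an irreducible character of \<open>H\<close>.\<close>
  have norm_psi: "(\<Sum>g\<in>carrier G. cnj (\<psi> g) * \<psi> g) = of_nat (order G)"
  proof -
    let ?N = "\<lambda>g. cnj (\<psi> g) * \<psi> g"
    have "(\<Sum>g\<in>carrier G. ?N g) = (\<Sum>g\<in>carrier G - ?K. ?N g) + (\<Sum>g\<in>?K. ?N g)"
      using malnormal_kernel_subset[of H] by (simp add: sum.subset_diff)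
    then have "of_nat (card H) * (\<Sum>g\<in>carrier G. ?N g) =
        of_nat (order G) * (\<Sum>h\<in>H - {\<one>}. ?N h) + of_nat (card ?K * card H) * (f * f)"
      using malnormal_sum[OF H, of ?N] by (simp add: psi_class psi_K cnj_f algebra_simps)
    also have "\<dots> = of_nat (order G) * ((\<Sum>h\<in>H - {\<one>}. ?N h) + f * f)"
      by (simp only: card_malnormal_kernel[OF H] ring_distribs)
    also have "(\<Sum>h\<in>H - {\<one>}. ?N h) = (\<Sum>h\<in>H - {\<one>}. cnj (chr ?H e h) * chr ?H e h)"
      by (intro sum.cong refl) (simp add: psi_H)
    also have "\<dots> + f * f = (\<Sum>h\<in>H. cnj (chr ?H e h) * chr ?H e h)"
      using finH one_H by (simp add: sum.remove[of H "\<one>"] f_def[symmetric] cnj_f)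
    also have "\<dots> = of_nat (card H)"
      using H.pairing_conv_chr[OF H.projection_star[OF e_H], of e] H.pairing_minimal_projection[OF e]
      by (simp add: Coset.order_def)
    finally show ?thesis using cardH by simp
  qed
  define F where "F = (\<lambda>p. \<Sum>g\<in>carrier G. cnj (\<psi> g) * chr G p g)"
  have F_add: "F (\<lambda>x. p x + q x) = F p + F q" for p q
    by (simp add: F_def chr_linear algebra_simps sum.distrib)
  have F_pairing: "F p = of_nat (order G) *
      (pairing G e p - of_nat m * pairing G eH p + of_nat m * pairing G eG p)" for p
  proof -
    have "F p = (\<Sum>g\<in>carrier G. cnj (chr G e g) * chr G p g)
        - f * (\<Sum>g\<in>carrier G. cnj (chr G eH g) * chr G p g)
        + f * (\<Sum>g\<in>carrier G. cnj (chr G eG g) * chr G p g)"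
      by (simp add: F_def \<psi>_def cnj_f algebra_simps sum.distrib sum_subtractf sum_distrib_left)
    then show ?thesis
      using pairing_conv_chr[OF projection_star[OF pe], of p]
        pairing_conv_chr[OF projection_star[OF peH], of p]
        pairing_conv_chr[OF projection_star[OF peG], of p]
      by (simp add: m algebra_simps)
  qed
  \<comment> \<open>This combination is the squared norm of \<open>\<psi>\<close>. As it is nonzero,
    \<open>F\<close> is nonzero on one of the three projections and hence on some minimal
    projection.\<close>
  have "F e - f * F eH + f * F eG = of_nat (order G)"
    unfolding norm_psi[symmetric]
    by (simp add: F_def \<psi>_def[of] algebra_simps sum.distrib sum_subtractf sum_distrib_left)
  then have "F e \<noteq> 0 \<or> F eH \<noteq> 0 \<or> F eG \<noteq> 0"
    using order_pos by auto
  then obtain r where r: "minimal_projection G r" "F r \<noteq> 0"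
    using exists_minimal_projection[of F, OF F_add] pe peH peG by blast
  have pr: "projection G r" using r by (simp add: minimal_projection_def)
  have "pairing G e r - of_nat m * pairing G eH r + of_nat m * pairing G eG r \<in> \<int>"
    using pairing_in_Ints[OF projection_conv projection_conv] pe peH peG pr
    by (intro Ints_add Ints_diff Ints_mult) auto
  then obtain c where c: "pairing G e r - of_nat m * pairing G eH r + of_nat m * pairing G eG r = of_int c"
    by (auto elim: Ints_cases)
  have F_r: "F r = of_nat (order G) * of_int c"
    by (simp add: F_pairing c)
  then have "c \<noteq> 0" using r by auto
  have norm_r: "(\<Sum>g\<in>carrier G. cnj (chr G r g) * chr G r g) = of_nat (order G)"
    using pairing_conv_chr[OF projection_star[OF pr], of r] pairing_minimal_projection[OF r(1)] by simp
  have F_r_cnj: "(\<Sum>g\<in>carrier G. cnj (chr G r g) * \<psi> g) = of_nat (order G) * of_int c"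
  proof -
    have "(\<Sum>g\<in>carrier G. cnj (chr G r g) * \<psi> g) = cnj (F r)"
      by (simp add: F_def mult.commute)
    then show ?thesis by (simp add: F_r)
  qed
  \<comment> \<open>The expanded squared norm of the remainder \<open>D\<close> is
    \<open>|G| (1 - c\<^sup>2)\<close>. Since it is nonnegative and \<open>c\<close> is a nonzero
    integer, \<open>c\<^sup>2 = 1\<close> and \<open>D\<close> vanishes.\<close>
  define D where "D = (\<lambda>g. \<psi> g - of_int c * chr G r g)"
  have "(\<Sum>g\<in>carrier G. cnj (D g) * D g) = (\<Sum>g\<in>carrier G. cnj (\<psi> g) * \<psi> g)
      - of_int c * F r - of_int c * (\<Sum>g\<in>carrier G. cnj (chr G r g) * \<psi> g)
      + of_int (c\<^sup>2) * (\<Sum>g\<in>carrier G. cnj (chr G r g) * chr G r g)"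
    by (simp add: D_def F_def algebra_simps sum.distrib sum_subtractf sum_distrib_left power2_eq_square)
  also have "\<dots> = of_nat (order G) * of_int (1 - c\<^sup>2)"
    unfolding norm_psi F_r F_r_cnj norm_r by (simp add: algebra_simps power2_eq_square)
  finally have norm_D: "(\<Sum>g\<in>carrier G. cnj (D g) * D g) = of_nat (order G) * of_int (1 - c\<^sup>2)" .
  have "0 \<le> Re (\<Sum>g\<in>carrier G. cnj (D g) * D g)"
    unfolding Re_sum by (rule sum_nonneg) simp
  then have "0 \<le> real (order G) * of_int (1 - c\<^sup>2)"
    by (simp add: norm_D)
  then have "0 \<le> (of_int (1 - c\<^sup>2) :: real)"
    using order_pos by (simp add: zero_le_mult_iff)
  then have "c\<^sup>2 \<le> 1" by (simp only: of_int_0_le_iff)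
  moreover have "c\<^sup>2 > 0" using \<open>c \<noteq> 0\<close> by simp
  ultimately have "c\<^sup>2 = 1" by linarith
  then have D_0: "D g = 0" if "g \<in> carrier G" for g
    using norm_sq_sum_eq_0D[of D "carrier G"] norm_D that by simp
  have psi_r: "\<psi> g = of_int c * chr G r g" if "g \<in> carrier G" for g
    using D_0[OF that] by (simp add: D_def)
  have iff: "chr G r g = chr G r \<one> \<longleftrightarrow> \<psi> g = f" if "g \<in> carrier G" for g
    using psi_r[OF that] psi_r[OF one_closed] psi_one \<open>c \<noteq> 0\<close> by auto
  have "\<forall>g\<in>?K. chr G r g = chr G r \<one>"
    using iff psi_K malnormal_kernel_subset by blast
  moreover have "chr G r h = chr G r \<one> \<longleftrightarrow> chr ?H e h = chr ?H e \<one>" if h: "h \<in> H" for h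
  proof (cases "h = \<one>")
    case False
    then show ?thesis using iff[of h] psi_H h HG by (auto simp: f_def)
  qed simp
  ultimately show ?thesis using pr by blast
qed

theorem frobenius_kernel_subgroup:
  assumes H: "malnormal G H"
  shows "subgroup (malnormal_kernel G H) G"
proof (rule subgroupI)
  let ?H = "G\<lparr>carrier := H\<rparr>"
  let ?K = "malnormal_kernel G H"
  note sub = malnormal_subgroup[OF H]
  interpret H: finite_group ?H using sub by (rule subgroup_finite_group)
  have HG: "H \<subseteq> carrier G" using sub by (rule subgroup.subset)
  show "?K \<subseteq> carrier G" by (rule malnormal_kernel_subset)
  show "?K \<noteq> {}" using malnormal_kernel_Int[OF sub] by auto
  show "inv g \<in> ?K" if g: "g \<in> ?K" for g
  proof -
    have gG: "g \<in> carrier G" using g malnormal_kernel_subset by blast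
    have "inv g = \<one>" if x: "x \<in> carrier G" "x \<otimes> inv g \<otimes> inv x \<in> H" for x
    proof -
      have "inv (x \<otimes> inv g \<otimes> inv x) \<in> H"
        using x sub by (simp add: subgroup.m_inv_closed)
      then have "x \<otimes> g \<otimes> inv x \<in> H"
        using x gG by (simp add: inv_mult_group m_assoc)
      then show ?thesis using g x by (auto simp: malnormal_kernel_def)
    qed
    then show ?thesis using gG by (auto simp: malnormal_kernel_def)
  qed
  show "g \<otimes> h \<in> ?K" if g: "g \<in> ?K" and h: "h \<in> ?K" for g h
  proof (rule ccontr)
    assume not: "g \<otimes> h \<notin> ?K"
    have gh: "g \<in> carrier G" "h \<in> carrier G" using g h malnormal_kernel_subset by blast+
    then obtain x where x: "x \<in> carrier G" "x \<otimes> (g \<otimes> h) \<otimes> inv x \<in> H" "g \<otimes> h \<noteq> \<one>"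
      using not by (auto simp: malnormal_kernel_def)
    define k where "k = x \<otimes> (g \<otimes> h) \<otimes> inv x"
    have k: "k \<in> H" "k \<noteq> \<one>"
      using x gh by (auto simp: k_def conj_eq_one_iff)
    define F where "F = (\<lambda>e. chr ?H e k - chr ?H e \<one>)"
    \<comment> \<open>The unit carries the regular character of \<open>H\<close>, which is
      \<open>card H\<close> at \<open>\<one>\<close> and zero at \<open>k\<close>. So the additive
      \<open>F\<close> is nonzero on it, and some irreducible character of \<open>H\<close> does not
      have \<open>k\<close> in its kernel; its extension to \<open>G\<close> yields the
      contradiction.\<close>
    let ?u = "\<lambda>x. if x = \<one> then 1 else (0::complex)"
    have "projection ?H ?u"
      using H.projection_unit by simp
    moreover have "F ?u \<noteq> 0"
    proof -
      have "chr ?H ?u k = 0"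
      proof -
        have "inv y \<otimes> inv k \<otimes> y \<noteq> \<one>" if "y \<in> H" for y
          using conj_eq_one_iff[of "inv y" "inv k"] that k HG by (auto simp: subset_iff)
        then show ?thesis
          using k sub by (simp add: chr_def)
      qed
      moreover have "chr ?H ?u \<one> = of_nat (card H)"
        using H.chr_one[of ?u] by (simp add: Coset.order_def)
      moreover have "card H \<noteq> 0" using k H.fin by auto
      ultimately show ?thesis by (simp add: F_def)
    qed
    moreover have "F (\<lambda>x. p x + q x) = F p + F q" for p q
      by (simp add: F_def H.chr_linear)
    ultimately obtain e where e: "minimal_projection ?H e" "F e \<noteq> 0"
      using H.exists_minimal_projection[of F ?u] by blast
    obtain r where r: "projection G r" "\<forall>g\<in>?K. chr G r g = chr G r \<one>"
      "\<forall>h\<in>H. chr G r h = chr G r \<one> \<longleftrightarrow> chr ?H e h = chr ?H e \<one>"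
      using malnormal_extension[OF H e(1)] by blast
    have "chr G r (g \<otimes> h) = chr G r \<one>"
      using chr_kernel_mult_closed[OF r(1)] r(2) g h gh by blast
    then have "chr G r k = chr G r \<one>"
      using x gh by (simp add: k_def chr_conj)
    then show False
      using r(3) k e(2) by (simp add: F_def)
  qed
qed

section \<open>Conjugates of malnormal subgroups\<close>

lemma finite_subgroup: "subgroup H G \<Longrightarrow> finite H"
  using fin finite_subset subgroup.subset by metis

lemma finite_malnormal_kernel [simp]: "finite (malnormal_kernel G H)"
  using fin finite_subset malnormal_kernel_subset by metis

lemma card_subgroup_gt_1:
  assumes "subgroup H G" "H \<noteq> {\<one>}"
  shows "card H \<ge> 2"
proof -
  obtain h where "h \<in> H" "h \<noteq> \<one>"
    using assms subgroup.one_closed[OF assms(1)] by blast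
  then have "card {\<one>, h} \<le> card H"
    using subgroup.one_closed[OF assms(1)] finite_subgroup[OF assms(1)] by (intro card_mono) auto
  then show ?thesis using \<open>h \<noteq> \<one>\<close> by simp
qed

text \<open>Otherwise the complements of the two kernels would be disjoint, but each contains at least half of
  the group.\<close>
lemma malnormal_conj_meet:
  assumes A: "malnormal G A" "A \<noteq> {\<one>}" and B: "malnormal G B" "B \<noteq> {\<one>}"
  shows "\<exists>x\<in>carrier G. \<exists>a\<in>A. a \<noteq> \<one> \<and> x \<otimes> a \<otimes> inv x \<in> B"
proof (rule ccontr)
  assume none: "\<not> ?thesis"
  note subs = malnormal_subgroup[OF A(1)] malnormal_subgroup[OF B(1)]
  let ?KA = "malnormal_kernel G A" and ?KB = "malnormal_kernel G B"
  have "g \<in> ?KB" if g: "g \<in> carrier G" "g \<notin> ?KA" for g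
  proof (rule ccontr)
    assume "g \<notin> ?KB"
    then obtain y where y: "y \<in> carrier G" "y \<otimes> g \<otimes> inv y \<in> B"
      using g by (auto simp: malnormal_kernel_def)
    obtain x where x: "x \<in> carrier G" "x \<otimes> g \<otimes> inv x \<in> A" "g \<noteq> \<one>"
      using g by (auto simp: malnormal_kernel_def)
    have "(y \<otimes> inv x) \<otimes> (x \<otimes> g \<otimes> inv x) \<otimes> inv (y \<otimes> inv x) = y \<otimes> g \<otimes> inv y"
      using x y g by (subst conj_conj) (simp_all add: m_assoc)
    moreover have "y \<otimes> inv x \<in> carrier G" "x \<otimes> g \<otimes> inv x \<noteq> \<one>"
      using x y g by (simp_all add: conj_eq_one_iff)
    ultimately show False
      using none x(2) y(2) by metis
  qed
  moreover have "\<one> \<in> ?KA" "\<one> \<in> ?KB"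
    using malnormal_kernel_Int subs by blast+
  ultimately have "carrier G - ?KA \<subseteq> ?KB - {\<one>}" by blast
  then have "card (carrier G - ?KA) \<le> card (?KB - {\<one>})"
    by (rule card_mono[rotated]) simp
  moreover have "card (?KB - {\<one>}) = card ?KB - 1" "card ?KB > 0"
    using \<open>\<one> \<in> ?KB\<close> by (auto simp: card_gt_0_iff)
  moreover have "card (carrier G - ?KA) = order G - card ?KA"
    using malnormal_kernel_subset[of A] by (simp add: Coset.order_def card_Diff_subset)
  moreover have "2 * card ?KA \<le> order G"
    using card_malnormal_kernel[OF A(1)] card_subgroup_gt_1[OF subs(1) A(2)]
    by (metis mult.commute mult_le_mono1)
  moreover have "2 * card ?KB \<le> order G"
    using card_malnormal_kernel[OF B(1)] card_subgroup_gt_1[OF subs(2) B(2)]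
    by (metis mult.commute mult_le_mono1)
  ultimately show False by linarith
qed

definition conj_set :: "'a \<Rightarrow> 'a set \<Rightarrow> 'a set"
  where "conj_set x H = (\<lambda>h. x \<otimes> h \<otimes> inv x) ` H"

lemma conj_set_mem_iff:
  assumes "x \<in> carrier G" "H \<subseteq> carrier G"
  shows "g \<in> conj_set x H \<longleftrightarrow> g \<in> carrier G \<and> inv x \<otimes> g \<otimes> x \<in> H"
proof
  assume "g \<in> conj_set x H"
  then show "g \<in> carrier G \<and> inv x \<otimes> g \<otimes> x \<in> H"
    using assms by (auto simp: conj_set_def subset_iff conj_inv_cancel)
next
  assume "g \<in> carrier G \<and> inv x \<otimes> g \<otimes> x \<in> H"
  then show "g \<in> conj_set x H"
    using assms conj_inv_cancel(2)[of x g] unfolding conj_set_def by (metis image_eqI)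
qed

lemma conj_inj: "x \<in> carrier G \<Longrightarrow> inj_on (\<lambda>h. x \<otimes> h \<otimes> inv x) (carrier G)"
  by (rule inj_on_inverseI[where g = "\<lambda>h. inv x \<otimes> h \<otimes> x"]) (rule conj_inv_cancel)

lemma card_conj_set:
  assumes "x \<in> carrier G" "H \<subseteq> carrier G"
  shows "card (conj_set x H) = card H"
  unfolding conj_set_def by (rule card_image) (rule inj_on_subset[OF conj_inj], use assms in auto)

lemma conj_mult:
  assumes "x \<in> carrier G" "a \<in> carrier G" "b \<in> carrier G"
  shows "x \<otimes> (a \<otimes> b) \<otimes> inv x = (x \<otimes> a \<otimes> inv x) \<otimes> (x \<otimes> b \<otimes> inv x)"
proof -
  have "(x \<otimes> a \<otimes> inv x) \<otimes> (x \<otimes> b \<otimes> inv x) = x \<otimes> a \<otimes> ((inv x \<otimes> x) \<otimes> (b \<otimes> inv x))"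
    using assms by (simp only: m_assoc m_closed inv_closed)
  then show ?thesis using assms by (simp add: m_assoc)
qed

lemma conj_inv:
  assumes "x \<in> carrier G" "a \<in> carrier G"
  shows "inv (x \<otimes> a \<otimes> inv x) = x \<otimes> inv a \<otimes> inv x"
  using assms by (simp add: inv_mult_group m_assoc)

lemma conj_set_subgroup:
  assumes x: "x \<in> carrier G" and H: "subgroup H G"
  shows "subgroup (conj_set x H) G"
proof (rule subgroupI)
  note HG = subgroup.subset[OF H]
  show "conj_set x H \<subseteq> carrier G"
    using conj_set_mem_iff[OF x HG] by blast
  show "conj_set x H \<noteq> {}"
    using subgroup.one_closed[OF H] by (auto simp: conj_set_def)
  show "inv a \<in> conj_set x H" if "a \<in> conj_set x H" for a
    using that HG x subgroup.m_inv_closed[OF H] by (auto simp: conj_set_def conj_inv subset_iff)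
  show "a \<otimes> b \<in> conj_set x H" if *: "a \<in> conj_set x H" "b \<in> conj_set x H" for a b
  proof -
    obtain a' b' where ab: "a' \<in> H" "b' \<in> H" "a = x \<otimes> a' \<otimes> inv x" "b = x \<otimes> b' \<otimes> inv x"
      using * by (auto simp: conj_set_def)
    then have "a \<otimes> b = x \<otimes> (a' \<otimes> b') \<otimes> inv x"
      using conj_mult[OF x, of a' b'] HG by (simp add: subset_iff)
    then show ?thesis
      using ab subgroup.m_closed[OF H] by (auto simp: conj_set_def)
  qed
qed

lemma malnormal_conj_set:
  assumes x: "x \<in> carrier G" and H: "malnormal G H"
  shows "malnormal G (conj_set x H)"
  unfolding malnormal_def
proof (intro conjI ballI impI)
  note sub = malnormal_subgroup[OF H]
  note HG = subgroup.subset[OF sub]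
  note mem = conj_set_mem_iff[OF x HG]
  show "subgroup (conj_set x H) G" using x sub by (rule conj_set_subgroup)
  fix g h assume g: "g \<in> carrier G - conj_set x H" and h: "h \<in> conj_set x H"
    and gh: "g \<otimes> h \<otimes> inv g \<in> conj_set x H"
  define g' h' where "g' = inv x \<otimes> g \<otimes> x" and "h' = inv x \<otimes> h \<otimes> x"
  have "g' \<in> carrier G" "g' \<notin> H" "h' \<in> H" and hG: "h \<in> carrier G" and gG: "g \<in> carrier G"
    using g h x by (auto simp: mem g'_def h'_def)
  moreover have "g' \<otimes> h' \<otimes> inv g' = inv x \<otimes> (g \<otimes> h \<otimes> inv g) \<otimes> x"
    using conj_mult[of "inv x" "g \<otimes> h" "inv g"] conj_mult[of "inv x" g h] conj_inv[of "inv x" g] x gG hG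
    by (simp add: g'_def h'_def)
  then have "g' \<otimes> h' \<otimes> inv g' \<in> H"
    using gh by (simp add: mem)
  ultimately have "h' = \<one>"
    using malnormal_conj_mem[OF H, of h' g'] by blast
  then show "h = \<one>"
    using conj_eq_one_iff[of "inv x" h] x hG by (simp add: h'_def)
qed

lemma malnormal_kernel_conj:
  assumes H: "subgroup H G" and x: "x \<in> carrier G" and g: "g \<in> malnormal_kernel G H"
  shows "x \<otimes> g \<otimes> inv x \<in> malnormal_kernel G H"
proof -
  have gG: "g \<in> carrier G" using g malnormal_kernel_subset by blast
  have "y \<otimes> (x \<otimes> g \<otimes> inv x) \<otimes> inv y \<in> H \<Longrightarrow> g = \<one>" if "y \<in> carrier G" for y
    using g that x gG by (auto simp: conj_conj malnormal_kernel_def)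
  then show ?thesis
    using x gG by (auto simp: malnormal_kernel_def conj_eq_one_iff)
qed

lemma malnormal_kernel_conj_set:
  assumes H: "subgroup H G" and x: "x \<in> carrier G"
  shows "malnormal_kernel G (conj_set x H) = malnormal_kernel G H"
proof -
  note HG = subgroup.subset[OF H]
  have "(\<exists>y\<in>carrier G. y \<otimes> g \<otimes> inv y \<in> conj_set x H) \<longleftrightarrow> (\<exists>y\<in>carrier G. y \<otimes> g \<otimes> inv y \<in> H)"
    if g: "g \<in> carrier G" for g
  proof
    assume "\<exists>y\<in>carrier G. y \<otimes> g \<otimes> inv y \<in> conj_set x H"
    then obtain y where y: "y \<in> carrier G" "inv x \<otimes> (y \<otimes> g \<otimes> inv y) \<otimes> inv (inv x) \<in> H"
      using conj_set_mem_iff[OF x HG] x by auto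
    then have "(inv x \<otimes> y) \<otimes> g \<otimes> inv (inv x \<otimes> y) \<in> H"
      using conj_conj[of "inv x" y g] x g by simp
    then show "\<exists>y\<in>carrier G. y \<otimes> g \<otimes> inv y \<in> H"
      using x y by blast
  next
    assume "\<exists>y\<in>carrier G. y \<otimes> g \<otimes> inv y \<in> H"
    then obtain y where y: "y \<in> carrier G" "y \<otimes> g \<otimes> inv y \<in> H" by blast
    then have "(x \<otimes> y) \<otimes> g \<otimes> inv (x \<otimes> y) \<in> conj_set x H"
      using conj_conj[OF x, of y g] g unfolding conj_set_def by (metis imageI)
    then show "\<exists>y\<in>carrier G. y \<otimes> g \<otimes> inv y \<in> conj_set x H"
      using x y by blast
  qed
  then show ?thesis by (auto simp: malnormal_kernel_def)
qed

text \<open>Nontrivial elements of \<open>H\<close> act on the kernel without nontrivial fixed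
  points: if \<open>h\<close> and \<open>k\<close> commute, then \<open>k\<close> conjugates
  \<open>h\<close> to itself, so malnormality puts \<open>k\<close> into \<open>H\<close>.\<close>

lemma malnormal_commute:
  assumes H: "malnormal G H" and h: "h \<in> H" "h \<noteq> \<one>"
    and k: "k \<in> malnormal_kernel G H" "h \<otimes> k \<otimes> inv h = k"
  shows "k = \<one>"
proof -
  note sub = malnormal_subgroup[OF H]
  have G: "h \<in> carrier G" "k \<in> carrier G"
    using h k subgroup.mem_carrier[OF sub] malnormal_kernel_subset by blast+
  have "h \<otimes> k = (h \<otimes> k \<otimes> inv h) \<otimes> h"
    using G by (simp add: m_assoc)
  then have "k \<otimes> h \<otimes> inv k = h \<otimes> k \<otimes> inv k"
    using k(2) by simp
  also have "\<dots> = h"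
    using G by (simp add: m_assoc)
  finally have "k \<in> H"
    using malnormal_conj_mem[OF H h G(2)] h(1) by simp
  then show ?thesis
    using malnormal_kernel_Int[OF sub] k(1) by blast
qed

text \<open>Two conjugates of \<open>H\<close> that share a nontrivial element coincide, because the
  element relating them lies in \<open>H\<close>. Taking a set of sets merges the repetitions, so
  the identity-free conjugates partition the complement of the kernel.\<close>

lemma malnormal_conj_classes:
  fixes H
  assumes H: "malnormal G H"
  defines "\<C> \<equiv> (\<lambda>x. conj_set x H - {\<one>}) ` carrier G"
  shows "\<Union>\<C> = carrier G - malnormal_kernel G H"
    and "\<And>A B. A \<in> \<C> \<Longrightarrow> B \<in> \<C> \<Longrightarrow> A \<noteq> B \<Longrightarrow> A \<inter> B = {}"
proof -
  note sub = malnormal_subgroup[OF H]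
  note HG = subgroup.subset[OF sub]
  show "\<Union>\<C> = carrier G - malnormal_kernel G H"
  proof (intro equalityI subsetI)
    fix g assume "g \<in> \<Union>\<C>"
    then obtain x where "x \<in> carrier G" "g \<in> conj_set x H" "g \<noteq> \<one>"
      by (auto simp: \<C>_def)
    then have "inv x \<in> carrier G" "inv x \<otimes> g \<otimes> inv (inv x) \<in> H" "g \<noteq> \<one>" "g \<in> carrier G"
      by (auto simp: conj_set_mem_iff HG)
    then show "g \<in> carrier G - malnormal_kernel G H"
      unfolding malnormal_kernel_def by blast
  next
    fix g assume "g \<in> carrier G - malnormal_kernel G H"
    then obtain x where x: "x \<in> carrier G" "x \<otimes> g \<otimes> inv x \<in> H" "g \<noteq> \<one>" "g \<in> carrier G"
      by (auto simp: malnormal_kernel_def)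
    then have "g \<in> conj_set (inv x) H - {\<one>}"
      by (simp add: conj_set_mem_iff HG)
    then show "g \<in> \<Union>\<C>"
      unfolding \<C>_def using x inv_closed by blast
  qed
  show "A \<inter> B = {}" if AB: "A \<in> \<C>" "B \<in> \<C>" "A \<noteq> B" for A B
  proof (rule ccontr)
    assume "A \<inter> B \<noteq> {}"
    obtain x y where x: "x \<in> carrier G" "A = conj_set x H - {\<one>}"
      and y: "y \<in> carrier G" "B = conj_set y H - {\<one>}"
      using AB by (auto simp: \<C>_def)
    obtain g where g: "g \<in> A" "g \<in> B" using \<open>A \<inter> B \<noteq> {}\<close> by blast
    then have gG: "g \<in> carrier G" "g \<noteq> \<one>"
      and gx: "inv x \<otimes> g \<otimes> x \<in> H" and gy: "inv y \<otimes> g \<otimes> y \<in> H"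
      using x y by (auto simp: conj_set_mem_iff HG)
    have "(inv y \<otimes> x) \<otimes> (inv x \<otimes> g \<otimes> x) \<otimes> inv (inv y \<otimes> x) = inv y \<otimes> g \<otimes> y"
      using x y gG conj_conj[of "inv y" x "inv x \<otimes> g \<otimes> x"] by (simp add: conj_inv_cancel)
    moreover have "inv x \<otimes> g \<otimes> x \<noteq> \<one>"
      using conj_eq_one_iff[of "inv x" g] x gG by simp
    ultimately have t: "inv y \<otimes> x \<in> H"
      using malnormal_conj_mem[OF H gx, of "inv y \<otimes> x"] gy x y by simp
    have "conj_set x H = conj_set y H"
    proof -
      have "inv x \<otimes> z \<otimes> x \<in> H \<longleftrightarrow> inv y \<otimes> z \<otimes> y \<in> H" if z: "z \<in> carrier G" for z
      proof -
        let ?t = "inv y \<otimes> x"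
        have eq: "?t \<otimes> (inv x \<otimes> z \<otimes> x) \<otimes> inv ?t = inv y \<otimes> z \<otimes> y"
          using x y z conj_conj[of "inv y" x "inv x \<otimes> z \<otimes> x"] by (simp add: conj_inv_cancel)
        have eq': "inv ?t \<otimes> (inv y \<otimes> z \<otimes> y) \<otimes> ?t = inv x \<otimes> z \<otimes> x"
          unfolding eq[symmetric] using x y z by (intro conj_inv_cancel) auto
        have conj_t: "?t \<otimes> a \<otimes> inv ?t \<in> H" "inv ?t \<otimes> a \<otimes> ?t \<in> H" if "a \<in> H" for a
          using that t sub by (simp_all only: subgroup.m_closed subgroup.m_inv_closed)
        show ?thesis
          using conj_t(1)[of "inv x \<otimes> z \<otimes> x"] conj_t(2)[of "inv y \<otimes> z \<otimes> y"]
          unfolding eq eq' by blast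
      qed
      then show ?thesis
        using x y HG by (auto simp: conj_set_mem_iff)
    qed
    then show False using AB x y by simp
  qed
qed

text \<open>All orbits have \<open>p\<close>-power length, so without a fixed point \<open>p\<close>
  would divide \<open>card E\<close>. The action is a plain function with laws on \<open>E\<close>
  only, so that conjugation and translation of cosets can be plugged in directly.\<close>

lemma p_group_fixed_point:
  assumes p: "prime p" "order G = p ^ k" and E: "finite E" "\<not> p dvd card E"
    and closed: "\<And>g x. g \<in> carrier G \<Longrightarrow> x \<in> E \<Longrightarrow> act g x \<in> E"
    and one: "\<And>x. x \<in> E \<Longrightarrow> act \<one> x = x"
    and mult: "\<And>g h x. g \<in> carrier G \<Longrightarrow> h \<in> carrier G \<Longrightarrow> x \<in> E \<Longrightarrow> act (g \<otimes> h) x = act g (act h x)"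
  shows "\<exists>x\<in>E. \<forall>g\<in>carrier G. act g x = x"
proof (rule ccontr)
  assume none: "\<not> ?thesis"
  define \<phi> where "\<phi> = (\<lambda>g. restrict (act g) E)"
  have bij: "\<phi> g \<in> Bij E" if g: "g \<in> carrier G" for g
  proof -
    have "act (inv g) (act g x) = x" "act g (act (inv g) x) = x" if "x \<in> E" for x
      using g that mult[of "inv g" g x] mult[of g "inv g" x] one by auto
    then have "bij_betw (act g) E E"
      using g closed by (intro bij_betwI[where g = "act (inv g)"]) auto
    then show ?thesis
      by (simp add: Bij_def \<phi>_def)
  qed
  have "\<phi> \<in> hom G (BijGroup E)"
  proof (rule homI)
    fix g h assume gh: "g \<in> carrier G" "h \<in> carrier G"
    have "\<phi> (g \<otimes> h) = compose E (\<phi> g) (\<phi> h)"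
      using gh mult closed by (auto simp: \<phi>_def compose_def fun_eq_iff)
    then show "\<phi> (g \<otimes> h) = \<phi> g \<otimes>\<^bsub>BijGroup E\<^esub> \<phi> h"
      using gh bij by (simp add: BijGroup_def)
  qed (simp add: BijGroup_def bij)
  then have "group_hom G (BijGroup E) \<phi>"
    by (intro group_hom.intro group_hom_axioms.intro is_group group_BijGroup)
  then interpret A: group_action G E \<phi>
    by (rule group_action.intro)
  have dvd: "p dvd card O'" if O': "O' \<in> orbits G E \<phi>" for O'
  proof -
    obtain x where x: "x \<in> E" "O' = orbit G \<phi> x"
      using O' by (auto simp: orbits_def)
    have "card O' dvd p ^ k"
      using A.orbit_stabilizer_theorem[OF x(1)] x(2) p(2) by (metis dvd_triv_left)
    then obtain i where i: "card O' = p ^ i"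
      using divides_primepow_nat[OF p(1)] by blast
    have "card O' \<noteq> 1"
    proof
      assume "card O' = 1"
      moreover have "x \<in> O'" using A.orbit_refl x by blast
      ultimately have "O' = {x}" by (auto simp: card_1_singleton_iff)
      then have "\<forall>g\<in>carrier G. act g x = x"
        using x by (auto simp: orbit_def \<phi>_def)
      then show False using none x by blast
    qed
    then show ?thesis using i by (cases i) auto
  qed
  have "\<Union>(orbits G E \<phi>) = E"
    by (rule A.orbits_coverture)
  moreover from this have fin: "finite O'" if "O' \<in> orbits G E \<phi>" for O'
    using that E(1) by (metis finite_subset Union_upper)
  ultimately have "card E = card (\<Union>(orbits G E \<phi>))" by simp
  also have "\<dots> = (\<Sum>O'\<in>orbits G E \<phi>. card O')"
    using A.orbit_partition fin
    by (intro card_Union_disjoint) (auto simp: pairwise_def disjnt_def dest: partition.disjoint_union)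
  also have "p dvd \<dots>" using dvd by (rule dvd_sum)
  finally show False using E by simp
qed

section \<open>Frattini argument and invariant Sylow subgroups\<close>

lemma malnormal_Int:
  assumes M: "subgroup M G" and H: "malnormal G H"
  shows "malnormal (G\<lparr>carrier := M\<rparr>) (M \<inter> H)"
  unfolding malnormal_def
proof (intro conjI ballI impI)
  have "subgroup (M \<inter> H) G"
    using subgroups_Inter_pair[OF M malnormal_subgroup[OF H]] .
  then show "subgroup (M \<inter> H) (G\<lparr>carrier := M\<rparr>)"
    using M by (intro subgroup_incl) auto
  fix g h assume g: "g \<in> carrier (G\<lparr>carrier := M\<rparr>) - M \<inter> H" and h: "h \<in> M \<inter> H"
    and gh: "g \<otimes>\<^bsub>G\<lparr>carrier := M\<rparr>\<^esub> h \<otimes>\<^bsub>G\<lparr>carrier := M\<rparr>\<^esub> inv\<^bsub>G\<lparr>carrier := M\<rparr>\<^esub> g \<in> M \<inter> H"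
  have gM: "g \<in> M" "g \<notin> H" using g by auto
  then have "g \<otimes> h \<otimes> inv g \<in> H"
    using gh M by simp
  then show "h = \<one>\<^bsub>G\<lparr>carrier := M\<rparr>\<^esub>"
    using malnormal_conj_mem[OF H, of h g] gM h subgroup.mem_carrier[OF M] by auto
qed

text \<open>The Frattini argument: \<open>P\<close> and its conjugate by \<open>g\<close> are both
  Sylow subgroups of the normal subgroup \<open>K\<close>, hence conjugate by some \<open>k\<close>
  in \<open>K\<close>, and \<open>k \<otimes> g\<close> normalizes \<open>P\<close>.\<close>

lemma sylow_conj_in_subgroup:
  assumes p: "prime p" "\<not> p dvd m" and K: "subgroup K G" "card K = p ^ a * m"
    and K_conj: "\<And>g k. g \<in> carrier G \<Longrightarrow> k \<in> K \<Longrightarrow> g \<otimes> k \<otimes> inv g \<in> K"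
    and P: "subgroup P G" "P \<subseteq> K" "card P = p ^ a" and g: "g \<in> carrier G"
  shows "\<exists>k\<in>K. \<forall>y\<in>P. (k \<otimes> g) \<otimes> y \<otimes> inv (k \<otimes> g) \<in> P"
proof -
  have KG: "K \<subseteq> carrier G" and PG: "P \<subseteq> carrier G"
    using K P subgroup.subset by blast+
  define Q where "Q = conj_set g P"
  have Q: "subgroup Q G"
    unfolding Q_def using g P(1) by (rule conj_set_subgroup)
  have QK: "Q \<subseteq> K"
    using K_conj[OF g] P(2) by (auto simp: Q_def conj_set_def)
  have cardQ: "card Q = p ^ a"
    using card_conj_set[OF g PG] P(3) by (simp add: Q_def)
  interpret K: finite_group "G\<lparr>carrier := K\<rparr>"
    using K(1) by (rule subgroup_finite_group)
  interpret Q: finite_group "G\<lparr>carrier := Q\<rparr>"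
    using Q by (rule subgroup_finite_group)
  define E where "E = (\<lambda>k. P #> k) ` K"
  have "E = rcosets\<^bsub>G\<lparr>carrier := K\<rparr>\<^esub> P"
    by (auto simp: E_def RCOSETS_def r_coset_def)
  then have "card E * card P = card K"
    using K.lagrange[OF subgroup_incl[OF P(1) K(1) P(2)]] by (simp add: Coset.order_def)
  then have "card E = m"
    using K(2) P(3) p(1) by (simp add: prime_gt_0_nat)
  \<comment> \<open>The inverse makes right translation a left action of \<open>Q\<close> on the
    \<open>m\<close> right cosets of \<open>P\<close> in \<open>K\<close>. A fixed coset
    \<open>P #> k\<close> means that \<open>k\<close> conjugates \<open>Q\<close> into
    \<open>P\<close>.\<close>
  have "\<exists>C\<in>E. \<forall>q\<in>carrier (G\<lparr>carrier := Q\<rparr>). C #> inv q = C"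
  proof (rule Q.p_group_fixed_point[where p = p and k = a])
    show "order (G\<lparr>carrier := Q\<rparr>) = p ^ a"
      using cardQ by (simp add: Coset.order_def)
    show "finite E" using K.fin by (simp add: E_def)
    show "\<not> p dvd card E" using p(2) \<open>card E = m\<close> by simp
    show "C #> inv q \<in> E" if q: "q \<in> carrier (G\<lparr>carrier := Q\<rparr>)" and C: "C \<in> E" for q C
    proof -
      obtain k where k: "k \<in> K" "C = P #> k" using C by (auto simp: E_def)
      have "inv q \<in> K" using q QK subgroup.m_inv_closed[OF K(1)] by auto
      then have "C #> inv q = P #> (k \<otimes> inv q)" "k \<otimes> inv q \<in> K"
        using k PG KG subgroup.m_closed[OF K(1)] coset_mult_assoc[OF PG, of k "inv q"]
        by (auto simp: subset_iff)
      then show ?thesis by (auto simp: E_def)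
    qed
    show "C #> inv \<one>\<^bsub>G\<lparr>carrier := Q\<rparr>\<^esub> = C" if "C \<in> E" for C
      using that KG PG by (auto simp: E_def coset_mult_assoc subset_iff)
    show "C #> inv (q \<otimes>\<^bsub>G\<lparr>carrier := Q\<rparr>\<^esub> r) = C #> inv r #> inv q"
      if "q \<in> carrier (G\<lparr>carrier := Q\<rparr>)" "r \<in> carrier (G\<lparr>carrier := Q\<rparr>)" "C \<in> E" for q r C
    proof -
      have qr: "q \<in> carrier G" "r \<in> carrier G" using that QK KG by auto
      obtain k where "k \<in> K" "C = P #> k" using \<open>C \<in> E\<close> by (auto simp: E_def)
      then have "C \<subseteq> carrier G" using KG PG r_coset_subset_G[of P k] by auto
      then show ?thesis
        using qr by (simp add: coset_mult_assoc inv_mult_group)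
    qed
  qed (use p in auto)
  then obtain k where k: "k \<in> K" and fixed: "\<And>q. q \<in> Q \<Longrightarrow> P #> k #> inv q = P #> k"
    by (auto simp: E_def)
  have kG: "k \<in> carrier G" using k KG by blast
  have "(k \<otimes> g) \<otimes> y \<otimes> inv (k \<otimes> g) \<in> P" if y: "y \<in> P" for y
  proof -
    have yG: "y \<in> carrier G" using y PG by blast
    define q where "q = g \<otimes> y \<otimes> inv g"
    have q: "q \<in> Q" using y by (simp add: q_def Q_def conj_set_def)
    then have qG: "q \<in> carrier G" using QK KG by blast
    have "P #> (k \<otimes> inv q) = P #> k"
      using fixed[OF q] coset_mult_assoc[OF PG kG, of "inv q"] qG by simp
    then have "k \<otimes> inv q \<in> P #> k"
      using rcos_self[OF _ P(1), of "k \<otimes> inv q"] kG qG by simp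
    then obtain z where z: "z \<in> P" "k \<otimes> inv q = z \<otimes> k"
      by (auto simp: r_coset_def)
    then have zG: "z \<in> carrier G" using PG by blast
    have "k \<otimes> inv q \<otimes> inv k = z"
      using z zG kG by (simp add: m_assoc)
    then have "k \<otimes> q \<otimes> inv k = inv z"
      using conj_inv[OF kG, of "inv q"] qG by simp
    then show ?thesis
      using conj_conj[OF kG g yG] subgroup.m_inv_closed[OF P(1) z(1)] by (simp add: q_def)
  qed
  then show ?thesis using k by blast
qed

text \<open>Only an inclusion is demanded; for \<open>P\<close> inside the finite group it is an
  equality, which gives closure under inverses below.\<close>

definition normalizing :: "'a set \<Rightarrow> 'a set"
  where "normalizing P = {g \<in> carrier G. \<forall>y\<in>P. g \<otimes> y \<otimes> inv g \<in> P}"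

lemma subgroup_normalizing:
  assumes P: "P \<subseteq> carrier G"
  shows "subgroup (normalizing P) G"
proof (rule subgroupI)
  show "normalizing P \<subseteq> carrier G" by (auto simp: normalizing_def)
  have "\<one> \<in> normalizing P" using P by (auto simp: normalizing_def)
  then show "normalizing P \<noteq> {}" by blast
  show "g \<otimes> h \<in> normalizing P" if "g \<in> normalizing P" "h \<in> normalizing P" for g h
    using that P by (auto simp: normalizing_def subset_iff simp flip: conj_conj)
  show "inv g \<in> normalizing P" if g: "g \<in> normalizing P" for g
  proof -
    have gG: "g \<in> carrier G" and "conj_set g P \<subseteq> P"
      using g by (auto simp: normalizing_def conj_set_def)
    moreover have "finite P" using P fin by (rule finite_subset)
    ultimately have "conj_set g P = P"
      using card_conj_set[OF gG P] by (intro card_subset_eq) auto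
    then have "inv g \<otimes> y \<otimes> g \<in> P" if "y \<in> P" for y
      using that conj_set_mem_iff[OF gG P, of y] by simp
    then show ?thesis using gG by (auto simp: normalizing_def)
  qed
qed

text \<open>With \<open>K\<close> the kernel of \<open>H\<close>, the kernel of \<open>M \<inter> H\<close> in \<open>M\<close> is contained in \<open>K \<inter> M\<close>, so that
  \<open>|M| \<le> |K \<inter> M| |M \<inter> H|\<close>; the supplement condition gives \<open>|M| \<ge> |K \<inter> M| |H|\<close>.\<close>
lemma malnormal_subset_supplement:
  assumes H: "malnormal G H" and M: "subgroup M G"
    and supp: "\<And>g. g \<in> carrier G \<Longrightarrow> \<exists>k\<in>malnormal_kernel G H. k \<otimes> g \<in> M"
    and meet: "h0 \<in> M" "h0 \<in> H" "h0 \<noteq> \<one>"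
  shows "H \<subseteq> M"
proof -
  let ?M = "G\<lparr>carrier := M\<rparr>"
  let ?K = "malnormal_kernel G H"
  define L where "L = M \<inter> H"
  note sub = malnormal_subgroup[OF H]
  have HG: "H \<subseteq> carrier G" and MG: "M \<subseteq> carrier G" and KG: "?K \<subseteq> carrier G"
    using sub M subgroup.subset malnormal_kernel_subset by blast+
  have K: "subgroup ?K G" using H by (rule frobenius_kernel_subgroup)
  interpret M: finite_group ?M using M by (rule subgroup_finite_group)
  have L: "malnormal ?M L" unfolding L_def using M H by (rule malnormal_Int)
  have L_nt: "L \<noteq> {\<one>}" using meet by (auto simp: L_def)
  have "malnormal_kernel ?M L \<subseteq> ?K \<inter> M"
  proof
    fix m assume m: "m \<in> malnormal_kernel ?M L"
    then have mM: "m \<in> M" by (auto simp: malnormal_kernel_def)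
    have "m \<in> ?K"
    proof (rule ccontr)
      assume "m \<notin> ?K"
      then obtain y where y: "y \<in> carrier G" "y \<otimes> m \<otimes> inv y \<in> H" "m \<noteq> \<one>"
        using mM MG by (auto simp: malnormal_kernel_def)
      \<comment> \<open>\<open>B\<close> is the part in \<open>M\<close> of the conjugate of
        \<open>H\<close> that contains \<open>m\<close>. Both \<open>B\<close> and \<open>L\<close>
        are malnormal in \<open>M\<close> and nontrivial, so some \<open>x\<close> in
        \<open>M\<close> conjugates a nontrivial element of \<open>L\<close> into \<open>B\<close>.
        Malnormality of \<open>H\<close> puts \<open>y \<otimes> x\<close> into \<open>H\<close>,
        and \<open>inv x\<close> then conjugates \<open>m\<close> into \<open>L\<close>.\<close>
      define B where "B = M \<inter> conj_set (inv y) H"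
      have B: "malnormal ?M B"
        unfolding B_def using M malnormal_conj_set[OF _ H, of "inv y"] y by (intro malnormal_Int) auto
      have mem_B: "z \<in> B \<longleftrightarrow> z \<in> M \<and> y \<otimes> z \<otimes> inv y \<in> H" for z
        using conj_set_mem_iff[of "inv y" H z] y HG MG by (auto simp: B_def)
      have "m \<in> B" using mM y by (simp add: mem_B)
      then have "B \<noteq> {\<one>\<^bsub>?M\<^esub>}" using y by auto
      then obtain x a where x: "x \<in> M" and a: "a \<in> L" "a \<noteq> \<one>" and xa: "x \<otimes> a \<otimes> inv x \<in> B"
        using M.malnormal_conj_meet[OF L _ B] L_nt M by auto
      have G: "x \<in> carrier G" "a \<in> carrier G" "m \<in> carrier G"
        using x a mM MG by (auto simp: L_def)
      have "(y \<otimes> x) \<otimes> a \<otimes> inv (y \<otimes> x) \<in> H"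
        using xa conj_conj[OF y(1) G(1,2)] by (simp add: mem_B)
      then have yx: "y \<otimes> x \<in> H"
        using malnormal_conj_mem[OF H _ a(2), of "y \<otimes> x"] a(1) y(1) G by (simp add: L_def)
      have "inv (y \<otimes> x) \<otimes> (y \<otimes> m \<otimes> inv y) \<otimes> (y \<otimes> x) \<in> H"
        using yx y(2) sub by (simp only: subgroup.m_closed subgroup.m_inv_closed)
      moreover have "inv (y \<otimes> x) \<otimes> (y \<otimes> m \<otimes> inv y) \<otimes> (y \<otimes> x) = inv x \<otimes> m \<otimes> x"
        using conj_conj[of "inv x" "inv y" "y \<otimes> m \<otimes> inv y"] y G
        by (simp add: inv_mult_group conj_inv_cancel)
      moreover have "inv x \<otimes> m \<otimes> x \<in> M"
        using x mM M by (simp only: subgroup.m_closed subgroup.m_inv_closed)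
      ultimately have "inv x \<otimes> m \<otimes> inv (inv x) \<in> L"
        using G by (simp add: L_def)
      moreover have "inv x \<in> M" using x M by (simp only: subgroup.m_inv_closed)
      ultimately have "m = \<one>"
        using m M unfolding malnormal_kernel_def by auto
      then show False using y by simp
    qed
    then show "m \<in> ?K \<inter> M" using mM by blast
  qed
  then have "card (malnormal_kernel ?M L) \<le> card (?K \<inter> M)"
    by (intro card_mono) auto
  then have le: "card M \<le> card (?K \<inter> M) * card L"
    using M.card_malnormal_kernel[OF L, symmetric] by (simp add: Coset.order_def mult_le_mono1)
  obtain \<kappa> where \<kappa>: "\<And>h. h \<in> H \<Longrightarrow> \<kappa> h \<in> ?K" "\<And>h. h \<in> H \<Longrightarrow> \<kappa> h \<otimes> h \<in> M"
    using supp HG by (metis subsetD)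
  \<comment> \<open>Modulo the kernel the image of \<open>(h, t)\<close> is \<open>h\<close>, and
    the kernel meets \<open>H\<close> trivially; so \<open>h\<close>, and then \<open>t\<close>, can
    be recovered.\<close>
  let ?f = "\<lambda>(h, t). t \<otimes> (\<kappa> h \<otimes> h)"
  have "inj_on ?f (H \<times> (?K \<inter> M))"
  proof (rule inj_onI, clarsimp)
    fix h t h' t' assume h: "h \<in> H" "h' \<in> H" and t: "t \<in> ?K" "t' \<in> ?K"
      and eq: "t \<otimes> (\<kappa> h \<otimes> h) = t' \<otimes> (\<kappa> h' \<otimes> h')"
    have G: "h \<in> carrier G" "h' \<in> carrier G" "t \<in> carrier G" "t' \<in> carrier G"
      "\<kappa> h \<in> carrier G" "\<kappa> h' \<in> carrier G"
      using h t \<kappa>(1) HG KG by auto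
    define s s' where "s = t \<otimes> \<kappa> h" and "s' = t' \<otimes> \<kappa> h'"
    have s: "s \<in> ?K" "s' \<in> ?K"
      using t h \<kappa>(1) K by (simp_all add: s_def s'_def subgroup.m_closed)
    have sG: "s \<in> carrier G" "s' \<in> carrier G" using s KG by blast+
    have eq': "s \<otimes> h = s' \<otimes> h'"
      using eq G by (simp add: s_def s'_def m_assoc)
    have "inv s' \<otimes> s = inv s' \<otimes> (s \<otimes> h) \<otimes> inv h"
      using sG G by (simp add: m_assoc)
    also have "\<dots> = h' \<otimes> inv h"
      unfolding eq' using sG G by (simp add: m_assoc[symmetric])
    finally have *: "inv s' \<otimes> s = h' \<otimes> inv h" .
    have "inv s' \<otimes> s \<in> ?K"
      using s K by (simp only: subgroup.m_closed subgroup.m_inv_closed)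
    moreover have "inv s' \<otimes> s \<in> H"
      unfolding * using h sub by (simp only: subgroup.m_closed subgroup.m_inv_closed)
    ultimately have "h' \<otimes> inv h = \<one>"
      using malnormal_kernel_Int[OF sub] * by (metis IntI singletonD)
    then have "h' = h"
      using G by (metis inv_equality inv_inv inv_closed)
    then show "h = h' \<and> t = t'"
      using eq G by simp
  qed
  moreover have "?f ` (H \<times> (?K \<inter> M)) \<subseteq> M"
    using \<kappa>(2) subgroup.m_closed[OF M] by auto
  ultimately have "card (H \<times> (?K \<inter> M)) \<le> card M"
    by (rule card_inj_on_le) (rule finite_subgroup[OF M])
  then have "card H * card (?K \<inter> M) \<le> card M"
    by (simp only: card_cartesian_product)
  also note le
  also have "card (?K \<inter> M) * card L = card L * card (?K \<inter> M)"
    by (rule mult.commute)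
  finally have "card H * card (?K \<inter> M) \<le> card L * card (?K \<inter> M)" .
  moreover have "card (?K \<inter> M) > 0"
    using subgroup.one_closed[OF K] subgroup.one_closed[OF M] by (auto simp: card_gt_0_iff)
  ultimately have "card H \<le> card L" by simp
  moreover have "L \<subseteq> H" by (simp add: L_def)
  ultimately have "L = H"
    using finite_subgroup[OF sub] by (intro card_seteq) auto
  then show ?thesis by (auto simp: L_def)
qed

text \<open>By the Frattini argument the normalizer \<open>M\<close> of a Sylow subgroup
  \<open>P\<close> of the kernel supplements the kernel. It therefore contains an element outside
  the kernel, meets some conjugate of \<open>H\<close> nontrivially, and contains that conjugate by
  \<open>malnormal_subset_supplement\<close>. Conjugating back makes a conjugate of \<open>P\<close>
  invariant under \<open>H\<close>.\<close>

lemma exists_invariant_sylow: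
  assumes H: "malnormal G H" "H \<noteq> {\<one>}" and p: "prime p" "p dvd card (malnormal_kernel G H)"
  shows "\<exists>P a. subgroup P G \<and> P \<subseteq> malnormal_kernel G H \<and> card P = p ^ a \<and> a > 0 \<and> H \<subseteq> normalizing P"
proof -
  let ?K = "malnormal_kernel G H"
  note sub = malnormal_subgroup[OF H(1)]
  have HG: "H \<subseteq> carrier G" and KG: "?K \<subseteq> carrier G"
    using sub subgroup.subset malnormal_kernel_subset by blast+
  have K: "subgroup ?K G" using H(1) by (rule frobenius_kernel_subgroup)
  have "card ?K \<noteq> 0" using subgroup.one_closed[OF K] by auto
  define a where "a = multiplicity p (card ?K)"
  have "\<not> is_unit p" using p(1) not_prime_unit by blast
  then obtain m where m: "card ?K = p ^ a * m" "\<not> p dvd m"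
    unfolding a_def using multiplicity_decompose'[OF \<open>card ?K \<noteq> 0\<close>] by blast
  have a: "card ?K = p ^ a * m" "a > 0"
    using m p(2) by (auto intro: gr0I)
  interpret K: finite_group "G\<lparr>carrier := ?K\<rparr>" using K by (rule subgroup_finite_group)
  obtain P where P: "subgroup P (G\<lparr>carrier := ?K\<rparr>)" "card P = p ^ a"
    using sylow_thm[OF p(1) K.is_group, of a m] a K.fin by (auto simp: Coset.order_def)
  have PK: "P \<subseteq> ?K" using subgroup.subset[OF P(1)] by simp
  have PG: "subgroup P G" using incl_subgroup[OF K P(1)] .
  note P_sub = subgroup.subset[OF PG]
  define M where "M = normalizing P"
  have M: "subgroup M G" unfolding M_def using P_sub by (rule subgroup_normalizing)
  have supp: "\<exists>k\<in>?K. k \<otimes> g \<in> M" if g: "g \<in> carrier G" for g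
    using sylow_conj_in_subgroup[OF p(1) m(2) K a(1) malnormal_kernel_conj[OF sub] PG PK P(2) g] KG g
    unfolding M_def normalizing_def by blast
  obtain h where h: "h \<in> H" "h \<noteq> \<one>"
    using H(2) subgroup.one_closed[OF sub] by blast
  then have hG: "h \<in> carrier G" using HG by blast
  obtain k where k: "k \<in> ?K" "k \<otimes> h \<in> M" using supp[OF hG] by blast
  then have kG: "k \<in> carrier G" using KG by blast
  have "k \<otimes> h \<notin> ?K"
  proof
    assume "k \<otimes> h \<in> ?K"
    then have "inv k \<otimes> (k \<otimes> h) \<in> ?K"
      using k K by (simp only: subgroup.m_closed subgroup.m_inv_closed)
    then have "h \<in> ?K" using kG hG by (simp add: m_assoc[symmetric])
    then show False using malnormal_kernel_Int[OF sub] h by blast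
  qed
  then obtain y where y: "y \<in> carrier G" "y \<otimes> (k \<otimes> h) \<otimes> inv y \<in> H" "k \<otimes> h \<noteq> \<one>"
    using kG hG by (auto simp: malnormal_kernel_def)
  let ?H' = "conj_set (inv y) H"
  have mem_H': "z \<in> ?H' \<longleftrightarrow> z \<in> carrier G \<and> y \<otimes> z \<otimes> inv y \<in> H" for z
    using conj_set_mem_iff[of "inv y" H z] y HG by auto
  have "?H' \<subseteq> M"
  proof (rule malnormal_subset_supplement[where ?h0.0 = "k \<otimes> h"])
    show "malnormal G ?H'" using y(1) H(1) by (intro malnormal_conj_set) auto
    show "\<exists>k\<in>malnormal_kernel G ?H'. k \<otimes> g \<in> M" if "g \<in> carrier G" for g
      using supp[OF that] malnormal_kernel_conj_set[OF sub, of "inv y"] y(1) by simp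
    show "k \<otimes> h \<in> ?H'" using y kG hG by (simp add: mem_H')
  qed (use M k y in auto)
  define P' where "P' = conj_set y P"
  have "subgroup P' G"
    unfolding P'_def using y(1) PG by (rule conj_set_subgroup)
  moreover have "P' \<subseteq> ?K"
    using PK malnormal_kernel_conj[OF sub y(1)] by (auto simp: P'_def conj_set_def)
  moreover have "card P' = p ^ a"
    using card_conj_set[OF y(1) P_sub] P(2) by (simp add: P'_def)
  moreover have "H \<subseteq> normalizing P'"
  proof
    fix h assume h: "h \<in> H"
    then have hG: "h \<in> carrier G" using HG by blast
    define w where "w = inv y \<otimes> h \<otimes> y"
    have wG: "w \<in> carrier G" and yw: "y \<otimes> w \<otimes> inv y = h"
      using y(1) hG conj_inv_cancel(2)[of y h] by (simp_all add: w_def)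
    then have "w \<in> M" using \<open>?H' \<subseteq> M\<close> h by (auto simp: mem_H')
    have "h \<otimes> z \<otimes> inv h \<in> P'" if "z \<in> P'" for z
    proof -
      obtain z0 where z0: "z0 \<in> P" "z = y \<otimes> z0 \<otimes> inv y"
        using \<open>z \<in> P'\<close> by (auto simp: P'_def conj_set_def)
      have z0G: "z0 \<in> carrier G" using z0 P_sub by blast
      have hy: "h \<otimes> y = y \<otimes> w"
        using y(1) hG by (simp add: w_def m_assoc[symmetric])
      have "h \<otimes> z \<otimes> inv h = (h \<otimes> y) \<otimes> z0 \<otimes> inv (h \<otimes> y)"
        unfolding z0(2) using hG y(1) z0G by (rule conj_conj)
      also have "\<dots> = y \<otimes> (w \<otimes> z0 \<otimes> inv w) \<otimes> inv y"
        unfolding hy using y(1) wG z0G by (rule conj_conj[symmetric])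
      finally show ?thesis
        using \<open>w \<in> M\<close> z0(1) by (auto simp: P'_def conj_set_def M_def normalizing_def)
    qed
    then show "h \<in> normalizing P'" using hG by (simp add: normalizing_def)
  qed
  ultimately show ?thesis using a(2) by blast
qed

text \<open>If \<open>p\<close> divided both orders, a subgroup of order \<open>p\<close> in
  \<open>H\<close> would act by conjugation on the kernel without the identity, a set whose size is
  \<open>-1\<close> modulo \<open>p\<close>. A fixed point contradicts
  \<open>malnormal_commute\<close>.\<close>

lemma coprime_malnormal_kernel:
  assumes H: "malnormal G H" and p: "prime p" "p dvd card (malnormal_kernel G H)"
  shows "\<not> p dvd card H"
proof
  assume dvd: "p dvd card H"
  let ?K = "malnormal_kernel G H"
  note sub = malnormal_subgroup[OF H]
  have HG: "H \<subseteq> carrier G" using sub by (rule subgroup.subset)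
  interpret H: finite_group "G\<lparr>carrier := H\<rparr>" using sub by (rule subgroup_finite_group)
  obtain m where m: "card H = p ^ 1 * m" using dvd by auto
  obtain Q where Q: "subgroup Q (G\<lparr>carrier := H\<rparr>)" "card Q = p ^ 1"
    using sylow_thm[OF p(1) H.is_group, of 1 m] m H.fin by (auto simp: Coset.order_def)
  have QH: "Q \<subseteq> H" using subgroup.subset[OF Q(1)] by simp
  have QG: "subgroup Q G" using incl_subgroup[OF sub Q(1)] .
  interpret Q: finite_group "G\<lparr>carrier := Q\<rparr>" using QG by (rule subgroup_finite_group)
  have one: "\<one> \<in> ?K" using malnormal_kernel_Int[OF sub] by blast
  have "\<exists>k\<in>?K - {\<one>}. \<forall>q\<in>carrier (G\<lparr>carrier := Q\<rparr>). q \<otimes> k \<otimes> inv q = k"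
  proof (rule Q.p_group_fixed_point[where p = p and k = 1])
    show "order (G\<lparr>carrier := Q\<rparr>) = p ^ 1" using Q by (simp add: Coset.order_def)
    have "Suc (card (?K - {\<one>})) = card ?K" using one by (intro card_Suc_Diff1) auto
    then have "card ?K - card (?K - {\<one>}) = 1" by simp
    then show "\<not> p dvd card (?K - {\<one>})"
      using p dvd_diff_nat[of p "card ?K" "card (?K - {\<one>})"] by auto
    show "q \<otimes> k \<otimes> inv q \<in> ?K - {\<one>}" if "q \<in> carrier (G\<lparr>carrier := Q\<rparr>)" "k \<in> ?K - {\<one>}" for q k
      using that QH HG malnormal_kernel_subset[of H] malnormal_kernel_conj[OF sub, of q k]
      by (auto simp: conj_eq_one_iff subset_iff)
    show "\<one>\<^bsub>G\<lparr>carrier := Q\<rparr>\<^esub> \<otimes> k \<otimes> inv \<one>\<^bsub>G\<lparr>carrier := Q\<rparr>\<^esub> = k" if "k \<in> ?K - {\<one>}" for k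
      using that malnormal_kernel_subset[of H] by auto
    show "(q \<otimes>\<^bsub>G\<lparr>carrier := Q\<rparr>\<^esub> r) \<otimes> k \<otimes> inv (q \<otimes>\<^bsub>G\<lparr>carrier := Q\<rparr>\<^esub> r) =
        q \<otimes> (r \<otimes> k \<otimes> inv r) \<otimes> inv q"
      if "q \<in> carrier (G\<lparr>carrier := Q\<rparr>)" "r \<in> carrier (G\<lparr>carrier := Q\<rparr>)" "k \<in> ?K - {\<one>}" for q r k
      using that QH HG malnormal_kernel_subset[of H] conj_conj[of q r k] by (auto simp: subset_iff)
  qed (use p in auto)
  then obtain k where k: "k \<in> ?K" "k \<noteq> \<one>" and comm: "\<And>q. q \<in> Q \<Longrightarrow> q \<otimes> k \<otimes> inv q = k"
    by auto
  have "Q \<noteq> {\<one>}" using Q(2) p(1) by auto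
  then obtain q where q: "q \<in> Q" "q \<noteq> \<one>"
    using subgroup.one_closed[OF QG] by blast
  have "q \<in> H" using q(1) QH by blast
  then have "k = \<one>"
    using q(2) k(1) comm[OF q(1)] by (rule malnormal_commute[OF H])
  then show False using k(2) by simp
qed

section \<open>Uniqueness of the order of a malnormal subgroup\<close>

text \<open>The contradiction comes from an abelian \<open>p\<close>-group \<open>Z\<close> on which \<open>H\<close> acts without fixed points:
  the product over the orbit of \<open>v \<in> Z\<close> under any nontrivial subgroup of \<open>H\<close> is fixed, hence
  trivial, whereas \<open>H\<close> is partitioned into its kernel and the conjugates of \<open>L\<close>.\<close>
lemma malnormal_no_malnormal:
  assumes H: "malnormal G H" "H \<noteq> {\<one>}" "H \<noteq> carrier G"
    and L: "malnormal (G\<lparr>carrier := H\<rparr>) L" "L \<noteq> {\<one>}"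
  shows "L = H"
proof (rule ccontr)
  assume "L \<noteq> H"
  let ?K = "malnormal_kernel G H"
  let ?H = "G\<lparr>carrier := H\<rparr>"
  note sub = malnormal_subgroup[OF H(1)]
  have HG: "H \<subseteq> carrier G" and KG: "?K \<subseteq> carrier G"
    using sub subgroup.subset malnormal_kernel_subset by blast+
  interpret H: finite_group ?H using sub by (rule subgroup_finite_group)
  have finH: "finite H" using H.fin by simp
  have "card ?K \<noteq> 1"
  proof
    assume "card ?K = 1"
    then have "card H = card (carrier G)"
      using card_malnormal_kernel[OF H(1)] by (simp add: Coset.order_def)
    then show False using card_subset_eq[OF fin HG] H(3) by blast
  qed
  then obtain p where p: "prime p" "p dvd card ?K"
    using prime_factor_nat by blast
  have pH: "\<not> p dvd card H" using coprime_malnormal_kernel[OF H(1) p] .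
  obtain P a where P: "subgroup P G" "P \<subseteq> ?K" "card P = p ^ a" "a > 0" and HP: "H \<subseteq> normalizing P"
    using exists_invariant_sylow[OF H(1,2) p] by blast
  have PG: "P \<subseteq> carrier G" using P(2) KG by blast
  interpret P: finite_group "G\<lparr>carrier := P\<rparr>" using P(1) by (rule subgroup_finite_group)
  have one_P: "\<one> \<in> P" using P(1) by (rule subgroup.one_closed)
  \<comment> \<open>The \<open>p\<close>-group \<open>P\<close> acts on its \<open>p ^ a - 1\<close>
    nontrivial elements by conjugation, so it has a nontrivial central element.\<close>
  have "\<exists>z\<in>P - {\<one>}. \<forall>y\<in>carrier (G\<lparr>carrier := P\<rparr>). y \<otimes> z \<otimes> inv y = z"
  proof (rule P.p_group_fixed_point[where p = p and k = a])
    show "order (G\<lparr>carrier := P\<rparr>) = p ^ a" using P(3) by (simp add: Coset.order_def)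
    have "finite P" using P.fin by simp
    then show "finite (P - {\<one>})" by simp
    have "Suc (card (P - {\<one>})) = card P"
      using one_P \<open>finite P\<close> by (intro card_Suc_Diff1) auto
    then have "card P - card (P - {\<one>}) = 1" by simp
    moreover have "p dvd card P" using P(3,4) by simp
    ultimately show "\<not> p dvd card (P - {\<one>})"
      using p dvd_diff_nat[of p "card P" "card (P - {\<one>})"] by auto
    show "y \<otimes> z \<otimes> inv y \<in> P - {\<one>}" if y: "y \<in> carrier (G\<lparr>carrier := P\<rparr>)" and z: "z \<in> P - {\<one>}" for y z
    proof -
      have "y \<otimes> z \<otimes> inv y \<in> P"
        using y z P(1) by (simp add: subgroup.m_closed subgroup.m_inv_closed)
      moreover have "y \<otimes> z \<otimes> inv y \<noteq> \<one>"
        using y z PG by (subst conj_eq_one_iff) auto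
      ultimately show ?thesis by simp
    qed
    show "\<one>\<^bsub>G\<lparr>carrier := P\<rparr>\<^esub> \<otimes> z \<otimes> inv \<one>\<^bsub>G\<lparr>carrier := P\<rparr>\<^esub> = z" if "z \<in> P - {\<one>}" for z
      using that PG by auto
    show "(x \<otimes>\<^bsub>G\<lparr>carrier := P\<rparr>\<^esub> y) \<otimes> z \<otimes> inv (x \<otimes>\<^bsub>G\<lparr>carrier := P\<rparr>\<^esub> y) = x \<otimes> (y \<otimes> z \<otimes> inv y) \<otimes> inv x"
      if "x \<in> carrier (G\<lparr>carrier := P\<rparr>)" "y \<in> carrier (G\<lparr>carrier := P\<rparr>)" "z \<in> P - {\<one>}" for x y z
      using that PG conj_conj[of x y z] by (auto simp: subset_iff)
  qed (use p in auto)
  then obtain v where v: "v \<in> P" "v \<noteq> \<one>" and v_central: "\<And>y. y \<in> P \<Longrightarrow> y \<otimes> v \<otimes> inv y = v"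
    by auto
  \<comment> \<open>The centre of \<open>P\<close>: abelian, so that products over orbits make sense
    as \<open>finprod\<close>, and characteristic in \<open>P\<close>, hence still normalized by
    \<open>H\<close>.\<close>
  define Z where "Z = {z \<in> P. \<forall>y\<in>P. y \<otimes> z \<otimes> inv y = z}"
  have ZP: "Z \<subseteq> P" and vZ: "v \<in> Z"
    using v v_central by (auto simp: Z_def)
  have ZG: "Z \<subseteq> carrier G" using ZP PG by blast
  have Z: "subgroup Z G"
  proof (rule subgroupI)
    have "\<one> \<in> Z" using one_P PG by (auto simp: Z_def)
    then show "Z \<noteq> {}" by blast
    show "inv z \<in> Z" if "z \<in> Z" for z
    proof -
      have "y \<otimes> inv z \<otimes> inv y = inv z" if "y \<in> P" for y
        using \<open>z \<in> Z\<close> that conj_inv[of y z] PG by (auto simp: Z_def subset_iff)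
      then show ?thesis
        using that subgroup.m_inv_closed[OF P(1)] by (auto simp: Z_def)
    qed
    show "z \<otimes> z' \<in> Z" if "z \<in> Z" "z' \<in> Z" for z z'
    proof -
      have "y \<otimes> (z \<otimes> z') \<otimes> inv y = z \<otimes> z'" if "y \<in> P" for y
        using \<open>z \<in> Z\<close> \<open>z' \<in> Z\<close> that conj_mult[of y z z'] PG by (auto simp: Z_def subset_iff)
      then show ?thesis
        using that subgroup.m_closed[OF P(1)] by (auto simp: Z_def)
    qed
  qed (rule ZG)
  let ?Z = "G\<lparr>carrier := Z\<rparr>"
  interpret Z: comm_group ?Z
  proof (rule group.group_comm_groupI)
    show "Group.group ?Z" using Z by (rule subgroup_imp_group)
    show "x \<otimes>\<^bsub>?Z\<^esub> y = y \<otimes>\<^bsub>?Z\<^esub> x" if "x \<in> carrier ?Z" "y \<in> carrier ?Z" for x y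
    proof -
      have xy: "x \<in> carrier G" "y \<in> carrier G" and "x \<in> P" "y \<in> Z" using that ZP ZG by auto
      have "x \<otimes> y = (x \<otimes> y \<otimes> inv x) \<otimes> x" using xy by (simp add: m_assoc)
      also have "x \<otimes> y \<otimes> inv x = y" using \<open>x \<in> P\<close> \<open>y \<in> Z\<close> by (simp add: Z_def)
      finally show ?thesis by simp
    qed
  qed
  have HZ: "h \<otimes> z \<otimes> inv h \<in> Z" if h: "h \<in> H" and z: "z \<in> Z" for h z
  proof -
    have norm: "g \<otimes> y \<otimes> inv g \<in> P" if "g \<in> H" "y \<in> P" for g y
      using HP that by (auto simp: normalizing_def)
    have G: "h \<in> carrier G" "z \<in> carrier G" using h z HG ZG by auto
    have "y \<otimes> (h \<otimes> z \<otimes> inv h) \<otimes> inv y = h \<otimes> z \<otimes> inv h" if y: "y \<in> P" for y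
    proof -
      define y' where "y' = inv h \<otimes> y \<otimes> h"
      have yG: "y \<in> carrier G" using y PG by blast
      have "y' \<in> P"
        using norm[of "inv h" y] y h G subgroup.m_inv_closed[OF sub] by (simp add: y'_def)
      then have y'G: "y' \<in> carrier G" using PG by blast
      have yh: "y \<otimes> h = h \<otimes> y'"
        using G yG by (simp add: y'_def m_assoc[symmetric])
      have "y \<otimes> (h \<otimes> z \<otimes> inv h) \<otimes> inv y = (y \<otimes> h) \<otimes> z \<otimes> inv (y \<otimes> h)"
        using yG G by (rule conj_conj)
      also have "\<dots> = h \<otimes> (y' \<otimes> z \<otimes> inv y') \<otimes> inv h"
        unfolding yh using G(1) y'G G(2) by (rule conj_conj[symmetric])
      also have "y' \<otimes> z \<otimes> inv y' = z" using z \<open>y' \<in> P\<close> by (simp add: Z_def)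
      finally show ?thesis .
    qed
    then show ?thesis using norm[OF h] z by (auto simp: Z_def)
  qed
  have conj_finprod: "h \<otimes> finprod ?Z f A \<otimes> inv h = finprod ?Z (\<lambda>a. h \<otimes> f a \<otimes> inv h) A"
    if h: "h \<in> H" and A: "finite A" and f: "f \<in> A \<rightarrow> Z" for h A and f :: "'a \<Rightarrow> 'a"
    using A f
  proof (induction A rule: finite_induct)
    case empty
    then show ?case using h HG by auto
  next
    case (insert b A)
    have fA: "f \<in> A \<rightarrow> carrier ?Z" and fb: "f b \<in> carrier ?Z" using insert.prems by auto
    have gA: "(\<lambda>a. h \<otimes> f a \<otimes> inv h) \<in> A \<rightarrow> carrier ?Z" and gb: "h \<otimes> f b \<otimes> inv h \<in> carrier ?Z"
      using insert.prems HZ[OF h] by auto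
    have prod: "finprod ?Z f A \<in> Z" using Z.finprod_closed[OF fA] by simp
    have G: "h \<in> carrier G" "f b \<in> carrier G" "finprod ?Z f A \<in> carrier G"
      using h HG fb ZG prod by auto
    have "finprod ?Z f (insert b A) = f b \<otimes> finprod ?Z f A"
      using Z.finprod_insert[OF insert.hyps fA fb] by simp
    moreover have "finprod ?Z (\<lambda>a. h \<otimes> f a \<otimes> inv h) (insert b A) =
        (h \<otimes> f b \<otimes> inv h) \<otimes> finprod ?Z (\<lambda>a. h \<otimes> f a \<otimes> inv h) A"
      using Z.finprod_insert[OF insert.hyps gA gb] by simp
    moreover have "h \<otimes> finprod ?Z f A \<otimes> inv h = finprod ?Z (\<lambda>a. h \<otimes> f a \<otimes> inv h) A"
      using insert.IH insert.prems by auto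
    ultimately show ?case
      using conj_mult[OF G] by simp
  qed
  define F where "F = (\<lambda>h. h \<otimes> v \<otimes> inv h)"
  have F_closed: "F h \<in> Z" if "h \<in> H" for h
    using HZ[OF that vZ] by (simp add: F_def)
  have F_one: "F \<one> = v" using v PG by (auto simp: F_def)
  \<comment> \<open>Conjugation by a nontrivial \<open>s\<close> in \<open>S\<close> only permutes
    the factors. The product is thus an element of the kernel fixed by \<open>s\<close>, and
    \<open>malnormal_commute\<close> makes it trivial.\<close>
  have prod_subgroup: "finprod ?Z F S = \<one>" if S: "subgroup S G" "S \<subseteq> H" "S \<noteq> {\<one>}" for S
  proof -
    obtain s where s: "s \<in> S" "s \<noteq> \<one>"
      using S subgroup.one_closed[OF S(1)] by blast
    have sG: "s \<in> carrier G" using s S(2) HG by blast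
    have FS: "F \<in> S \<rightarrow> Z" using F_closed S(2) by auto
    have img: "(\<lambda>t. s \<otimes> t) ` S = S"
    proof (intro equalityI subsetI)
      fix t assume t: "t \<in> S"
      then have "t = s \<otimes> (inv s \<otimes> t)"
        using sG S(2) HG by (simp add: m_assoc[symmetric] subset_iff)
      moreover have "inv s \<otimes> t \<in> S"
        using s t S(1) by (simp only: subgroup.m_closed subgroup.m_inv_closed)
      ultimately show "t \<in> (\<lambda>t. s \<otimes> t) ` S" by (rule image_eqI)
    qed (use s subgroup.m_closed[OF S(1)] in auto)
    have inj: "inj_on (\<lambda>t. s \<otimes> t) S"
      using sG S(2) HG by (auto simp: inj_on_def subset_iff)
    have "s \<otimes> finprod ?Z F S \<otimes> inv s = finprod ?Z (\<lambda>t. s \<otimes> F t \<otimes> inv s) S"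
      using s S(2) finite_subgroup[OF S(1)] FS by (intro conj_finprod) auto
    also have "\<dots> = finprod ?Z (\<lambda>t. F (s \<otimes> t)) S"
    proof (rule Z.finprod_cong'[OF refl])
      show "s \<otimes> F t \<otimes> inv s = F (s \<otimes> t)" if "t \<in> S" for t
        unfolding F_def using sG that S(2) HG vZ ZG by (intro conj_conj) auto
      show "(\<lambda>t. F (s \<otimes> t)) \<in> S \<rightarrow> carrier ?Z"
        using s S subgroup.m_closed[OF S(1)] by (auto intro!: F_closed)
    qed
    also have "\<dots> = finprod ?Z F S"
      using Z.finprod_reindex[of F "\<lambda>t. s \<otimes> t" S] FS inj by (simp add: img)
    finally have fixed: "s \<otimes> finprod ?Z F S \<otimes> inv s = finprod ?Z F S" .
    have "finprod ?Z F S \<in> Z" using Z.finprod_closed[of F S] FS by simp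
    then have "finprod ?Z F S \<in> ?K" using ZP P(2) by blast
    moreover have "s \<in> H" using s(1) S(2) by blast
    ultimately show ?thesis
      using fixed s(2) by (intro malnormal_commute[OF H(1)])
  qed
  define N where "N = malnormal_kernel ?H L"
  have L_sub: "subgroup L ?H" using L(1) by (simp add: malnormal_def)
  have LH: "L \<subseteq> H" using subgroup.subset[OF L_sub] by simp
  have NH: "N \<subseteq> H" by (auto simp: N_def malnormal_kernel_def)
  \<comment> \<open>The theorem of Frobenius inside \<open>H\<close>: only as a subgroup does
    \<open>N\<close> fall under \<open>prod_subgroup\<close>.\<close>
  have N: "subgroup N G"
    unfolding N_def using incl_subgroup[OF sub H.frobenius_kernel_subgroup[OF L(1)]] .
  have cards: "card N * card L = card H"
    using H.card_malnormal_kernel[OF L(1)] by (simp add: N_def Coset.order_def)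
  have "N \<noteq> {\<one>}"
  proof
    assume "N = {\<one>}"
    then have "card L = card H" using cards by simp
    then show False using card_subset_eq[OF finH LH] \<open>L \<noteq> H\<close> by blast
  qed
  define \<C> where "\<C> = (\<lambda>x. finite_group.conj_set ?H x L - {\<one>}) ` H"
  have Un: "\<Union>\<C> = H - N"
    using H.malnormal_conj_classes(1)[OF L(1)] by (simp add: \<C>_def N_def)
  have disj: "pairwise disjnt \<C>"
    using H.malnormal_conj_classes(2)[OF L(1)] by (auto simp: \<C>_def pairwise_def disjnt_def)
  have finC: "finite \<C>" using finH by (simp add: \<C>_def)
  have L2: "card L \<ge> 2"
    using H.card_subgroup_gt_1[OF L_sub] L(2) by simp
  \<comment> \<open>The product over a whole conjugate of \<open>L\<close> is trivial; leaving out
    the factor \<open>F \<one> = v\<close> leaves \<open>inv v\<close>.\<close>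
  have each: "card C = card L - 1 \<and> finprod ?Z F C = inv v" if C: "C \<in> \<C>" for C
  proof -
    obtain x where x: "x \<in> H" "C = H.conj_set x L - {\<one>}"
      using C by (auto simp: \<C>_def)
    let ?S = "H.conj_set x L"
    have S: "subgroup ?S ?H" using x(1) L_sub by (intro H.conj_set_subgroup) auto
    have SG: "subgroup ?S G" using incl_subgroup[OF sub S] .
    have SH: "?S \<subseteq> H" using subgroup.subset[OF S] by simp
    have cardS: "card ?S = card L" using H.card_conj_set[of x L] x(1) LH by simp
    have one_S: "\<one> \<in> ?S" using SG by (rule subgroup.one_closed)
    have finS: "finite ?S" using SG by (rule finite_subgroup)
    have "?S \<noteq> {\<one>}" using cardS L2 by auto
    then have "finprod ?Z F ?S = \<one>" using SG SH by (intro prod_subgroup)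
    moreover have "insert \<one> C = ?S" using one_S x(2) by blast
    moreover have FC: "F \<in> C \<rightarrow> carrier ?Z" using F_closed SH x(2) by auto
    then have "finprod ?Z F (insert \<one> C) = F \<one> \<otimes> finprod ?Z F C"
      using finS x(2) F_closed[OF subgroup.one_closed[OF sub]]
      by (subst Z.finprod_insert) auto
    ultimately have "v \<otimes> finprod ?Z F C = \<one>" by (simp add: F_one)
    moreover have "finprod ?Z F C \<in> Z" using Z.finprod_closed[OF FC] by simp
    ultimately have "finprod ?Z F C = inv v"
      using vZ ZG by (metis inv_equality inv_inv inv_comm subsetD)
    moreover have "card C = card L - 1"
      using cardS one_S finS x(2) by simp
    ultimately show ?thesis by simp
  qed
  have "finprod ?Z F (\<Union>\<C>) = finprod ?Z (finprod ?Z F) \<C>"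
  proof (rule Z.finprod_Union_disjoint[OF finC _ disj])
    show "finite A \<and> (\<forall>x\<in>A. F x \<in> carrier ?Z)" if "A \<in> \<C>" for A
    proof -
      have "A \<subseteq> H" using that Un by blast
      then show ?thesis using F_closed finH by (auto intro: finite_subset)
    qed
  qed
  also have "\<dots> = finprod ?Z (\<lambda>_. inv v) \<C>"
    using each subgroup.m_inv_closed[OF Z vZ] by (intro Z.finprod_cong') auto
  also have "\<dots> = inv v [^]\<^bsub>?Z\<^esub> card \<C>"
    using subgroup.m_inv_closed[OF Z vZ] by (intro Z.finprod_const) simp
  finally have prod_diff: "finprod ?Z F (H - N) = inv v [^]\<^bsub>?Z\<^esub> card \<C>"
    by (simp add: Un)
  have "finprod ?Z F H = finprod ?Z F (N \<union> (H - N))"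
    using NH by (simp add: Un_absorb1)
  also have "\<dots> = finprod ?Z F N \<otimes> finprod ?Z F (H - N)"
    using finH F_closed NH by (subst Z.finprod_Un_disjoint) (auto intro: finite_subset)
  \<comment> \<open>The products over \<open>H\<close> and over \<open>N\<close> are both trivial,
    so the blocks in between, each contributing \<open>inv v\<close>, also multiply to
    \<open>\<one>\<close>.\<close>
  finally have pow_C: "inv v [^]\<^bsub>?Z\<^esub> card \<C> = \<one>"
    using prod_subgroup[OF sub subset_refl H(2)] prod_subgroup[OF N NH \<open>N \<noteq> {\<one>}\<close>] prod_diff
      subgroup.m_inv_closed[OF Z vZ] Z.nat_pow_closed[of "inv v" "card \<C>"] ZG
    by auto
  have "card (H - N) = (\<Sum>C\<in>\<C>. card C)"
    unfolding Un[symmetric] using disj finH Un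
    by (intro card_Union_disjoint) (auto intro: finite_subset)
  also have "\<dots> = card \<C> * (card L - 1)"
    using each by simp
  finally have "card \<C> * (card L - 1) = card H - card N"
    using NH finH by (simp add: card_Diff_subset finite_subset)
  also have "\<dots> = card N * (card L - 1)"
    by (simp add: cards[symmetric] diff_mult_distrib2)
  finally have cardC: "card \<C> = card N"
    using L2 by simp
  \<comment> \<open>The number of blocks is \<open>card N\<close>, a divisor of
    \<open>card H\<close> and so prime to \<open>p\<close>, whereas \<open>Z\<close> is a
    \<open>p\<close>-group. Hence \<open>inv v\<close> is killed by two coprime exponents.\<close>
  have "coprime (card \<C>) (card Z)"
  proof -
    have "subgroup Z (G\<lparr>carrier := P\<rparr>)" using Z P(1) ZP by (rule subgroup_incl)
    then have "card (rcosets\<^bsub>G\<lparr>carrier := P\<rparr>\<^esub> Z) * card Z = card P"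
      using P.lagrange by (simp add: Coset.order_def)
    then have Z_dvd: "card Z dvd p ^ a"
      unfolding P(3) by (intro dvdI[of _ _ "card (rcosets\<^bsub>G\<lparr>carrier := P\<rparr>\<^esub> Z)"]) (simp add: mult.commute)
    have "coprime p (card H)"
      using p(1) pH by (simp add: prime_imp_coprime)
    then have cop: "coprime (p ^ a) (card H)" by simp
    have C_dvd: "card \<C> dvd card H" by (simp add: cards[symmetric] cardC)
    have "coprime (card Z) (card \<C>)"
      using Z_dvd C_dvd cop by (rule coprime_divisors)
    then show ?thesis by (simp add: coprime_commute)
  qed
  moreover have "card \<C> \<noteq> 0"
    using cardC cards finH H(2) subgroup.one_closed[OF sub] by auto
  ultimately obtain s t where st: "card \<C> * s = card Z * t + 1"
    using bezout_nat[of "card \<C>" "card Z"] by auto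
  have ivZ: "inv v \<in> carrier ?Z" using subgroup.m_inv_closed[OF Z vZ] by simp
  have finZ: "finite (carrier ?Z)" using finite_subgroup[OF Z] by simp
  have pow_Z: "inv v [^]\<^bsub>?Z\<^esub> card Z = \<one>"
    using Z.power_order_eq_one[OF finZ ivZ] by simp
  have "\<one> = inv v [^]\<^bsub>?Z\<^esub> (card \<C> * s)"
    using pow_C Z.nat_pow_pow[OF ivZ, of "card \<C>" s] Z.nat_pow_one[of s] by simp
  also have "\<dots> = inv v [^]\<^bsub>?Z\<^esub> (card Z * t) \<otimes> inv v"
    unfolding st using Z.nat_pow_mult[OF ivZ, of "card Z * t" 1] ivZ ZG
    by (simp add: subset_iff)
  also have "\<dots> = inv v"
    using pow_Z Z.nat_pow_pow[OF ivZ, of "card Z" t] Z.nat_pow_one[of t] ivZ ZG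
    by (auto simp: subset_iff)
  finally have "inv v = \<one>" by simp
  then have "v = \<one>" using vZ ZG by (metis inv_inv inv_one subsetD)
  then show False using v(2) by simp
qed

theorem malnormal_card_unique:
  assumes A: "malnormal G A" "A \<noteq> {\<one>}" "A \<noteq> carrier G"
    and B: "malnormal G B" "B \<noteq> {\<one>}" "B \<noteq> carrier G"
  shows "card A = card B"
proof -
  note subs = malnormal_subgroup[OF A(1)] malnormal_subgroup[OF B(1)]
  have AG: "A \<subseteq> carrier G" and BG: "B \<subseteq> carrier G"
    using subs subgroup.subset by blast+
  obtain x a where x: "x \<in> carrier G" "a \<in> A" "a \<noteq> \<one>" "x \<otimes> a \<otimes> inv x \<in> B"
    using malnormal_conj_meet[OF A(1,2) B(1,2)] by blast
  define B' where "B' = conj_set (inv x) B"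
  have B': "malnormal G B'"
    unfolding B'_def using x(1) B(1) by (intro malnormal_conj_set) auto
  have "a \<in> B'"
    using conj_set_mem_iff[of "inv x" B a] x AG BG by (auto simp: B'_def)
  have cardB': "card B' = card B"
    unfolding B'_def using x(1) BG by (intro card_conj_set) auto
  have "card B \<noteq> card (carrier G)"
    using card_subset_eq[OF fin BG] B(3) by blast
  then have B'_proper: "B' \<noteq> {\<one>}" "B' \<noteq> carrier G"
    using \<open>a \<in> B'\<close> x(3) cardB' by auto
  have nt: "A \<inter> B' \<noteq> {\<one>}" using \<open>a \<in> B'\<close> x by blast
  have "A \<inter> B' = A"
    using malnormal_no_malnormal[OF A malnormal_Int[OF subs(1) B'] nt] .
  moreover have "B' \<inter> A = B'"
    using malnormal_no_malnormal[OF B' B'_proper malnormal_Int[OF malnormal_subgroup[OF B'] A(1)]] nt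
    by (simp add: Int_commute)
  ultimately have "A = B'" by blast
  then show ?thesis using cardB' by simp
qed

end

section \<open>Frobenius permutation groups\<close>

unbundle no m_inv_syntax

text \<open>From here on \<open>inv\<close> is the inverse of a function, and the group inverse is
  written \<open>m_inv\<close>; \<open>perm_monoid_inv\<close> identifies the two on
  \<open>G\<close>.\<close>

definition perm_monoid :: "(nat \<Rightarrow> nat) set \<Rightarrow> (nat \<Rightarrow> nat) monoid"
  where "perm_monoid G = \<lparr>carrier = G, monoid.mult = (\<circ>), one = id\<rparr>"

lemma perm_monoid_simps [simp]:
  "carrier (perm_monoid G) = G" "monoid.mult (perm_monoid G) = (\<circ>)" "one (perm_monoid G) = id"
  by (simp_all add: perm_monoid_def)

lemma perm_group_bij: "perm_group n G \<Longrightarrow> g \<in> G \<Longrightarrow> bij g"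
  unfolding perm_group_def using permutes_bij by blast

lemma perm_group_finite_group:
  assumes "perm_group n G"
  shows "finite_group (perm_monoid G)"
proof -
  have "group (perm_monoid G)"
  proof (rule groupI)
    fix g assume "g \<in> carrier (perm_monoid G)"
    then show "\<exists>h\<in>carrier (perm_monoid G). h \<otimes>\<^bsub>perm_monoid G\<^esub> g = \<one>\<^bsub>perm_monoid G\<^esub>"
      using assms perm_group_bij[OF assms, of g]
      by (intro bexI[of _ "inv g"]) (auto simp: perm_group_def bij_is_inj)
  qed (use assms in \<open>auto simp: perm_group_def o_assoc\<close>)
  moreover have "finite G"
    by (rule finite_subset[OF _ finite_permutations[of "{1..n}"]])
      (use assms in \<open>auto simp: perm_group_def\<close>)
  ultimately show ?thesis
    by (simp add: finite_group_def finite_group_axioms_def)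
qed

lemma perm_monoid_inv:
  assumes "perm_group n G" "g \<in> G"
  shows "m_inv (perm_monoid G) g = inv g"
proof -
  interpret finite_group "perm_monoid G" using assms(1) by (rule perm_group_finite_group)
  show ?thesis
    using assms perm_group_bij[OF assms] by (intro inv_equality) (auto simp: perm_group_def bij_is_inj)
qed

lemma perm_group_subgroup:
  assumes G: "perm_group n G" and H: "perm_group n H" "H \<subseteq> G"
  shows "subgroup H (perm_monoid G)"
proof -
  interpret finite_group "perm_monoid G" using G by (rule perm_group_finite_group)
  show ?thesis
    using H by (intro subgroupI) (auto simp: perm_monoid_inv[OF G] perm_group_def subset_iff)
qed

lemma frobenius_complement_malnormal:
  assumes G: "perm_group n G" and H: "frobenius_complement n G H"
  shows "malnormal (perm_monoid G) H"
  unfolding malnormal_def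
proof (intro conjI ballI impI)
  have HG: "perm_group n H" "H \<subseteq> G"
    using H by (auto simp: frobenius_complement_def subgroup_of_def)
  show "subgroup H (perm_monoid G)" using G HG by (rule perm_group_subgroup)
  fix g h assume g: "g \<in> carrier (perm_monoid G) - H" and h: "h \<in> H"
    and gh: "g \<otimes>\<^bsub>perm_monoid G\<^esub> h \<otimes>\<^bsub>perm_monoid G\<^esub> m_inv (perm_monoid G) g \<in> H"
  define h' where "h' = g \<circ> h \<circ> inv g"
  have "h' \<in> H" using g gh perm_monoid_inv[OF G, of g] by (simp add: h'_def)
  have "inv g \<circ> g = id"
    using perm_group_bij[OF G, of g] g by (simp add: bij_is_inj)
  then have "inv g \<circ> h' \<circ> g = h"
    unfolding h'_def by (metis comp_assoc comp_id id_comp)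
  then have "h \<in> H \<inter> {inv g \<circ> h \<circ> g | h. h \<in> H}"
    using h \<open>h' \<in> H\<close> by blast
  moreover have "H \<inter> {inv g \<circ> h \<circ> g | h. h \<in> H} = {id}"
    using H g by (auto simp only: frobenius_complement_def perm_monoid_simps)
  ultimately show "h = \<one>\<^bsub>perm_monoid G\<^esub>"
    by (simp only: singleton_iff perm_monoid_simps)
qed

text \<open>If \<open>g\<close> moves \<open>x\<close> and the conjugate of \<open>h\<close> by
  \<open>g\<close> fixes \<open>x\<close>, then \<open>h\<close> fixes both \<open>x\<close> and
  \<open>inv g x\<close>, so it is the identity. By transitivity an element with a fixed point has a
  conjugate in \<open>S\<close>, which identifies the kernel. The order formula is the
  orbit-stabilizer count.\<close>

lemma frobenius_group_stabilizer_malnormal: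
  assumes "frobenius_group n G" and x: "x \<in> {1..n}"
  defines "S \<equiv> {g \<in> G. g x = x}"
  shows "malnormal (perm_monoid G) S" "S \<noteq> {id}" "S \<noteq> G"
    and "malnormal_kernel (perm_monoid G) S = {g \<in> G. g = id \<or> derangement n g}"
    and "card G = n * card S"
proof -
  have G: "perm_group n G" and trans: "\<And>y z. y \<in> {1..n} \<Longrightarrow> z \<in> {1..n} \<Longrightarrow> \<exists>g\<in>G. g y = z"
    and fixed: "\<And>g. g \<in> G \<Longrightarrow> g \<noteq> id \<Longrightarrow> card (fixed_points n g) \<le> 1"
    and nontriv: "\<exists>g\<in>G. g \<noteq> id \<and> fixed_points n g \<noteq> {}"
    using assms(1) by (auto simp: frobenius_group_def transitive_on_def)
  interpret finite_group "perm_monoid G" using G by (rule perm_group_finite_group)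
  have finG: "finite G" using fin by simp
  have perm: "g permutes {1..n}" if "g \<in> G" for g
    using G that by (simp add: perm_group_def)
  have range: "g y \<in> {1..n}" if "g \<in> G" "y \<in> {1..n}" for g y
    using permutes_in_image[OF perm[OF that(1)]] that(2) by blast
  have bij: "bij g" if "g \<in> G" for g using perm_group_bij[OF G that] .
  have inv_G: "inv g \<in> G" if "g \<in> G" for g using G that by (simp add: perm_group_def)
  have comp_G: "g \<circ> h \<in> G" if "g \<in> G" "h \<in> G" for g h using G that by (simp add: perm_group_def)
  have inv_eq: "inv g y = z \<longleftrightarrow> y = g z" if "g \<in> G" for g y z
    using bij[OF that] by (metis bij_inv_eq_iff)
  have unique: "g = id" if "g \<in> G" "g y = y" "g z = z" "y \<in> {1..n}" "z \<in> {1..n}" "y \<noteq> z" for g y z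
  proof (rule ccontr)
    assume "g \<noteq> id"
    have "card {y, z} \<le> card (fixed_points n g)"
      using that by (intro card_mono) (auto simp: fixed_points_def)
    then show False using fixed[OF that(1) \<open>g \<noteq> id\<close>] that(6) by simp
  qed
  have S: "perm_group n S"
    using G inv_eq by (auto simp: S_def perm_group_def)
  have SG: "S \<subseteq> G" by (auto simp: S_def)
  show mal: "malnormal (perm_monoid G) S"
    unfolding malnormal_def
  proof (intro conjI ballI impI)
    show "subgroup S (perm_monoid G)" using G S SG by (rule perm_group_subgroup)
    fix g h assume g: "g \<in> carrier (perm_monoid G) - S" and h: "h \<in> S"
      and gh: "g \<otimes>\<^bsub>perm_monoid G\<^esub> h \<otimes>\<^bsub>perm_monoid G\<^esub> m_inv (perm_monoid G) g \<in> S"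
    have gG: "g \<in> G" "g x \<noteq> x" using g by (auto simp: S_def)
    then have "g (h (inv g x)) = x"
      using gh perm_monoid_inv[OF G gG(1)] by (simp add: S_def)
    then have "h (inv g x) = inv g x" using inv_eq[OF gG(1)] by metis
    moreover have "inv g x \<noteq> x" using inv_eq[OF gG(1)] gG(2) by metis
    ultimately have "h = id"
      using h x range[OF inv_G[OF gG(1)] x] unique[of h "inv g x" x] by (auto simp: S_def)
    then show "h = \<one>\<^bsub>perm_monoid G\<^esub>" by simp
  qed
  obtain g0 y0 where g0: "g0 \<in> G" "g0 \<noteq> id" "y0 \<in> {1..n}" "g0 y0 = y0"
    using nontriv by (auto simp: fixed_points_def)
  show "S \<noteq> {id}"
  proof -
    obtain t where t: "t \<in> G" "t x = y0" using trans[OF x g0(3)] by blast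
    have "(inv t \<circ> g0 \<circ> t) x = x" using t g0(4) inv_eq[OF t(1)] by simp
    then have "inv t \<circ> g0 \<circ> t \<in> S"
      using t g0 inv_G comp_G by (simp add: S_def)
    moreover have "inv t \<circ> g0 \<circ> t \<noteq> id"
    proof
      assume "inv t \<circ> g0 \<circ> t = id"
      then have "g0 (t z) = t z" for z
        using inv_eq[OF t(1)] by (metis comp_apply id_apply)
      then have "g0 = id"
        using bij[OF t(1)] by (metis bij_pointE eq_id_iff)
      then show False using g0 by simp
    qed
    ultimately show ?thesis by blast
  qed
  show "S \<noteq> G"
  proof
    assume "S = G"
    then have "y = x" if "y \<in> {1..n}" for y
      using trans[OF x that] by (auto simp: S_def)
    then have "{1..n} = {x}" using x by blast
    \<comment> \<open>A group fixing \<open>x\<close> throughout is transitive only for a single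
      point, where the identity is the only permutation.\<close>
    then have "g0 = id"
      using perm[OF g0(1)] by (simp add: permutes_sing)
    then show False using g0 by simp
  qed
  show "malnormal_kernel (perm_monoid G) S = {g \<in> G. g = id \<or> derangement n g}"
  proof -
    have "(\<exists>t\<in>G. t \<otimes>\<^bsub>perm_monoid G\<^esub> g \<otimes>\<^bsub>perm_monoid G\<^esub> m_inv (perm_monoid G) t \<in> S) \<longleftrightarrow> \<not> derangement n g"
      if g: "g \<in> G" for g
    proof
      assume "\<exists>t\<in>G. t \<otimes>\<^bsub>perm_monoid G\<^esub> g \<otimes>\<^bsub>perm_monoid G\<^esub> m_inv (perm_monoid G) t \<in> S"
      then obtain t where t: "t \<in> G" "t (g (inv t x)) = x"
        using perm_monoid_inv[OF G] by (auto simp: S_def)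
      then have "g (inv t x) = inv t x" using inv_eq[OF t(1)] by metis
      then show "\<not> derangement n g"
        using range[OF inv_G[OF t(1)] x] by (auto simp: derangement_def fixed_points_def)
    next
      assume "\<not> derangement n g"
      then obtain y where y: "y \<in> {1..n}" "g y = y"
        by (auto simp: derangement_def fixed_points_def)
      obtain t where t: "t \<in> G" "t y = x" using trans[OF y(1) x] by blast
      then have "inv t x = y" using inv_eq[OF t(1)] by metis
      then have "t \<circ> g \<circ> inv t \<in> S"
        using t y g inv_G comp_G by (simp add: S_def)
      then show "\<exists>t\<in>G. t \<otimes>\<^bsub>perm_monoid G\<^esub> g \<otimes>\<^bsub>perm_monoid G\<^esub> m_inv (perm_monoid G) t \<in> S"
        using t(1) perm_monoid_inv[OF G t(1)] by (intro bexI[of _ t]) auto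
    qed
    then show ?thesis by (auto simp: malnormal_kernel_def)
  qed
  show "card G = n * card S"
  proof -
    have fiber: "card {g \<in> G. g x = y} = card S" if y: "y \<in> {1..n}" for y
    proof -
      obtain t where t: "t \<in> G" "t x = y" using trans[OF x y] by blast
      have "{g \<in> G. g x = y} = (\<lambda>s. t \<circ> s) ` S"
      proof (intro equalityI subsetI)
        fix g assume g: "g \<in> {g \<in> G. g x = y}"
        have "(inv t \<circ> g) x = x" using g t inv_eq[OF t(1)] by simp
        then have "inv t \<circ> g \<in> S" using g t inv_G comp_G by (simp add: S_def)
        moreover have "g = t \<circ> (inv t \<circ> g)"
          using bij[OF t(1)] by (simp add: o_assoc bij_is_surj surj_iff[THEN iffD1])
        ultimately show "g \<in> (\<lambda>s. t \<circ> s) ` S" by blast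
      qed (use t comp_G in \<open>auto simp: S_def\<close>)
      moreover have "inj_on (\<lambda>s. t \<circ> s) S"
        using bij[OF t(1)] by (auto simp: inj_on_def fun_eq_iff bij_def)
      ultimately show ?thesis by (simp add: card_image)
    qed
    have "G = (\<Union>y\<in>{1..n}. {g \<in> G. g x = y})" using range[OF _ x] by blast
    then have "card G = card (\<Union>y\<in>{1..n}. {g \<in> G. g x = y})" by simp
    also have "\<dots> = (\<Sum>y\<in>{1..n}. card {g \<in> G. g x = y})"
      using finG by (intro card_UN_disjoint) auto
    also have "\<dots> = n * card S" using fiber by simp
    finally show ?thesis .
  qed
qed

theorem theorem11:
  fixes n :: nat and G H K :: "(nat \<Rightarrow> nat) set"
  assumes "frobenius_group n G"
    and "frobenius_complement n G H"
    and "K = frobenius_kernel G H"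
  shows "disjoint_union_of_complete G (derangement_adj n) (card H) n"
proof -
  have G: "perm_group n G" using assms(1) by (simp add: frobenius_group_def)
  interpret finite_group "perm_monoid G" using G by (rule perm_group_finite_group)
  obtain x where x: "x \<in> {1..n}"
    using assms(1) by (auto simp: frobenius_group_def fixed_points_def)
  define S where "S = {g \<in> G. g x = x}"
  define N where "N = malnormal_kernel (perm_monoid G) S"
  note stab = frobenius_group_stabilizer_malnormal[OF assms(1) x, folded S_def]
  have N_eq: "N = {g \<in> G. g = id \<or> derangement n g}"
    unfolding N_def by (rule stab(4))
  have N: "subgroup N (perm_monoid G)"
    unfolding N_def using stab(1) by (rule frobenius_kernel_subgroup)
  have "id \<in> S" using G by (simp add: S_def perm_group_def)
  moreover have "finite S" using fin by (simp add: S_def)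
  ultimately have "card S > 0" by (auto simp: card_gt_0_iff)
  have cardG: "card G = n * card S" by (rule stab(5))
  then have cardN: "card N = n"
    using card_malnormal_kernel[OF stab(1)] \<open>card S > 0\<close> by (simp add: N_def Coset.order_def)
  \<comment> \<open>The complement enters the count here, through its order: \<open>S\<close> and
    \<open>H\<close> are both proper nontrivial malnormal subgroups.\<close>
  have "card S = card H"
    using assms(2) stab(1-3) frobenius_complement_malnormal[OF G assms(2)]
    by (intro malnormal_card_unique) (auto simp: frobenius_complement_def)
  have NG: "N \<subseteq> carrier (perm_monoid G)" using N by (rule subgroup.subset)
  let ?P = "rcosets\<^bsub>perm_monoid G\<^esub> N"
  have "card ?P * n = card G"
    using lagrange[OF N] cardN by (simp add: Coset.order_def)
  then have cardP: "card ?P = card H"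
    using cardG x \<open>card S = card H\<close> by auto
  have Union: "\<Union>?P = G" using rcosets_part_G[OF N] by simp
  have adj: "derangement_adj n \<sigma> \<pi> \<longleftrightarrow> \<sigma> \<noteq> \<pi> \<and> (\<exists>A\<in>?P. \<sigma> \<in> A \<and> \<pi> \<in> A)"
    if "\<sigma> \<in> G" "\<pi> \<in> G" for \<sigma> \<pi>
  proof -
    have mem: "\<sigma> \<in> N #>\<^bsub>perm_monoid G\<^esub> \<pi> \<longleftrightarrow> \<sigma> \<circ> inv \<pi> \<in> N"
      using subgroup.rcos_module[OF N is_group, of \<pi> \<sigma>] that perm_monoid_inv[OF G that(2)] by simp
    have coset: "(\<exists>A\<in>?P. \<sigma> \<in> A \<and> \<pi> \<in> A) \<longleftrightarrow> \<sigma> \<in> N #>\<^bsub>perm_monoid G\<^esub> \<pi>"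
    proof
      assume "\<exists>A\<in>?P. \<sigma> \<in> A \<and> \<pi> \<in> A"
      then obtain a where a: "a \<in> G" "\<sigma> \<in> N #>\<^bsub>perm_monoid G\<^esub> a" "\<pi> \<in> N #>\<^bsub>perm_monoid G\<^esub> a"
        by (auto simp: RCOSETS_def)
      then show "\<sigma> \<in> N #>\<^bsub>perm_monoid G\<^esub> \<pi>"
        using repr_independence[OF a(3) _ N] by simp
    next
      assume "\<sigma> \<in> N #>\<^bsub>perm_monoid G\<^esub> \<pi>"
      then show "\<exists>A\<in>?P. \<sigma> \<in> A \<and> \<pi> \<in> A"
        using rcos_self[OF _ N, of \<pi>] rcosetsI[OF NG, of \<pi>] that by auto
    qed
    have eq: "\<sigma> \<circ> inv \<pi> = id \<longleftrightarrow> \<sigma> = \<pi>"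
    proof
      assume *: "\<sigma> \<circ> inv \<pi> = id"
      have "\<sigma> = (\<sigma> \<circ> inv \<pi>) \<circ> \<pi>"
        using perm_group_bij[OF G that(2)] by (simp add: comp_assoc bij_is_inj)
      then show "\<sigma> = \<pi>" by (simp add: *)
    next
      assume "\<sigma> = \<pi>"
      then show "\<sigma> \<circ> inv \<pi> = id"
        using perm_group_bij[OF G that(2)] by (simp add: bij_is_surj surj_iff[THEN iffD1])
    qed
    \<comment> \<open>The point \<open>x\<close> shows that the identity has a fixed point; this
      rules out loops and gives the condition \<open>\<sigma> \<noteq> \<pi>\<close>.\<close>
    have no_id: "\<not> derangement n id" using x by (auto simp: derangement_def fixed_points_def)
    have "\<sigma> \<circ> inv \<pi> \<in> G" using that G by (simp add: perm_group_def)
    then have "\<sigma> \<circ> inv \<pi> \<in> N \<longleftrightarrow> \<sigma> \<circ> inv \<pi> = id \<or> derangement n (\<sigma> \<circ> inv \<pi>)"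
      by (simp only: N_eq mem_Collect_eq simp_thms)
    then show ?thesis
      unfolding coset mem derangement_adj_def using eq no_id by metis
  qed
  show ?thesis
    unfolding disjoint_union_of_complete_def
  proof (intro exI[of _ ?P] conjI ballI impI)
    show "?P \<subseteq> Pow G" using Union by blast
    show "A \<inter> B = {}" if "A \<in> ?P" "B \<in> ?P" "A \<noteq> B" for A B
      using rcos_disjoint[OF N] that by (auto simp: pairwise_def disjnt_def)
    show "finite ?P" using Union fin by (simp add: finite_UnionD)
    show "finite A" if "A \<in> ?P" for A
    proof (rule finite_subset)
      show "A \<subseteq> G" using that Union by blast
    qed (use fin in simp)
    show "card A = n" if "A \<in> ?P" for A
      using card_rcosets_equal[OF that NG] cardN by simp
  qed (use Union cardP adj in auto)
qed

end
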